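(* Let $\Omega\subset\mathbb{R}^n$ be a bounded domain with $C^2$ boundary, $0<s_2<s_1<1$, $n>2s_1$, $0<\mu<n$, $1<q<p<2$, and let $a\in L^{\frac{d}{d-q}}(\Omega)$, for some $q<d<2^*_{s_1}$, be a sign-changing function with $a^+:=\max\{a,0\}\not\equiv0$. Let $1<r<2^*_\mu$. Then there exists $\lambda_0>0$ such that for all $\lambda\in(0,\lambda_0)$ and all $\beta>0$, problem $(P_\lambda)$ has at least two non-trivial non-negative solutions.
   Context: $2^*_{s_1}=\frac{2n}{n-2s_1}$, $2^*_\mu=\frac{2n-\mu}{n-2s_1}$. Problem $(P_\lambda)$ is $$(-\Delta)^{s_1}u+\beta(-\Delta)^{s_2}_pu=\lambda a(x)|u|^{q-2}u+\Big(\int_\Omega\frac{|u(y)|^r}{|x-y|^\mu}\,dy\Big)|u|^{r-2}u\ \text{ in }\Omega,\qquad u=0\ \text{ in }\mathbb{R}^n\setminus\Omega,$$ understood in the following weak sense. Let $Q=\mathbb{R}^{2n}\setminus(\Omega^c\times\Omega^c)$, $p_1=2$, $p_2=p$, and for $i=1,2$ let $X_i$ be the space of $u\in L^{p_i}(\mathbb{R}^n)$ with $u=0$ a.e. in $\mathbb{R}^n\setminus\Omega$ and $\|u\|_{X_i}:=\big(\int_Q\frac{|u(x)-u(y)|^{p_i}}{|x-y|^{n+p_is_i}}\,dxdy\big)^{1/p_i}<\infty$ (one has $X_1\subset X_2$ continuously). Put $$\mathcal{K}_i(u,v)=\int_Q\frac{|u(x)-u(y)|^{p_i-2}(u(x)-u(y))(v(x)-v(y))}{|x-y|^{n+p_is_i}}\,dxdy,\qquad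 \mathcal{A}_r(u,v)=\int_\Omega\int_\Omega\frac{|u(y)|^r|u(x)|^{r-2}u(x)v(x)}{|x-y|^\mu}\,dxdy.$$ A solution of $(P_\lambda)$ is a function $u\in X_1$ such that $\mathcal{K}_1(u,v)+\beta\mathcal{K}_2(u,v)-\lambda\int_\Omega a(x)|u|^{q-2}uv\,dx-\mathcal{A}_r(u,v)=0$ for all $v\in X_1$. *)

theory Defs
  imports "HOL-Analysis.Analysis"
begin

definition C2_function :: "('a::real_normed_vector \<Rightarrow> 'b::real_normed_vector) \<Rightarrow> bool" where
  "C2_function f \<longleftrightarrow>
     (\<exists>(D :: 'a \<Rightarrow> 'a \<Rightarrow>\<^sub>L 'b) (H :: 'a \<Rightarrow> 'a \<Rightarrow>\<^sub>L 'a \<Rightarrow>\<^sub>L 'b).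
        (\<forall>x. (f has_derivative blinfun_apply (D x)) (at x)) \<and>
        (\<forall>x. (D has_derivative blinfun_apply (H x)) (at x)) \<and>
        continuous_on UNIV H)"

text \<open>
  A set has \<open>C\<^sup>2\<close> boundary if near each boundary point it is, in suitable orthonormal
  coordinates with last axis \<open>e\<close>, the strict epigraph of a \<open>C\<^sup>2\<close> function of the remaining
  coordinates. A function on the hyperplane orthogonal to \<open>e\<close> is encoded by a function \<open>g\<close> on
  the whole space evaluated at the orthogonal projection \<open>x - (x \<bullet> e) e\<close>.
\<close>
definition C2_boundary :: "'a::euclidean_space set \<Rightarrow> bool" where
  "C2_boundary \<Omega> \<longleftrightarrow>
     (\<forall>x0 \<in> frontier \<Omega>. \<exists>\<rho>>0. \<exists>e g. norm e = 1 \<and> C2_function (g :: 'a \<Rightarrow> real) \<and>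
        \<Omega> \<inter> ball x0 \<rho> = {x \<in> ball x0 \<rho>. g (x - (x \<bullet> e) *\<^sub>R e) < x \<bullet> e})"

definition bounded_C2_domain :: "'a::euclidean_space set \<Rightarrow> bool" where
  "bounded_C2_domain \<Omega> \<longleftrightarrow>
     open \<Omega> \<and> connected \<Omega> \<and> \<Omega> \<noteq> {} \<and> bounded \<Omega> \<and> C2_boundary \<Omega>"

text \<open>
  Elements of \<open>L\<^sup>p(A)\<close> are represented by functions; equality in \<open>L\<^sup>p(A)\<close> is almost-everywhere
  equality on \<open>A\<close>. Values outside \<open>A\<close> are irrelevant.
\<close>
definition Lp_on :: "real \<Rightarrow> 'a::euclidean_space set \<Rightarrow> ('a \<Rightarrow> real) set" where
  "Lp_on p A = {f. f \<in> borel_measurable (lebesgue_on A) \<and>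
                   integrable (lebesgue_on A) (\<lambda>x. \<bar>f x\<bar> powr p)}"

definition sign_changing_on :: "'a::euclidean_space set \<Rightarrow> ('a \<Rightarrow> real) \<Rightarrow> bool" where
  "sign_changing_on A f \<longleftrightarrow>
     \<not> (AE x in lebesgue_on A. max (f x) 0 = 0) \<and>
     \<not> (AE x in lebesgue_on A. max (- f x) 0 = 0)"

definition crit_sobolev :: "real \<Rightarrow> real \<Rightarrow> real" where
  "crit_sobolev n s = 2 * n / (n - 2 * s)"

definition crit_choquard :: "real \<Rightarrow> real \<Rightarrow> real \<Rightarrow> real" where
  "crit_choquard n s \<mu> = (2 * n - \<mu>) / (n - 2 * s)"

definition Q_set :: "'a set \<Rightarrow> ('a \<times> 'a) set" where
  "Q_set \<Omega> = UNIV - (- \<Omega>) \<times> (- \<Omega>)"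

text \<open>
  Pitfall: \<open>0 powr c = 0\<close> for every \<open>c\<close>, so \<open>\<bar>t\<bar> powr (c - 2) * t\<close> is the usual
  \<open>|t|\<^sup>c\<^sup>-\<^sup>2 t\<close> with value \<open>0\<close> at \<open>t = 0\<close>, also for \<open>c \<le> 2\<close>. On the diagonal
  \<open>x = y\<close>, a null set, the quotients below are \<open>0\<close>.

  Finiteness of the Gagliardo seminorm is integrability of its nonnegative integrand.
\<close>
definition X_space :: "(real ^ 'n) set \<Rightarrow> real \<Rightarrow> real \<Rightarrow> (real ^ 'n \<Rightarrow> real) set" where
  "X_space \<Omega> p s =
     {u \<in> Lp_on p UNIV.
        (AE x in lebesgue. x \<notin> \<Omega> \<longrightarrow> u x = 0) \<and>
        integrable (lebesgue_on (Q_set \<Omega>))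
          (\<lambda>(x, y). \<bar>u x - u y\<bar> powr p / norm (x - y) powr (real CARD('n) + p * s))}"

definition K_form ::
    "(real ^ 'n) set \<Rightarrow> real \<Rightarrow> real \<Rightarrow> (real ^ 'n \<Rightarrow> real) \<Rightarrow> (real ^ 'n \<Rightarrow> real) \<Rightarrow> real" where
  "K_form \<Omega> p s u v =
     (LINT (x, y) | lebesgue_on (Q_set \<Omega>).
        \<bar>u x - u y\<bar> powr (p - 2) * (u x - u y) * (v x - v y)
          / norm (x - y) powr (real CARD('n) + p * s))"

definition A_form ::
    "(real ^ 'n) set \<Rightarrow> real \<Rightarrow> real \<Rightarrow> (real ^ 'n \<Rightarrow> real) \<Rightarrow> (real ^ 'n \<Rightarrow> real) \<Rightarrow> real" where
  "A_form \<Omega> \<mu> r u v =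
     (LINT (x, y) | lebesgue_on (\<Omega> \<times> \<Omega>).
        \<bar>u y\<bar> powr r * \<bar>u x\<bar> powr (r - 2) * u x * v x / norm (x - y) powr \<mu>)"

definition weak_solution ::
    "(real ^ 'n) set \<Rightarrow> real \<Rightarrow> real \<Rightarrow> real \<Rightarrow> real \<Rightarrow> real \<Rightarrow> real \<Rightarrow> (real ^ 'n \<Rightarrow> real)
     \<Rightarrow> real \<Rightarrow> real \<Rightarrow> (real ^ 'n \<Rightarrow> real) \<Rightarrow> bool" where
  "weak_solution \<Omega> s1 s2 p q r \<mu> a lam \<beta> u \<longleftrightarrow>
     u \<in> X_space \<Omega> 2 s1 \<and>
     (\<forall>v \<in> X_space \<Omega> 2 s1.
        K_form \<Omega> 2 s1 u v + \<beta> * K_form \<Omega> p s2 u v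
          - lam * (LINT x | lebesgue_on \<Omega>. a x * \<bar>u x\<bar> powr (q - 2) * u x * v x)
          - A_form \<Omega> \<mu> r u v = 0)"

definition nontrivial_nonneg :: "('a::euclidean_space \<Rightarrow> real) \<Rightarrow> bool" where
  "nontrivial_nonneg u \<longleftrightarrow> \<not> (AE x in lebesgue. u x = 0) \<and> (AE x in lebesgue. 0 \<le> u x)"

end

theory Submission
  imports Defs "HOL-Complex_Analysis.Great_Picard"
begin

text \<open>
  The energy is a sum of four homogeneous functionals of degrees \<open>q < p < 2 < 2 * r\<close>. On the sphere
  of a fixed small radius every fibre \<open>t \<mapsto> E (t u)\<close> is increasing as soon as \<open>lam\<close> is small; since the
  term with factor \<open>\<beta>\<close> is nonnegative, the radius and the bound on \<open>lam\<close> do not depend on \<open>\<beta>\<close>. Beyond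
  this sphere each fibre has exactly one critical point, a maximum. The first solution minimises \<open>E\<close>
  in the ball; it is nontrivial because \<open>a\<^sup>+\<close> does not vanish and \<open>q\<close> is the smallest degree. The second
  one minimises \<open>E\<close> among the fibre maxima outside the ball. Replacing \<open>u\<close> by \<open>\<bar>u\<bar>\<close> does not
  increase the energy, so both can be taken nonnegative.

  Everything is subcritical, which keeps the function spaces elementary. Integrability improves
  from exponent \<open>\<sigma>\<close> to \<open>2 + 2 * s * \<sigma> / n\<close> by a Chebyshev argument, and iterating approaches the critical
  exponent; compactness follows from variance estimates on dyadic cells; the Choquard term is dominated
  pointwise by Young's inequality for products.
\<close>

section \<open>The fibre map\<close>

text \<open>The obstacle is that along a minimising sequence only \<open>H\<close> and
  \<open>A\<close> converge to their values at the limit, while \<open>K\<close> and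
  \<open>P\<close> may drop. Comparison along fibres makes lower semicontinuity enough. In the ball,
  an inward step from a point of the sphere lowers \<open>E\<close>, so the minimiser is interior.
  Outside, the limit \<open>w\<close> need not satisfy the constraint, but it can be rescaled to the
  top \<open>t\<close> of its own fibre: the multiples of the sequence by the same \<open>t\<close>
  have energy at most that of the sequence, and their limit bounds \<open>E\<close> at
  \<open>t * w\<close> from above. The two solutions lie on different sides of the sphere, so the
  values of \<open>K\<close> distinguish them. All analysis is done with Borel functions vanishing
  identically off \<Omega>; passing to classes of Lebesgue measurable functions is postponed to the
  end.\<close>

definition fibre_slope :: "real \<Rightarrow> real \<Rightarrow> real \<Rightarrow> real \<Rightarrow> real \<Rightarrow> real \<Rightarrow> real \<Rightarrow> real \<Rightarrow> real" where
  "fibre_slope p q r k b a l t =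
     t powr (2 - q) * k + t powr (p - q) * b - t powr (2 * r - q) * a - l"

text \<open>The energy along the ray through a function whose quadratic, \<open>p\<close>-, Choquard
  and weighted terms are \<open>k\<close>, \<open>b\<close>, \<open>a\<close>, \<open>l\<close>,
  parameters included. Its derivative is \<open>fibre_slope\<close> times
  \<open>t powr (q - 1)\<close>; after this division \<open>l\<close> is an additive constant and
  drops out of all monotonicity questions.\<close>

definition fibre_energy :: "real \<Rightarrow> real \<Rightarrow> real \<Rightarrow> real \<Rightarrow> real \<Rightarrow> real \<Rightarrow> real \<Rightarrow> real \<Rightarrow> real" where
  "fibre_energy p q r k b a l t =
     t powr 2 * k / 2 + t powr p * b / p - t powr q * l / q - t powr (2 * r) * a / (2 * r)"

context
  fixes p q r k b a l :: real
  assumes exps: "1 < q" "q < p" "p < 2" "1 < r"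
    and coef: "0 < k" "0 \<le> b" "0 < a"
begin

private abbreviation "D \<equiv> fibre_slope p q r k b a l"
private abbreviation "F \<equiv> fibre_energy p q r k b a l"

text \<open>The derivative of the slope up to the positive factor \<open>x powr (1 - q)\<close>. In
  this normalisation the \<open>k\<close>-term is constant, the \<open>b\<close>-term nonincreasing
  because \<open>p < 2\<close>, and the subtracted \<open>a\<close>-term increasing because
  \<open>r > 1\<close>.\<close>

private definition "\<theta> x = (2 - q) * k + (p - q) * b * x powr (p - 2) - (2 * r - q) * a * x powr (2 * r - 2)"

private lemma D_deriv: assumes "0 < x" shows "(D has_real_derivative x powr (1 - q) * \<theta> x) (at x)"
proof -
  have "(D has_real_derivative (2 - q) * x powr (2 - q - 1) * k + (p - q) * x powr (p - q - 1) * b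
     - (2 * r - q) * x powr (2 * r - q - 1) * a) (at x)"
    unfolding fibre_slope_def[abs_def] using assms by (auto intro!: derivative_eq_intros)
  moreover have "x powr (p - q - 1) = x powr (1 - q) * x powr (p - 2)"
    "x powr (2 * r - q - 1) = x powr (1 - q) * x powr (2 * r - 2)"
    by (simp_all flip: powr_add add: algebra_simps)
  ultimately show ?thesis unfolding \<theta>_def by (simp add: algebra_simps)
qed

text \<open>A drop from a positive to a nonpositive value forces \<theta> to be negative somewhere
  in between. Since \<theta> is nonincreasing it stays negative, so the slope decreases strictly
  from there on.\<close>

private lemma D_neg_after:
  assumes "0 < t0" "t0 < t" "t < s" "D t0 > 0" "D t \<le> 0"
  shows "D s < 0"
proof -
  have cont: "\<And>x. 0 < x \<Longrightarrow> isCont D x" using D_deriv DERIV_isCont by blast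
  obtain \<xi> where \<xi>: "t0 < \<xi>" "\<xi> < t" "D t - D t0 = (t - t0) * (\<xi> powr (1 - q) * \<theta> \<xi>)"
    using MVT2[of t0 t D "\<lambda>x. x powr (1 - q) * \<theta> x"] D_deriv assms by auto
  have "(t - t0) * (\<xi> powr (1 - q) * \<theta> \<xi>) < 0" using \<xi>(3) assms by linarith
  moreover have "t - t0 > 0" "\<xi> powr (1 - q) > 0" using assms \<xi> by auto
  ultimately have neg: "\<theta> \<xi> < 0" by (simp add: mult_less_0_iff)
  have "\<theta> y < 0" if "\<xi> \<le> y" for y
  proof -
    have "y powr (p - 2) \<le> \<xi> powr (p - 2)" using that exps \<xi> assms by (intro powr_mono2') auto
    moreover have "\<xi> powr (2 * r - 2) \<le> y powr (2 * r - 2)" using that exps \<xi> assms by (intro powr_mono2) auto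
    ultimately have "(p - q) * b * y powr (p - 2) \<le> (p - q) * b * \<xi> powr (p - 2)"
      "(2 * r - q) * a * \<xi> powr (2 * r - 2) \<le> (2 * r - q) * a * y powr (2 * r - 2)"
      using exps coef by (auto intro!: mult_left_mono)
    then show ?thesis using neg unfolding \<theta>_def by linarith
  qed
  then have "\<exists>y. DERIV D x :> y \<and> y < 0" if "t \<le> x" "x \<le> s" for x
    using D_deriv[of x] that assms \<xi> by (intro exI[of _ "x powr (1 - q) * \<theta> x"]) (auto simp: mult_less_0_iff)
  from DERIV_neg_imp_decreasing[OF assms(3) this] assms show ?thesis by auto
qed

lemma fibre_slope_eventually_neg: "\<exists>T>t0. D T < 0"
proof -
  \<comment> \<open>After division by \<open>t powr (2 * r - q)\<close> the exponents of all terms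
    but \<open>- a\<close> are negative, since \<open>2 * r\<close> is the largest degree.\<close>
  have "((\<lambda>t. t powr (2 - 2*r) * k + t powr (p - 2*r) * b - a - l * t powr (q - 2*r)) \<longlongrightarrow> 0 * k + 0 * b - a - l * 0) at_top"
    using exps by (intro tendsto_intros tendsto_neg_powr filterlim_ident) auto
  then have "eventually (\<lambda>t. t powr (2 - 2*r) * k + t powr (p - 2*r) * b - a - l * t powr (q - 2*r) < 0) at_top"
    by (rule order_tendstoD) (use coef in auto)
  with eventually_gt_at_top[of "max t0 1"] have "eventually (\<lambda>t. t > t0 \<and> D t < 0) at_top"
  proof eventually_elim
    case (elim t)
    have "D t = t powr (2 * r - q) * (t powr (2 - 2*r) * k + t powr (p - 2*r) * b - a - l * t powr (q - 2*r))"
      using elim(1) by (simp add: fibre_slope_def algebra_simps flip: powr_add)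
    then show ?case using elim by (auto simp: mult_less_0_iff)
  qed
  then show ?thesis by (auto simp: eventually_at_top_linorder)
qed

lemma fibre_energy_deriv:
  assumes "0 < x" shows "(F has_real_derivative x powr (q - 1) * D x) (at x)"
proof -
  have "(F has_real_derivative 2 * x powr (2 - 1) * k / 2 + p * x powr (p - 1) * b / p
     - q * x powr (q - 1) * l / q - (2 * r) * x powr (2 * r - 1) * a / (2 * r)) (at x)"
    unfolding fibre_energy_def[abs_def] using assms by (auto intro!: derivative_eq_intros)
  moreover have "x powr (q - 1) * x powr (2 - q) = x" "x powr (q - 1) * x powr (p - q) = x powr (p - 1)"
    "x powr (q - 1) * x powr (2 * r - q) = x powr (2 * r - 1)"
    using assms by (simp_all flip: powr_add add: algebra_simps)
  ultimately show ?thesis unfolding fibre_slope_def using exps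
    by (simp add: algebra_simps) (use assms in \<open>simp add: field_simps\<close>)
qed

text \<open>The slope has a zero beyond \<open>t0\<close> by the intermediate value theorem, and
  \<open>D_neg_after\<close> excludes any second sign change, so this zero is the only one and
  maximises \<open>F\<close> on the half line from \<open>t0\<close>.\<close>

lemma fibre_maximum:
  assumes "0 < t0" "D t0 > 0"
  obtains t1 where "t0 < t1" "D t1 = 0" "\<And>t. t0 \<le> t \<Longrightarrow> t < t1 \<Longrightarrow> D t > 0" "\<And>t. t1 < t \<Longrightarrow> D t < 0"
    "\<And>t. t0 \<le> t \<Longrightarrow> F t \<le> F t1"
proof -
  have cont: "\<And>x. 0 < x \<Longrightarrow> isCont D x" using D_deriv DERIV_isCont by blast
  have zero: "\<exists>t. t0 < t \<and> t \<le> s \<and> D t = 0" if "t0 < s" "D s \<le> 0" for s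
  proof -
    have "\<exists>x\<ge>t0. x \<le> s \<and> D x = 0"
      using that assms cont by (intro IVT2) auto
    then show ?thesis using assms by (metis less_le order_less_irrefl)
  qed
  obtain T where "T > t0" "D T < 0" using fibre_slope_eventually_neg by blast
  then obtain t1 where t1: "t0 < t1" "D t1 = 0" using zero[of T] by force
  have neg: "D t < 0" if "t1 < t" for t using D_neg_after[of t0 t1 t] assms t1 that by auto
  have pos: "D t > 0" if t: "t0 \<le> t" "t < t1" for t
  proof (rule ccontr)
    assume "\<not> D t > 0"
    then have "D t \<le> 0" "t0 < t" using t assms by (auto simp: less_le)
    then show False using D_neg_after[of t0 t t1] assms t t1 by auto
  qed
  have der: "DERIV F x :> x powr (q - 1) * D x" if "t0 \<le> x" for x
    using fibre_energy_deriv assms that by auto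
  have "F t \<le> F t1" if "t0 \<le> t" for t
  proof (cases "t \<le> t1")
    case True
    have "\<exists>y. DERIV F x :> y \<and> 0 \<le> y" if x: "t \<le> x" "x \<le> t1" for x
    proof -
      have "0 \<le> D x" using pos[of x] t1(2) x \<open>t0 \<le> t\<close> by (cases "x = t1") auto
      then show ?thesis using der[of x] x \<open>t0 \<le> t\<close>
        by (intro exI[of _ "x powr (q - 1) * D x"]) auto
    qed
    with True show ?thesis using DERIV_nonneg_imp_nondecreasing by blast
  next
    case False
    have "\<exists>y. DERIV F x :> y \<and> y \<le> 0" if x: "t1 \<le> x" "x \<le> t" for x
    proof -
      have "D x \<le> 0" using neg[of x] t1(2) x by (cases "x = t1") auto
      then show ?thesis using der[of x] x t1
        by (intro exI[of _ "x powr (q - 1) * D x"]) (auto simp: mult_le_0_iff)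
    qed
    with False show ?thesis using DERIV_nonpos_imp_nonincreasing[of t1 t F] by auto
  qed
  with t1 neg pos show ?thesis using that by blast
qed

end

section \<open>Two critical points by minimisation\<close>

lemma minimizing_sequence:
  fixes f :: "'b \<Rightarrow> real"
  assumes "B \<noteq> {}" "\<And>x. x \<in> B \<Longrightarrow> m \<le> f x"
  obtains c x where "\<And>n::nat. x n \<in> B" "(\<lambda>n. f (x n)) \<longlonglongrightarrow> c" "\<And>y. y \<in> B \<Longrightarrow> c \<le> f y"
proof -
  define c where "c = Inf (f ` B)"
  have bdd: "bdd_below (f ` B)" using assms by (auto intro!: bdd_belowI[of _ m])
  have c: "c \<le> f y" if "y \<in> B" for y unfolding c_def using bdd that by (auto intro: cInf_lower)
  have "\<exists>x\<in>B. f x < c + 1 / real (Suc n)" for n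
    using cInf_lessD[of "f ` B" "c + 1 / real (Suc n)"] assms(1) unfolding c_def by auto
  then obtain x where x: "\<And>n. x n \<in> B" "\<And>n. f (x n) < c + 1 / real (Suc n)" by metis
  have "(\<lambda>n. c + 1 / real (Suc n)) \<longlonglongrightarrow> c + 0"
    by (intro tendsto_add tendsto_const LIMSEQ_Suc[OF lim_const_over_n])
  then have up: "(\<lambda>n. c + 1 / real (Suc n)) \<longlonglongrightarrow> c" by simp
  have "(\<lambda>n. f (x n)) \<longlonglongrightarrow> c"
  proof (rule tendsto_sandwich[OF _ _ tendsto_const up])
    show "eventually (\<lambda>n. c \<le> f (x n)) sequentially" using c[OF x(1)] by simp
    show "eventually (\<lambda>n. f (x n) \<le> c + 1 / real (Suc n)) sequentially"
      using less_imp_le[OF x(2)] by (intro always_eventually allI)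
  qed
  from that[OF x(1) this c] show ?thesis .
qed

lemma powr_tendsto_0: "0 < (e::real) \<Longrightarrow> ((\<lambda>t. t powr e) \<longlongrightarrow> 0) (at_right 0)"
  by (rule tendsto_zero_powrI[where b = e])
     (auto simp: eventually_at_right_less intro: eventually_mono[OF eventually_at_right_less[of 0]])

text \<open>
  The functionals \<open>K\<close>, \<open>P\<close>, \<open>H\<close>, \<open>A\<close> are homogeneous of degrees \<open>2\<close>, \<open>p\<close>, \<open>q\<close>, \<open>2 * r\<close>, and the primed
  versions are their first variations divided by the degree.
\<close>
locale fibering =
  fixes X :: "('a \<Rightarrow> real) set"
    and K P H A :: "('a \<Rightarrow> real) \<Rightarrow> real"
    and K' P' H' A' :: "('a \<Rightarrow> real) \<Rightarrow> ('a \<Rightarrow> real) \<Rightarrow> real"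
    and p q r C :: real
  assumes exps: "1 < q" "q < p" "p < 2" "1 < r"
    and C_pos: "0 < C"
    and X_line: "u \<in> X \<Longrightarrow> h \<in> X \<Longrightarrow> (\<lambda>x. u x + e * h x) \<in> X"
    and X_scale: "u \<in> X \<Longrightarrow> (\<lambda>x. c * u x) \<in> X"
    and X_abs: "u \<in> X \<Longrightarrow> (\<lambda>x. \<bar>u x\<bar>) \<in> X"
    and K_scale: "u \<in> X \<Longrightarrow> 0 < c \<Longrightarrow> K (\<lambda>x. c * u x) = c powr 2 * K u"
    and P_scale: "u \<in> X \<Longrightarrow> 0 < c \<Longrightarrow> P (\<lambda>x. c * u x) = c powr p * P u"
    and H_scale: "u \<in> X \<Longrightarrow> 0 < c \<Longrightarrow> H (\<lambda>x. c * u x) = c powr q * H u"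
    and A_scale: "u \<in> X \<Longrightarrow> 0 < c \<Longrightarrow> A (\<lambda>x. c * u x) = c powr (2 * r) * A u"
    and K_nonneg: "u \<in> X \<Longrightarrow> 0 \<le> K u"
    and P_nonneg: "u \<in> X \<Longrightarrow> 0 \<le> P u"
    and H_unit_bound: "u \<in> X \<Longrightarrow> K u \<le> 1 \<Longrightarrow> \<bar>H u\<bar> \<le> C"
    and A_unit_bound: "u \<in> X \<Longrightarrow> K u \<le> 1 \<Longrightarrow> \<bar>A u\<bar> \<le> C"
    and A_pos: "u \<in> X \<Longrightarrow> 0 < K u \<Longrightarrow> 0 < A u"
    and K_abs: "u \<in> X \<Longrightarrow> K (\<lambda>x. \<bar>u x\<bar>) \<le> K u"
    and P_abs: "u \<in> X \<Longrightarrow> P (\<lambda>x. \<bar>u x\<bar>) \<le> P u"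
    and H_abs: "u \<in> X \<Longrightarrow> H (\<lambda>x. \<bar>u x\<bar>) = H u"
    and A_abs: "u \<in> X \<Longrightarrow> A (\<lambda>x. \<bar>u x\<bar>) = A u"
    and H_pos: "\<exists>u\<in>X. 0 < H u"
    and compactness: "(\<And>n. U n \<in> X) \<Longrightarrow> (\<And>n x. 0 \<le> U n x) \<Longrightarrow> (\<And>n. K (U n) \<le> M) \<Longrightarrow>
      \<exists>k w \<kappa> \<pi>. strict_mono (k :: nat \<Rightarrow> nat) \<and> w \<in> X \<and> (\<forall>x. 0 \<le> w x) \<and>
        (\<lambda>n. K (U (k n))) \<longlonglongrightarrow> \<kappa> \<and> (\<lambda>n. P (U (k n))) \<longlonglongrightarrow> \<pi> \<and>
        (\<lambda>n. H (U (k n))) \<longlonglongrightarrow> H w \<and> (\<lambda>n. A (U (k n))) \<longlonglongrightarrow> A w \<and> K w \<le> \<kappa> \<and> P w \<le> \<pi>"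
    and K_deriv: "u \<in> X \<Longrightarrow> h \<in> X \<Longrightarrow>
      ((\<lambda>e. K (\<lambda>x. u x + e * h x)) has_real_derivative 2 * K' u h) (at 0)"
    and P_deriv: "u \<in> X \<Longrightarrow> h \<in> X \<Longrightarrow>
      ((\<lambda>e. P (\<lambda>x. u x + e * h x)) has_real_derivative p * P' u h) (at 0)"
    and H_deriv: "u \<in> X \<Longrightarrow> h \<in> X \<Longrightarrow>
      ((\<lambda>e. H (\<lambda>x. u x + e * h x)) has_real_derivative q * H' u h) (at 0)"
    and A_deriv: "u \<in> X \<Longrightarrow> h \<in> X \<Longrightarrow>
      ((\<lambda>e. A (\<lambda>x. u x + e * h x)) has_real_derivative (2 * r) * A' u h) (at 0)"
begin

text \<open>Normalising \<open>K\<close> to 1 turns a bound on the unit ball into a homogeneous one;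
  \<open>G\<close> has degree \<open>s\<close> and \<open>K\<close> degree 2, whence the exponent
  \<open>s / 2\<close>. If \<open>K u = 0\<close>, all multiples of \<open>u\<close> lie in the unit
  ball, and boundedness on this ray forces \<open>G u = 0\<close>.\<close>

lemma bound_by_scaling:
  assumes "u \<in> X" "0 < s"
    and scale: "\<And>c. 0 < c \<Longrightarrow> G (\<lambda>x. c * u x) = c powr s * G u"
    and bound: "\<And>c. 0 < c \<Longrightarrow> K (\<lambda>x. c * u x) \<le> 1 \<Longrightarrow> \<bar>G (\<lambda>x. c * u x)\<bar> \<le> C"
  shows "\<bar>G u\<bar> \<le> C * K u powr (s / 2)"
proof (cases "K u = 0")
  case True
  have "c powr s * \<bar>G u\<bar> \<le> C" if "c > 0" for c
    using bound[OF that] scale[OF that] K_scale[OF assms(1) that] True by (simp add: abs_mult)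
  then have *: "c powr s * \<bar>G u\<bar> \<le> C" if "c > 0" for c using that by blast
  have "G u = 0"
  proof (rule ccontr)
    assume "G u \<noteq> 0"
    \<comment> \<open>The multiple is chosen so that the scaled value of \<open>G\<close> has
      modulus \<open>C + 1\<close>.\<close>
    then have "((C + 1) / \<bar>G u\<bar>) powr (1 / s) > 0" "(((C + 1) / \<bar>G u\<bar>) powr (1 / s)) powr s = (C + 1) / \<bar>G u\<bar>"
      using C_pos assms(2) by (auto simp: powr_powr)
    with *[of "((C + 1) / \<bar>G u\<bar>) powr (1 / s)"] \<open>G u \<noteq> 0\<close> show False by simp
  qed
  then show ?thesis using C_pos by simp
next
  case False
  define c where "c = K u powr (-1/2)"
  have Ku: "K u > 0" using False K_nonneg[OF assms(1)] by simp
  have c: "c > 0" using Ku by (simp add: c_def)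
  have "c powr 2 = K u powr (-1)" unfolding c_def by (simp only: powr_powr) simp
  then have "c powr 2 * K u = 1" using Ku by (simp add: powr_minus)
  then have "K (\<lambda>x. c * u x) \<le> 1" using K_scale[OF assms(1) c] by simp
  then have "c powr s * \<bar>G u\<bar> \<le> C" using bound[OF c] scale[OF c] by (simp add: abs_mult)
  moreover have "c powr s = K u powr (- (s / 2))" unfolding c_def by (simp only: powr_powr) simp
  then have one: "c powr s * K u powr (s / 2) = 1" using Ku by (simp add: powr_minus)
  ultimately have "\<bar>G u\<bar> * (c powr s * K u powr (s/2)) \<le> C * K u powr (s/2)"
    using mult_right_mono[of "c powr s * \<bar>G u\<bar>" C "K u powr (s/2)"] by (simp add: mult_ac)
  then show ?thesis using one by simp
qed

lemma H_bound: "u \<in> X \<Longrightarrow> \<bar>H u\<bar> \<le> C * K u powr (q / 2)"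
  using exps by (intro bound_by_scaling H_unit_bound H_scale X_scale) auto

lemma A_bound: assumes "u \<in> X" shows "\<bar>A u\<bar> \<le> C * K u powr r"
proof -
  have "\<bar>A u\<bar> \<le> C * K u powr (2 * r / 2)"
    using exps assms by (intro bound_by_scaling A_unit_bound A_scale X_scale) auto
  then show ?thesis by simp
qed

lemma A_nonneg: "u \<in> X \<Longrightarrow> 0 \<le> A u"
  using A_pos[of u] A_bound[of u] K_nonneg[of u] by (cases "K u = 0") (auto simp: less_le)

text \<open>The radius at which \<open>A_bound\<close> costs at most half of the quadratic term:
  \<open>C * \<rho> powr (2 * r)\<close> equals half of \<open>\<rho>\<^sup>2\<close>.\<close>

definition \<rho> :: real where "\<rho> = (1 / (2 * C)) powr (1 / (2 * r - 2))"
text \<open>For \<open>lam < lam0\<close> the bound \<open>lam * C * \<rho> powr q\<close> on the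
  weighted term stays strictly below the other half of \<open>\<rho>\<^sup>2\<close>.\<close>

definition lam0 :: real where "lam0 = \<rho> powr (2 - q) / (2 * C)"

lemma rho: "\<rho> > 0" "C * \<rho> powr (2 * r - 2) = 1 / 2"
  using C_pos exps unfolding \<rho>_def by (auto simp: powr_powr)

lemma lam0_pos: "lam0 > 0" using rho C_pos by (simp add: lam0_def)

context
  fixes lam b :: real
  assumes lam: "0 < lam" "lam < lam0" and b: "0 < b"
begin

section \<open>Energy and fibres for fixed parameters\<close>

definition E :: "('a \<Rightarrow> real) \<Rightarrow> real" where
  "E u = K u / 2 + b * P u / p - lam * H u / q - A u / (2 * r)"

definition S :: "('a \<Rightarrow> real) \<Rightarrow> real \<Rightarrow> real" where
  "S u = fibre_slope p q r (K u) (b * P u) (A u) (lam * H u)"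

lemma E_scale: "u \<in> X \<Longrightarrow> 0 < t \<Longrightarrow>
    E (\<lambda>x. t * u x) = fibre_energy p q r (K u) (b * P u) (A u) (lam * H u) t"
  unfolding E_def fibre_energy_def by (simp add: K_scale P_scale H_scale A_scale mult_ac del: powr_numeral)

lemma S_scale: "u \<in> X \<Longrightarrow> 0 < t \<Longrightarrow> S (\<lambda>x. t * u x) 1 = t powr q * S u t"
  unfolding S_def fibre_slope_def
  by (simp add: K_scale P_scale H_scale A_scale algebra_simps flip: powr_add del: powr_numeral)

lemma E_abs: "u \<in> X \<Longrightarrow> E (\<lambda>x. \<bar>u x\<bar>) \<le> E u"
  using K_abs[of u] P_abs[of u] b exps unfolding E_def
  by (auto simp: H_abs A_abs intro!: add_mono divide_right_mono)

text \<open>The factor \<open>\<rho> / sqrt (K u)\<close> moves \<open>u\<close> onto the sphere.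
  There every term becomes a multiple of \<open>K u powr (q / 2)\<close>: the quadratic one has
  coefficient \<open>\<rho> powr (2 - q)\<close>, of which the Choquard term takes at most half and
  the weighted term less than half. The term with \<open>P\<close> has the good sign.\<close>

lemma slope_pos_at_radius:
  assumes "u \<in> X" "0 < K u" shows "0 < S u (\<rho> / sqrt (K u))"
proof -
  define t where "t = \<rho> / sqrt (K u)"
  have t: "t > 0" using rho assms by (simp add: t_def)
  have tp: "t powr s = \<rho> powr s * K u powr (- s / 2)" for s
    using rho assms by (simp add: t_def powr_divide powr_half_sqrt[symmetric] powr_powr powr_minus divide_simps)
  have "t powr (2 - q) * K u = \<rho> powr (2 - q) * (K u powr (- (2 - q) / 2) * K u powr 1)"
    using assms by (simp add: tp)
  also have "K u powr (- (2 - q) / 2) * K u powr 1 = K u powr (q / 2)"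
    by (subst powr_add[symmetric]) (simp add: field_simps)
  finally have 1: "t powr (2 - q) * K u = \<rho> powr (2 - q) * K u powr (q / 2)" .
  have "t powr (2 * r - q) * A u \<le> t powr (2 * r - q) * (C * K u powr r)"
    using A_bound[OF assms(1)] by (intro mult_left_mono) auto
  also have "\<dots> = C * \<rho> powr (2 * r - q) * (K u powr (- (2 * r - q) / 2) * K u powr r)"
    by (simp add: tp)
  also have "K u powr (- (2 * r - q) / 2) * K u powr r = K u powr (q / 2)"
    by (subst powr_add[symmetric]) (simp add: field_simps)
  also have "\<rho> powr (2 * r - q) = \<rho> powr (2 * r - 2) * \<rho> powr (2 - q)"
    by (subst powr_add[symmetric]) simp
  also have "C * (\<rho> powr (2 * r - 2) * \<rho> powr (2 - q)) * K u powr (q / 2)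
      = (C * \<rho> powr (2 * r - 2)) * \<rho> powr (2 - q) * K u powr (q / 2)"
    by (simp only: mult_ac)
  finally have 2: "t powr (2 * r - q) * A u \<le> \<rho> powr (2 - q) * K u powr (q / 2) / 2"
    unfolding rho by simp
  have "lam * C < \<rho> powr (2 - q) / 2" using lam C_pos by (simp add: lam0_def field_simps)
  then have "lam * C * K u powr (q/2) < \<rho> powr (2 - q) / 2 * K u powr (q/2)"
    using assms by (intro mult_strict_right_mono) auto
  moreover have "lam * H u \<le> lam * (C * K u powr (q/2))"
    using H_bound[OF assms(1)] lam by (intro mult_left_mono) auto
  moreover have "0 \<le> t powr (p - q) * (b * P u)" using P_nonneg[OF assms(1)] b by simp
  ultimately have "0 < S u t" using 1 2 unfolding S_def fibre_slope_def by (simp add: algebra_simps)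
  then show ?thesis by (simp add: t_def)
qed

lemma fibre_top:
  assumes "u \<in> X" "0 < K u"
  obtains t where "\<rho> / sqrt (K u) < t" "S u t = 0"
    "\<And>s. \<rho> / sqrt (K u) \<le> s \<Longrightarrow> s < t \<Longrightarrow> 0 < S u s" "\<And>s. t < s \<Longrightarrow> S u s < 0"
    "\<And>s. \<rho> / sqrt (K u) \<le> s \<Longrightarrow> E (\<lambda>x. s * u x) \<le> E (\<lambda>x. t * u x)"
proof -
  have r0: "0 < \<rho> / sqrt (K u)" using rho assms by simp
  show ?thesis
  proof (rule fibre_maximum[OF exps(1,2,3,4) assms(2) _ A_pos[OF assms] r0, of "b * P u" "lam * H u"])
    show "0 \<le> b * P u" using b P_nonneg[OF assms(1)] by simp
    show "0 < fibre_slope p q r (K u) (b * P u) (A u) (lam * H u) (\<rho> / sqrt (K u))"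
      using slope_pos_at_radius[OF assms] by (simp add: S_def)
  next
    fix t assume t: "\<rho> / sqrt (K u) < t" "fibre_slope p q r (K u) (b * P u) (A u) (lam * H u) t = 0"
      "\<And>s. \<rho> / sqrt (K u) \<le> s \<Longrightarrow> s < t \<Longrightarrow> 0 < fibre_slope p q r (K u) (b * P u) (A u) (lam * H u) s"
      "\<And>s. t < s \<Longrightarrow> fibre_slope p q r (K u) (b * P u) (A u) (lam * H u) s < 0"
      "\<And>s. \<rho> / sqrt (K u) \<le> s \<Longrightarrow> fibre_energy p q r (K u) (b * P u) (A u) (lam * H u) s
         \<le> fibre_energy p q r (K u) (b * P u) (A u) (lam * H u) t"
    have "E (\<lambda>x. s * u x) \<le> E (\<lambda>x. t * u x)" if "\<rho> / sqrt (K u) \<le> s" for s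
    proof -
      have "s > 0" "t > 0" using that r0 t(1) by linarith+
      then show ?thesis using t(5)[OF that] E_scale[OF assms(1)] by simp
    qed
    then show thesis using that t unfolding S_def by blast
  qed
qed

lemma E_deriv:
  assumes "u \<in> X" "h \<in> X"
  shows "((\<lambda>e. E (\<lambda>x. u x + e * h x)) has_real_derivative
     K' u h + b * P' u h - lam * H' u h - A' u h) (at 0)"
  unfolding E_def using exps
  by (auto intro!: derivative_eq_intros K_deriv P_deriv H_deriv A_deriv assms)

text \<open>A minimiser over the closed ball is a critical point once it is known to be off the
  sphere, and it is off the sphere because the slope at the radius is positive.\<close>

lemma ball_solution:
  "\<exists>u\<in>X. (\<forall>x. 0 \<le> u x) \<and> 0 < K u \<and> K u < \<rho>\<^sup>2 \<and>
     (\<forall>h\<in>X. K' u h + b * P' u h - lam * H' u h - A' u h = 0)"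
proof -
  define B where "B = {u \<in> X. (\<forall>x. 0 \<le> u x) \<and> K u \<le> \<rho>\<^sup>2}"
  have neg: "\<exists>u\<in>B. E u < 0"
  proof -
    obtain w where w: "w \<in> X" "0 < H w" using H_pos by blast
    define u where "u = (\<lambda>x. \<bar>w x\<bar>)"
    have u: "u \<in> X" "0 < H u" "\<And>x. 0 \<le> u x" using w by (auto simp: u_def X_abs H_abs)
    have "((\<lambda>t. t powr (2 - q) * K u / 2 + t powr (p - q) * (b * P u) / p - lam * H u / q
        - t powr (2 * r - q) * A u / (2 * r)) \<longlongrightarrow> 0 * K u / 2 + 0 * (b * P u) / p - lam * H u / q - 0 * A u / (2 * r)) (at_right 0)"
      using exps by (intro tendsto_intros powr_tendsto_0) auto
    then have "eventually (\<lambda>t. t powr (2 - q) * K u / 2 + t powr (p - q) * (b * P u) / p - lam * H u / q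
        - t powr (2 * r - q) * A u / (2 * r) < 0) (at_right 0)"
      by (rule order_tendstoD) (use u lam exps in auto)
    moreover have "((\<lambda>t. t powr 2 * K u) \<longlongrightarrow> 0 * K u) (at_right 0)"
      by (intro tendsto_mult tendsto_const powr_tendsto_0) auto
    then have "eventually (\<lambda>t. t powr 2 * K u < \<rho>\<^sup>2) (at_right 0)"
      by (rule order_tendstoD) (use rho in auto)
    moreover have "eventually (\<lambda>t::real. 0 < t) (at_right 0)" by (simp add: eventually_at_right_less)
    ultimately have "eventually (\<lambda>t. 0 < t \<and> t powr 2 * K u < \<rho>\<^sup>2 \<and> E (\<lambda>x. t * u x) < 0) (at_right 0)"
    proof eventually_elim
      case (elim t)
      have "E (\<lambda>x. t * u x) = t powr q * (t powr (2 - q) * K u / 2 + t powr (p - q) * (b * P u) / p - lam * H u / q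
        - t powr (2 * r - q) * A u / (2 * r))"
      proof -
        have pw: "t powr 2 = t powr q * t powr (2 - q)" "t powr p = t powr q * t powr (p - q)"
          "t powr (2 * r) = t powr q * t powr (2 * r - q)"
          by (simp_all flip: powr_add del: powr_numeral)
        show ?thesis unfolding E_scale[OF u(1) elim(3)] fibre_energy_def pw by (simp add: algebra_simps)
      qed
      then show ?case using elim by (auto simp: mult_less_0_iff)
    qed
    then obtain t where "0 < t" "t powr 2 * K u < \<rho>\<^sup>2" "E (\<lambda>x. t * u x) < 0"
      using eventually_happens'[OF trivial_limit_at_right_real] by blast
    then show ?thesis using u by (intro bexI[of _ "\<lambda>x. t * u x"]) (auto simp: B_def X_scale K_scale)
  qed
  have lower: "- lam * (C * \<rho> powr q) / q - C * \<rho> powr (2 * r) / (2 * r) \<le> E u" if "u \<in> X" "K u \<le> \<rho>\<^sup>2" for u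
  proof -
    have "\<bar>H u\<bar> \<le> C * (\<rho>\<^sup>2) powr (q / 2)"
      using H_bound[of u] that K_nonneg[of u] C_pos exps
      by (intro order_trans[OF H_bound] mult_left_mono powr_mono2) auto
    also have "(\<rho>\<^sup>2) powr (q / 2) = \<rho> powr q" using rho by (simp add: powr_powr flip: powr_numeral)
    finally have 1: "lam * H u / q \<le> lam * (C * \<rho> powr q) / q" using lam exps
      by (intro divide_right_mono mult_left_mono) auto
    have "\<bar>A u\<bar> \<le> C * (\<rho>\<^sup>2) powr r"
      using A_bound[of u] that K_nonneg[of u] C_pos exps
      by (intro order_trans[OF A_bound] mult_left_mono powr_mono2) auto
    also have "(\<rho>\<^sup>2) powr r = \<rho> powr (2 * r)" using rho by (simp add: powr_powr flip: powr_numeral)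
    finally have 2: "A u / (2 * r) \<le> C * \<rho> powr (2 * r) / (2 * r)" using exps
      by (intro divide_right_mono) auto
    have "0 \<le> b * P u / p" "0 \<le> K u / 2" using that K_nonneg P_nonneg b exps by auto
    with 1 2 show ?thesis unfolding E_def by simp
  qed
  obtain c U where U: "\<And>n::nat. U n \<in> B" "(\<lambda>n. E (U n)) \<longlonglongrightarrow> c" "\<And>y. y \<in> B \<Longrightarrow> c \<le> E y"
    by (rule minimizing_sequence[of B "- lam * (C * \<rho> powr q) / q - C * \<rho> powr (2 * r) / (2 * r)" E])
       (use neg lower in \<open>auto simp: B_def\<close>)
  \<comment> \<open>\<open>B\<close> contains only nonnegative functions, while the variations of
    the minimiser used below need not be nonnegative. Absolute values increase neither
    \<open>K\<close> nor \<open>E\<close>, so \<open>c\<close> is a lower bound on the whole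
    ball.\<close>
  have min: "c \<le> E u" if "u \<in> X" "K u \<le> \<rho>\<^sup>2" for u
    using U(3)[of "\<lambda>x. \<bar>u x\<bar>"] that K_abs[of u] X_abs[of u] E_abs[of u] by (auto simp: B_def)
  obtain k w \<kappa> \<pi> where k: "strict_mono k" and w: "w \<in> X" "\<And>x. 0 \<le> w x"
    and lim: "(\<lambda>n. K (U (k n))) \<longlonglongrightarrow> \<kappa>" "(\<lambda>n. P (U (k n))) \<longlonglongrightarrow> \<pi>" "(\<lambda>n. H (U (k n))) \<longlonglongrightarrow> H w"
      "(\<lambda>n. A (U (k n))) \<longlonglongrightarrow> A w" "K w \<le> \<kappa>" "P w \<le> \<pi>"
    using compactness[of U "\<rho>\<^sup>2"] U(1) unfolding B_def by blast
  have "\<kappa> \<le> \<rho>\<^sup>2" using U(1) by (intro LIMSEQ_le_const2[OF lim(1)]) (auto simp: B_def)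
  then have Kw: "K w \<le> \<rho>\<^sup>2" using lim by simp
  have "(\<lambda>n. E (U (k n))) \<longlonglongrightarrow> \<kappa> / 2 + b * \<pi> / p - lam * H w / q - A w / (2 * r)"
    unfolding E_def using exps by (intro tendsto_intros lim) auto
  moreover have "(\<lambda>n. E (U (k n))) \<longlonglongrightarrow> c" using LIMSEQ_subseq_LIMSEQ[OF U(2) k] by (simp add: o_def)
  ultimately have "c = \<kappa> / 2 + b * \<pi> / p - lam * H w / q - A w / (2 * r)" using LIMSEQ_unique by blast
  moreover have "b * P w / p \<le> b * \<pi> / p" using lim b exps by (intro divide_right_mono mult_left_mono) auto
  \<comment> \<open>\<open>K\<close> and \<open>P\<close> enter \<open>E\<close> with positive
    coefficients, so what they lose in the limit only lowers the energy.\<close>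
  ultimately have Ewc: "E w \<le> c" using lim unfolding E_def by simp
  have "E w < 0" using neg U(3) Ewc by force
  have K0: "0 < K w"
  proof (rule ccontr)
    assume "\<not> 0 < K w"
    then have z: "K w = 0" using K_nonneg[OF w(1)] by simp
    then have "H w = 0" "A w = 0" using H_bound[OF w(1)] A_bound[OF w(1)] by auto
    then have "0 \<le> E w" using z P_nonneg[OF w(1)] b exps by (simp add: E_def)
    with \<open>E w < 0\<close> show False by simp
  qed
  \<comment> \<open>On the sphere the fibre map increases at factor 1, so \<open>(1 - h) * w\<close>
    would remain in the ball with energy below the infimum \<open>c\<close>.\<close>
  have Klt: "K w < \<rho>\<^sup>2"
  proof (rule ccontr)
    assume "\<not> K w < \<rho>\<^sup>2"
    then have Kw2: "K w = \<rho>\<^sup>2" using Kw by simp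
    then have "0 < S w 1" using slope_pos_at_radius[OF w(1) K0] rho by simp
    moreover have "0 \<le> b * P w" using b P_nonneg[OF w(1)] by simp
    ultimately obtain d where d: "d > 0" "\<And>h. h > 0 \<Longrightarrow> h < d \<Longrightarrow>
        fibre_energy p q r (K w) (b * P w) (A w) (lam * H w) (1 - h) < fibre_energy p q r (K w) (b * P w) (A w) (lam * H w) 1"
      using DERIV_pos_inc_left[OF fibre_energy_deriv[OF exps, where x = 1 and k = "K w" and b = "b * P w" and a = "A w" and l = "lam * H w"]]
        K0 A_pos[OF w(1) K0] by (auto simp: S_def)
    define h where "h = min (d/2) (1/2)"
    have h: "0 < h" "h < d" "h < 1" using d by (auto simp: h_def)
    have "E (\<lambda>x. (1 - h) * w x) < E (\<lambda>x. 1 * w x)"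
      using d(2)[OF h(1,2)] h E_scale[OF w(1)] by (metis diff_gt_0_iff_gt zero_less_one)
    moreover have "c \<le> E (\<lambda>x. (1 - h) * w x)"
    proof (rule min)
      have "(1 - h) powr 2 * K w \<le> 1 * K w" using h K0
        by (intro mult_right_mono) (auto simp: power_le_one)
      then show "K (\<lambda>x. (1 - h) * w x) \<le> \<rho>\<^sup>2" using h K_scale[OF w(1), of "1 - h"] Kw by simp
    qed (use X_scale w in auto)
    ultimately show False using Ewc by simp
  qed
  have "K' w h + b * P' w h - lam * H' w h - A' w h = 0" if h: "h \<in> X" for h
  proof -
    have "isCont (\<lambda>e. K (\<lambda>x. w x + e * h x)) 0" using K_deriv[OF w(1) h] DERIV_isCont by blast
    then have "eventually (\<lambda>e. K (\<lambda>x. w x + e * h x) < \<rho>\<^sup>2) (at 0)"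
      unfolding isCont_def by (rule order_tendstoD) (use Klt in auto)
    then obtain d where d: "d > 0" "\<And>e. e \<noteq> 0 \<Longrightarrow> \<bar>e\<bar> < d \<Longrightarrow> K (\<lambda>x. w x + e * h x) < \<rho>\<^sup>2"
      unfolding eventually_at by (auto simp: dist_real_def)
    have "E (\<lambda>x. w x + 0 * h x) \<le> E (\<lambda>x. w x + e * h x)" if "\<bar>0 - e\<bar> < d" for e
    proof (cases "e = 0")
      case False
      then have "c \<le> E (\<lambda>x. w x + e * h x)" using d(2)[of e] that
        by (intro min X_line w h) auto
      then show ?thesis using Ewc by simp
    qed simp
    then show ?thesis using DERIV_local_min[OF E_deriv[OF w(1) h] d(1)] by blast
  qed
  then show ?thesis using w K0 Klt by blast
qed


section \<open>Fibre maxima outside the ball\<close>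

definition N :: "('a \<Rightarrow> real) set" where
  "N = {u \<in> X. \<rho>\<^sup>2 < K u \<and> S u 1 = 0}"

lemma fibre_top_in_N:
  assumes "u \<in> X" "0 < K u" "\<rho> / sqrt (K u) < t" "S u t = 0"
  shows "(\<lambda>x. t * u x) \<in> N"
proof -
  have t: "0 < t" using assms rho by (meson divide_pos_pos less_trans real_sqrt_gt_zero)
  have "\<rho> < t * sqrt (K u)" using assms by (simp add: field_simps)
  then have "\<rho>\<^sup>2 < (t * sqrt (K u))\<^sup>2" using rho by (intro power_strict_mono) auto
  then have "\<rho>\<^sup>2 < t\<^sup>2 * K u" using assms by (simp add: power_mult_distrib)
  then show ?thesis using assms t by (simp add: N_def X_scale K_scale S_scale)
qed

text \<open>An element of \<open>N\<close> is the top of its own fibre: its slope vanishes at factor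
  1, which lies beyond the radius, and \<open>fibre_top\<close> leaves only one zero there.\<close>

lemma N_max:
  assumes "u \<in> N" "\<rho> / sqrt (K u) \<le> s"
  shows "E (\<lambda>x. s * u x) \<le> E u"
proof -
  have u: "u \<in> X" "\<rho>\<^sup>2 < K u" "S u 1 = 0" using assms by (auto simp: N_def)
  have K0: "0 < K u" using u by (meson zero_le_power2 order.strict_trans1)
  have 1: "\<rho> / sqrt (K u) < 1" using u(2) K0 rho real_less_rsqrt by simp
  obtain t where t: "\<rho> / sqrt (K u) < t" "S u t = 0"
    "\<And>s. \<rho> / sqrt (K u) \<le> s \<Longrightarrow> s < t \<Longrightarrow> 0 < S u s" "\<And>s. t < s \<Longrightarrow> S u s < 0"
    "\<And>s. \<rho> / sqrt (K u) \<le> s \<Longrightarrow> E (\<lambda>x. s * u x) \<le> E (\<lambda>x. t * u x)"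
    using fibre_top[OF u(1) K0] by blast
  have "t = 1" using t(3)[of 1] t(4)[of 1] 1 u(3) by (cases t "1::real" rule: linorder_cases) auto
  then show ?thesis using t(5)[OF assms(2)] by simp
qed

text \<open>On \<open>N\<close> the vanishing slope expresses \<open>A u\<close> by the other terms.
  What remains has the positive coefficient \<open>1/2 - 1/(2 * r)\<close> at \<open>K\<close>, a
  nonnegative one at \<open>P\<close>, and a weighted term of order \<open>K u powr (q / 2)\<close>,
  which is sublinear in \<open>K u\<close>.\<close>

lemma N_coercive: "\<exists>c1>0. \<exists>c2. \<forall>u\<in>N. c1 * K u - c2 \<le> E u"
proof -
  define c1 where "c1 = (1 / 2 - 1 / (2 * r))"
  define c where "c = lam * (1 / q - 1 / (2 * r)) * C"
  have c1: "c1 > 0" using exps by (simp add: c1_def field_simps)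
  have hq: "0 < 1 / q - 1 / (2 * r)" using exps by (simp add: field_simps)
  then have c: "c > 0" using C_pos lam by (simp add: c_def)
  \<comment> \<open>The value of \<open>K u\<close> at which the weighted bound equals half of the
    linear term: above it the half absorbs the bound, below it the bound is at most
    \<open>c * T powr (q / 2)\<close>.\<close>
  define T where "T = (2 * c / c1) powr (1 / (1 - q / 2))"
  have T: "T > 0" "c * T powr (q / 2 - 1) = c1 / 2"
  proof -
    show "T > 0" using c c1 by (simp add: T_def)
    have "T powr (q / 2 - 1) = (2 * c / c1) powr (- 1)" unfolding T_def powr_powr using exps
      by (intro arg_cong2[where f = "(powr)"]) (auto simp: field_simps)
    then show "c * T powr (q / 2 - 1) = c1 / 2" using c c1 by (simp add: powr_minus field_simps)
  qed
  have "c1 / 2 * K u - c * T powr (q / 2) \<le> E u" if "u \<in> N" for u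
  proof -
    have u: "u \<in> X" "\<rho>\<^sup>2 < K u" "S u 1 = 0" using that by (auto simp: N_def)
    have K0: "0 < K u" using u by (meson zero_le_power2 order.strict_trans1)
    have A: "A u = K u + b * P u - lam * H u" using u(3) by (simp add: S_def fibre_slope_def)
    have "E u = c1 * K u + b * (1 / p - 1 / (2 * r)) * P u - lam * (1 / q - 1 / (2 * r)) * H u"
      unfolding E_def A c1_def using exps by (simp add: field_simps)
    moreover have "0 \<le> b * (1 / p - 1 / (2 * r)) * P u"
    proof -
      have "0 \<le> 1 / p - 1 / (2 * r)" using exps by (simp add: field_simps)
      then show ?thesis using b P_nonneg[OF u(1)] by simp
    qed
    moreover have "lam * (1 / q - 1 / (2 * r)) * H u \<le> lam * (1 / q - 1 / (2 * r)) * (C * K u powr (q / 2))"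
      using H_bound[OF u(1)] lam hq by (intro mult_left_mono) auto
    ultimately have 1: "c1 * K u - c * K u powr (q / 2) \<le> E u" by (simp add: c_def mult_ac)
    have "c * K u powr (q / 2) \<le> c1 / 2 * K u + c * T powr (q / 2)"
    proof (cases "K u \<le> T")
      case True
      then have "K u powr (q / 2) \<le> T powr (q / 2)" using K0 exps by (intro powr_mono2) auto
      then have "c * K u powr (q / 2) \<le> c * T powr (q / 2)" using c by (intro mult_left_mono) auto
      moreover have "0 \<le> c1 / 2 * K u" using c1 K0 by simp
      ultimately show ?thesis by linarith
    next
      case False
      have "K u powr (q / 2) = K u powr (q / 2 - 1) * K u powr 1" by (subst powr_add[symmetric]) simp
      also have "\<dots> \<le> T powr (q / 2 - 1) * K u powr 1" using False T exps
        by (intro mult_right_mono powr_mono2') auto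
      finally have "c * K u powr (q / 2) \<le> c * T powr (q / 2 - 1) * K u" using c K0 by (simp add: mult_ac)
      then show ?thesis unfolding T(2) using c by (smt (verit) mult_nonneg_nonneg powr_ge_zero)
    qed
    with 1 show ?thesis by simp
  qed
  then show ?thesis using c1 by (intro exI[of _ "c1/2"] conjI exI[of _ "c * T powr (q/2)"]) auto
qed

text \<open>Neither \<bar>u\<bar> for \<open>u\<close> in \<open>N\<close> nor the limit of a
  minimising sequence need belong to \<open>N\<close>. Both are moved to the tops of their fibres,
  and \<open>N_max\<close> shows that the energy does not exceed that of the functions they came
  from.\<close>

lemma N_minimizer: "\<exists>v\<in>N. (\<forall>x. 0 \<le> v x) \<and> (\<forall>u\<in>N. E v \<le> E u)"
proof -
  obtain c1 c2 where coer: "c1 > 0" "\<And>u. u \<in> N \<Longrightarrow> c1 * K u - c2 \<le> E u" using N_coercive by metis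
  have NX: "u \<in> X" "0 < K u" "\<rho>\<^sup>2 < K u" if "u \<in> N" for u
    using that by (auto simp: N_def intro: order.strict_trans1[OF zero_le_power2])
  have ne: "N \<noteq> {}"
  proof -
    obtain w where w: "w \<in> X" "0 < H w" using H_pos by blast
    then have "0 < K w" using H_bound[of w] K_nonneg[of w] by (cases "K w = 0") auto
    then show ?thesis using fibre_top[OF w(1)] fibre_top_in_N[OF w(1)] by (metis empty_iff)
  qed
  obtain c U where U: "\<And>n::nat. U n \<in> N" "(\<lambda>n. E (U n)) \<longlonglongrightarrow> c" "\<And>y. y \<in> N \<Longrightarrow> c \<le> E y"
  proof (rule minimizing_sequence[where f = E and m = "- c2", OF ne])
    show "- c2 \<le> E x" if "x \<in> N" for x using coer(2)[OF that] coer(1) NX(2)[OF that]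
      by (smt (verit) mult_pos_pos)
  qed blast
  have "\<exists>v. v \<in> N \<and> (\<forall>x. 0 \<le> v x) \<and> E v \<le> E (U n)" for n
  proof -
    define u where "u = U n"
    define w where "w = (\<lambda>x. \<bar>u x\<bar>)"
    have u: "u \<in> N" using U by (simp add: u_def)
    note uX = NX[OF u]
    have w: "w \<in> X" using X_abs uX by (simp add: w_def)
    have "A w > 0" using A_pos[of u] A_abs[of u] uX by (simp add: w_def)
    then have Kw: "0 < K w" using A_bound[OF w] K_nonneg[OF w] by (cases "K w = 0") auto
    obtain t where t: "\<rho> / sqrt (K w) < t" "S w t = 0" using fibre_top[OF w Kw] by metis
    \<comment> \<open>As \<open>K w \<le> K u\<close>, the admissible factors for \<open>u\<close>
      start earlier than those for \<open>w\<close>, so the top \<open>t\<close> of the fibre of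
      \<open>w\<close> is admissible in \<open>N_max\<close> for \<open>u\<close>.\<close>
    have "sqrt (K w) \<le> sqrt (K u)" using K_abs[OF uX(1)] by (simp add: w_def)
    then have "\<rho> / sqrt (K u) \<le> \<rho> / sqrt (K w)" using rho Kw uX by (intro divide_left_mono) auto
    then have ts: "\<rho> / sqrt (K u) \<le> t" using t by simp
    have t0: "0 < t" using t rho Kw by (meson divide_pos_pos less_trans real_sqrt_gt_zero)
    have "(\<lambda>x. t * w x) = (\<lambda>x. \<bar>t * u x\<bar>)" using t0 by (auto simp: w_def abs_mult)
    then have "E (\<lambda>x. t * w x) \<le> E (\<lambda>x. t * u x)" using E_abs[OF X_scale[OF uX(1), of t]] by simp
    also have "\<dots> \<le> E u" by (rule N_max[OF u ts])
    finally show ?thesis using fibre_top_in_N[OF w Kw t] t0 u_def by (intro exI[of _ "\<lambda>x. t * w x"]) (auto simp: w_def)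
  qed
  then obtain V where V: "\<And>n. V n \<in> N" "\<And>n x. 0 \<le> V n x" "\<And>n. E (V n) \<le> E (U n)" by metis
  have Vc: "(\<lambda>n. E (V n)) \<longlonglongrightarrow> c"
  proof (rule tendsto_sandwich[OF _ _ tendsto_const U(2)])
    show "eventually (\<lambda>n. c \<le> E (V n)) sequentially" using U(3)[OF V(1)] by simp
    show "eventually (\<lambda>n. E (V n) \<le> E (U n)) sequentially" using V(3) by simp
  qed
  obtain B where B: "\<And>n. \<bar>E (V n)\<bar> \<le> B"
    using convergent_imp_Bseq[OF convergentI[OF Vc]] by (auto simp: Bseq_def)
  have KM: "K (V n) \<le> (B + c2) / c1" for n
    using coer(2)[OF V(1), of n] B[of n] coer(1) by (simp add: field_simps)
  obtain k w \<kappa> \<pi> where k: "strict_mono k" and w: "w \<in> X" "\<And>x. 0 \<le> w x"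
    and lim: "(\<lambda>n. K (V (k n))) \<longlonglongrightarrow> \<kappa>" "(\<lambda>n. P (V (k n))) \<longlonglongrightarrow> \<pi>" "(\<lambda>n. H (V (k n))) \<longlonglongrightarrow> H w"
      "(\<lambda>n. A (V (k n))) \<longlonglongrightarrow> A w" "K w \<le> \<kappa>" "P w \<le> \<pi>"
    using compactness[of V "(B + c2) / c1", OF NX(1)[OF V(1)] V(2) KM] by blast
  have \<kappa>: "\<rho>\<^sup>2 \<le> \<kappa>" by (rule LIMSEQ_le_const[OF lim(1)]) (use NX(3)[OF V(1)] less_imp_le in blast)
  have \<pi>: "0 \<le> \<pi>" using lim P_nonneg[OF w(1)] by simp
  have "(\<lambda>n. K (V (k n)) + b * P (V (k n)) - lam * H (V (k n)) - A (V (k n))) \<longlonglongrightarrow> \<kappa> + b * \<pi> - lam * H w - A w"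
    by (intro tendsto_intros lim)
  moreover have "K (V (k n)) + b * P (V (k n)) - lam * H (V (k n)) - A (V (k n)) = 0" for n
    using V(1)[of "k n"] by (simp add: N_def S_def fibre_slope_def)
  ultimately have eq0: "\<kappa> + b * \<pi> - lam * H w - A w = 0" by (simp add: LIMSEQ_const_iff)
  \<comment> \<open>The constraint survives in the limit with \<kappa> and \<pi> in place of
    \<open>K w\<close> and \<open>P w\<close>. If \<open>K w\<close> were 0, then \<open>H w\<close>
    and \<open>A w\<close> would vanish too, contradicting
    \<open>\<rho>\<^sup>2 \<le> \<kappa>\<close>.\<close>
  have Kw: "0 < K w"
  proof (rule ccontr)
    assume "\<not> 0 < K w"
    then have "K w = 0" using K_nonneg[OF w(1)] by simp
    then have "H w = 0" "A w = 0" using H_bound[OF w(1)] A_bound[OF w(1)] by auto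
    moreover have "0 \<le> b * \<pi>" using b \<pi> by simp
    moreover have "0 < \<kappa>" using rho(1) \<kappa> by (meson zero_less_power less_le_trans)
    ultimately show False using eq0 by simp
  qed
  obtain t where t: "\<rho> / sqrt (K w) < t" "S w t = 0" using fibre_top[OF w(1) Kw] by metis
  have t0: "0 < t" using t rho Kw by (meson divide_pos_pos less_trans real_sqrt_gt_zero)
  have tN: "(\<lambda>x. t * w x) \<in> N" using fibre_top_in_N[OF w(1) Kw t] .
  have "(\<lambda>n. \<rho> / sqrt (K (V (k n)))) \<longlonglongrightarrow> \<rho> / sqrt \<kappa>"
    by (intro tendsto_intros lim) (use \<kappa> rho in \<open>auto simp: real_sqrt_eq_zero_cancel_iff\<close>)
  \<comment> \<open>Because \<open>K w \<le> \<kappa>\<close>, the top of the fibre of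
    \<open>w\<close> is eventually an admissible factor for the members of the sequence as
    well.\<close>
  moreover have "\<rho> / sqrt \<kappa> < t"
  proof -
    have "\<rho> / sqrt \<kappa> \<le> \<rho> / sqrt (K w)" using rho Kw lim by (intro divide_left_mono) auto
    then show ?thesis using t by simp
  qed
  ultimately have ev: "eventually (\<lambda>n. \<rho> / sqrt (K (V (k n))) < t) sequentially" by (rule order_tendstoD)
  have limE: "(\<lambda>n. E (\<lambda>x. t * V (k n) x)) \<longlonglongrightarrow> t powr 2 * \<kappa> / 2 + b * (t powr p * \<pi>) / p - lam * (t powr q * H w) / q
     - t powr (2 * r) * A w / (2 * r)"
    unfolding E_def using exps by (simp only: K_scale[OF NX(1)[OF V(1)] t0] P_scale[OF NX(1)[OF V(1)] t0]
      H_scale[OF NX(1)[OF V(1)] t0] A_scale[OF NX(1)[OF V(1)] t0]) (intro tendsto_intros lim, auto)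
  have limV: "(\<lambda>n. E (V (k n))) \<longlonglongrightarrow> c" using LIMSEQ_subseq_LIMSEQ[OF Vc k] by (simp add: o_def)
  have "t powr 2 * \<kappa> / 2 + b * (t powr p * \<pi>) / p - lam * (t powr q * H w) / q
     - t powr (2 * r) * A w / (2 * r) \<le> c"
  proof (rule tendsto_le[OF sequentially_bot limV limE])
    show "eventually (\<lambda>n. E (\<lambda>x. t * V (k n) x) \<le> E (V (k n))) sequentially"
      using ev by eventually_elim (intro N_max V, simp)
  qed
  moreover have "E (\<lambda>x. t * w x) \<le> t powr 2 * \<kappa> / 2 + b * (t powr p * \<pi>) / p - lam * (t powr q * H w) / q
     - t powr (2 * r) * A w / (2 * r)"
    unfolding E_def K_scale[OF w(1) t0] P_scale[OF w(1) t0] H_scale[OF w(1) t0] A_scale[OF w(1) t0]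
    using lim b exps lam by (intro diff_mono add_mono divide_right_mono mult_left_mono) auto
  ultimately have "E (\<lambda>x. t * w x) \<le> c" by simp
  then show ?thesis using tN U(3) t0 w by (intro bexI[of _ "\<lambda>x. t * w x"]) force+
qed

text \<open>
  No Lagrange multiplier is needed: for \<open>v\<close> minimal and \<open>t e\<close> the fibre maximiser of \<open>v + e h\<close>,
  \<open>E (t e (v + e h)) \<ge> E v \<ge> E (t e v)\<close>, and by homogeneity the difference quotient of the outer terms
  tends to the first variation at \<open>v\<close> as soon as \<open>t e \<longlonglongrightarrow> 1\<close>.
\<close>
lemma nehari_solution:
  "\<exists>v\<in>X. (\<forall>x. 0 \<le> v x) \<and> \<rho>\<^sup>2 < K v \<and>
     (\<forall>h\<in>X. K' v h + b * P' v h - lam * H' v h - A' v h = 0)"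
proof -
  obtain v where v: "v \<in> N" "\<And>x. 0 \<le> v x" "\<And>u. u \<in> N \<Longrightarrow> E v \<le> E u" using N_minimizer by blast
  then have vX: "v \<in> X" "\<rho>\<^sup>2 < K v" "S v 1 = 0" by (auto simp: N_def)
  have K0: "0 < K v" using vX by (meson zero_le_power2 order.strict_trans1)
  have r1: "\<rho> / sqrt (K v) < 1" using vX(2) K0 rho real_less_rsqrt by simp
  have "K' v h + b * P' v h - lam * H' v h - A' v h = 0" if h: "h \<in> X" for h
  proof -
    define V where "V e = (\<lambda>x. v x + e * h x)" for e
    have VX: "V e \<in> X" for e unfolding V_def by (intro X_line vX h)
    have V0: "V 0 = v" by (simp add: V_def)
    have der: "((\<lambda>e. K (V e)) has_real_derivative 2 * K' v h) (at 0)"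
      "((\<lambda>e. P (V e)) has_real_derivative p * P' v h) (at 0)"
      "((\<lambda>e. H (V e)) has_real_derivative q * H' v h) (at 0)"
      "((\<lambda>e. A (V e)) has_real_derivative (2 * r) * A' v h) (at 0)"
      unfolding V_def by (intro K_deriv P_deriv H_deriv A_deriv vX h)+
    have cts: "((\<lambda>e. K (V e)) \<longlongrightarrow> K v) (at 0)" "((\<lambda>e. P (V e)) \<longlongrightarrow> P v) (at 0)"
      "((\<lambda>e. H (V e)) \<longlongrightarrow> H v) (at 0)" "((\<lambda>e. A (V e)) \<longlongrightarrow> A v) (at 0)"
      using der[THEN DERIV_isCont] by (simp_all add: isCont_def V0)
    have Kpos: "eventually (\<lambda>e. 0 < K (V e)) (at 0)" by (rule order_tendstoD(1)[OF cts(1) K0])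
    have radius: "((\<lambda>e. \<rho> / sqrt (K (V e))) \<longlongrightarrow> \<rho> / sqrt (K v)) (at 0)"
      by (intro tendsto_intros cts) (use K0 in auto)
    have slope: "((\<lambda>e. S (V e) s) \<longlongrightarrow> S v s) (at 0)" for s
      unfolding S_def fibre_slope_def by (intro tendsto_intros cts)
    have "\<exists>t. 0 < K (V e) \<longrightarrow> \<rho> / sqrt (K (V e)) < t \<and> S (V e) t = 0 \<and>
        (\<forall>s. \<rho> / sqrt (K (V e)) \<le> s \<longrightarrow> s < t \<longrightarrow> 0 < S (V e) s) \<and> (\<forall>s>t. S (V e) s < 0)" for e
      using fibre_top[OF VX[of e]] by metis
    then obtain t where t: "\<And>e. 0 < K (V e) \<Longrightarrow> \<rho> / sqrt (K (V e)) < t e" "\<And>e. 0 < K (V e) \<Longrightarrow> S (V e) (t e) = 0"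
      "\<And>e s. 0 < K (V e) \<Longrightarrow> \<rho> / sqrt (K (V e)) \<le> s \<Longrightarrow> s < t e \<Longrightarrow> 0 < S (V e) s"
      "\<And>e s. 0 < K (V e) \<Longrightarrow> t e < s \<Longrightarrow> S (V e) s < 0"
      by metis
    obtain t1 where t1: "\<rho> / sqrt (K v) < t1" "S v t1 = 0"
      "\<And>s. \<rho> / sqrt (K v) \<le> s \<Longrightarrow> s < t1 \<Longrightarrow> 0 < S v s" "\<And>s. t1 < s \<Longrightarrow> S v s < 0"
      using fibre_top[OF vX(1) K0] by metis
    have "t1 = 1" using t1(3)[of 1] t1(4)[of 1] r1 vX(3) by (cases t1 "1::real" rule: linorder_cases) auto
    note t1 = t1[unfolded this]
    \<comment> \<open>Continuity of the fibre maximiser follows from signs alone, without an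
      implicit function theorem: at a fixed factor below 1 the slope of \<open>V e\<close> is
      eventually positive, at one above 1 eventually negative, and these signs locate
      \<open>t e\<close>.\<close>
    have tlim: "(t \<longlongrightarrow> 1) (at 0)"
    proof (rule order_tendstoI)
      fix a :: real assume "a < 1"
      define x where "x = max a (\<rho> / sqrt (K v) / 2 + 1 / 2)"
      have x: "a \<le> x" "\<rho> / sqrt (K v) < x" "x < 1" using \<open>a < 1\<close> r1 by (auto simp: x_def)
      have "eventually (\<lambda>e. 0 < S (V e) x) (at 0)"
        by (rule order_tendstoD(1)[OF slope t1(3)]) (use x in auto)
      then show "eventually (\<lambda>e. a < t e) (at 0)" using Kpos
      proof eventually_elim
        case (elim e)
        show ?case using t(2,4)[OF elim(2)] elim(1) x by (smt (verit))
      qed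
    next
      fix a :: real assume a: "1 < a"
      have "eventually (\<lambda>e. S (V e) a < 0) (at 0)" by (rule order_tendstoD(2)[OF slope t1(4)[OF a]])
      moreover have "eventually (\<lambda>e. \<rho> / sqrt (K (V e)) < a) (at 0)"
        by (rule order_tendstoD(2)[OF radius]) (use r1 a in auto)
      ultimately show "eventually (\<lambda>e. t e < a) (at 0)" using Kpos
      proof eventually_elim
        case (elim e)
        show ?case using t(2,3)[OF elim(3)] elim(1,2) by (smt (verit))
      qed
    qed
    define J where "J e = E (\<lambda>x. t e * V e x) - E (\<lambda>x. t e * v x)" for e
    have tpos: "eventually (\<lambda>e. 0 < t e) (at 0)" by (rule order_tendstoD(1)[OF tlim]) simp
    have "eventually (\<lambda>e. \<rho> / sqrt (K v) < t e) (at 0)" by (rule order_tendstoD(1)[OF tlim r1])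
    then have J0: "eventually (\<lambda>e. 0 \<le> J e) (at 0)" using Kpos
    proof eventually_elim
      case (elim e)
      have "E v \<le> E (\<lambda>x. t e * V e x)" using v(3) fibre_top_in_N[OF VX elim(2) t(1,2)[OF elim(2)]] by simp
      moreover have "E (\<lambda>x. t e * v x) \<le> E v" using N_max[OF v(1)] elim(1) by simp
      ultimately show ?case by (simp add: J_def)
    qed
    define L where "L = K' v h + b * P' v h - lam * H' v h - A' v h"
    have quot: "((\<lambda>e. (K (V e) - K v) / e) \<longlongrightarrow> 2 * K' v h) (at 0)"
      "((\<lambda>e. (P (V e) - P v) / e) \<longlongrightarrow> p * P' v h) (at 0)"
      "((\<lambda>e. (H (V e) - H v) / e) \<longlongrightarrow> q * H' v h) (at 0)"
      "((\<lambda>e. (A (V e) - A v) / e) \<longlongrightarrow> (2 * r) * A' v h) (at 0)"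
      using der by (simp_all add: DERIV_def V0)
    have lim0: "((\<lambda>e. t e powr 2 * ((K (V e) - K v) / e) / 2 + b * (t e powr p * ((P (V e) - P v) / e)) / p
        - lam * (t e powr q * ((H (V e) - H v) / e)) / q - t e powr (2 * r) * ((A (V e) - A v) / e) / (2 * r))
      \<longlongrightarrow> 1 powr 2 * (2 * K' v h) / 2 + b * (1 powr p * (p * P' v h)) / p
        - lam * (1 powr q * (q * H' v h)) / q - 1 powr (2 * r) * ((2 * r) * A' v h) / (2 * r)) (at 0)"
      using exps by (intro tendsto_intros quot tlim) auto
    have ev0: "eventually (\<lambda>e. t e powr 2 * ((K (V e) - K v) / e) / 2 + b * (t e powr p * ((P (V e) - P v) / e)) / p
        - lam * (t e powr q * ((H (V e) - H v) / e)) / q - t e powr (2 * r) * ((A (V e) - A v) / e) / (2 * r) = J e / e) (at 0)"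
      using tpos
    proof eventually_elim
      case (elim e)
      show ?case unfolding J_def E_def K_scale[OF VX elim] P_scale[OF VX elim] H_scale[OF VX elim] A_scale[OF VX elim]
        K_scale[OF vX(1) elim] P_scale[OF vX(1) elim] H_scale[OF vX(1) elim] A_scale[OF vX(1) elim]
        by (simp only: times_divide_eq_right right_diff_distrib diff_divide_distrib add_divide_distrib
              divide_divide_eq_left mult.commute[of e])
    qed
    have "((\<lambda>e. J e / e) \<longlongrightarrow> L) (at 0)"
      using Lim_transform_eventually[OF lim0 ev0] exps by (simp add: L_def)
    then have lim: "((\<lambda>e. J e / e) \<longlongrightarrow> L) (at_right 0)" "((\<lambda>e. J e / e) \<longlongrightarrow> L) (at_left 0)"
      by (simp_all add: filterlim_at_split)
    have J0': "eventually (\<lambda>e. 0 \<le> J e) (at_right 0)" "eventually (\<lambda>e. 0 \<le> J e) (at_left 0)"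
      using J0 by (simp_all add: eventually_at_split)
    \<comment> \<open>\<open>J e\<close> is nonnegative for \<open>e\<close> of either sign, so
      \<open>J e / e\<close> changes sign with \<open>e\<close> and its two-sided limit must be
      0.\<close>
    have "0 \<le> L"
    proof (rule tendsto_lowerbound[OF lim(1)])
      show "eventually (\<lambda>e. 0 \<le> J e / e) (at_right 0)"
        using J0'(1) eventually_at_right_less[of 0] by eventually_elim auto
    qed simp
    moreover have "L \<le> 0"
    proof (rule tendsto_upperbound[OF lim(2)])
      have "eventually (\<lambda>e::real. e < 0) (at_left 0)" by (simp add: eventually_at_filter)
      with J0'(2) show "eventually (\<lambda>e. J e / e \<le> 0) (at_left 0)"
        by eventually_elim (auto simp: divide_nonneg_neg)
    qed simp
    ultimately show ?thesis by (simp add: L_def)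
  qed
  then show ?thesis using v vX by blast
qed

end

text \<open>The strict inequality \<open>K u < K v\<close> is recorded because, for a
  \<open>K\<close> depending only on the class modulo null sets, it shows that the two solutions
  differ as classes.\<close>

theorem two_critical_points:
  "\<exists>l0>0. \<forall>lam. 0 < lam \<and> lam < l0 \<longrightarrow> (\<forall>b>0. \<exists>u\<in>X. \<exists>v\<in>X.
     (\<forall>x. 0 \<le> u x) \<and> (\<forall>x. 0 \<le> v x) \<and> 0 < K u \<and> K u < K v \<and>
     (\<forall>h\<in>X. K' u h + b * P' u h - lam * H' u h - A' u h = 0) \<and>
     (\<forall>h\<in>X. K' v h + b * P' v h - lam * H' v h - A' v h = 0))"
proof (intro exI[of _ lam0] conjI lam0_pos allI impI)
  fix lam b :: real assume "0 < lam \<and> lam < lam0" "0 < b"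
  then obtain u v where "u \<in> X" "\<forall>x. 0 \<le> u x" "0 < K u" "K u < \<rho>\<^sup>2"
      "\<forall>h\<in>X. K' u h + b * P' u h - lam * H' u h - A' u h = 0"
    and "v \<in> X" "\<forall>x. 0 \<le> v x" "\<rho>\<^sup>2 < K v" "\<forall>h\<in>X. K' v h + b * P' v h - lam * H' v h - A' v h = 0"
    using ball_solution[of lam b] nehari_solution[of lam b] by blast
  then show "\<exists>u\<in>X. \<exists>v\<in>X. (\<forall>x. 0 \<le> u x) \<and> (\<forall>x. 0 \<le> v x) \<and> 0 < K u \<and> K u < K v \<and>
     (\<forall>h\<in>X. K' u h + b * P' u h - lam * H' u h - A' u h = 0) \<and>
     (\<forall>h\<in>X. K' v h + b * P' v h - lam * H' v h - A' v h = 0)"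
    by (meson less_trans)
qed

end

section \<open>First variations of power integrals\<close>

text \<open>At 0 the difference quotient is at most \<open>\<bar>h\<bar> powr (p - 1)\<close>, which
  tends to 0 because \<open>p > 1\<close>; elsewhere it is the usual power rule on either half
  line.\<close>

lemma abs_powr_deriv:
  fixes t p :: real
  assumes "1 < p" shows "((\<lambda>t. \<bar>t\<bar> powr p) has_real_derivative p * (\<bar>t\<bar> powr (p - 2) * t)) (at t)"
proof (cases t "0::real" rule: linorder_cases)
  case greater
  have "((\<lambda>t. t powr p) has_real_derivative p * t powr (p - 1)) (at t)"
    using greater by (auto intro!: derivative_eq_intros)
  moreover have "t powr (p - 1) = \<bar>t\<bar> powr (p - 2) * t"
    using greater powr_add[of t "p - 2" 1] by simp
  ultimately have "((\<lambda>t. t powr p) has_real_derivative p * (\<bar>t\<bar> powr (p - 2) * t)) (at t)" by simp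
  then show ?thesis
    by (rule has_field_derivative_transform_within_open[where S = "{0<..}"]) (use greater in auto)
next
  case less
  have "((\<lambda>t. (- t) powr p) has_real_derivative - (p * (- t) powr (p - 1))) (at t)"
    using less by (auto intro!: derivative_eq_intros)
  moreover have "- ((- t) powr (p - 1)) = \<bar>t\<bar> powr (p - 2) * t"
    using less powr_add[of "- t" "p - 2" 1] by simp
  then have "- (p * (- t) powr (p - 1)) = p * (\<bar>t\<bar> powr (p - 2) * t)"
    by (metis mult_minus_right)
  ultimately have "((\<lambda>t. (- t) powr p) has_real_derivative p * (\<bar>t\<bar> powr (p - 2) * t)) (at t)" by simp
  then show ?thesis
    by (rule has_field_derivative_transform_within_open[where S = "{..<0}"]) (use less in auto)
next
  case equal
  have lim: "((\<lambda>h::real. \<bar>h\<bar> powr (p - 1)) \<longlongrightarrow> 0) (at 0)"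
    by (rule tendsto_zero_powrI[where b = "p - 1"]) (use assms in \<open>auto intro!: tendsto_eq_intros\<close>)
  have le: "norm (\<bar>h\<bar> powr p / h) \<le> \<bar>h\<bar> powr (p - 1)" for h :: real
    using powr_add[of "\<bar>h\<bar>" "p - 1" 1] by (cases "h = 0") (auto simp: abs_mult)
  have "((\<lambda>h::real. \<bar>h\<bar> powr p / h) \<longlongrightarrow> 0) (at 0)"
    by (rule Lim_null_comparison[OF always_eventually lim]) (use le in blast)
  then show ?thesis using equal assms by (simp add: DERIV_def)
qed

lemma abs_powr_diff_le:
  fixes s t p m :: real
  assumes "1 < p" "\<bar>s\<bar> \<le> m" "\<bar>t\<bar> \<le> m"
  shows "\<bar>\<bar>s\<bar> powr p - \<bar>t\<bar> powr p\<bar> \<le> p * m powr (p - 1) * \<bar>s - t\<bar>"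
proof -
  have "norm (\<bar>s\<bar> powr p - \<bar>t\<bar> powr p) \<le> p * m powr (p - 1) * norm (s - t)"
  proof (rule field_differentiable_bound[where S = "{- m..m}"])
    show "((\<lambda>t. \<bar>t\<bar> powr p) has_field_derivative p * (\<bar>z\<bar> powr (p - 2) * z)) (at z within {-m..m})" for z
      using abs_powr_deriv[OF assms(1)] DERIV_subset by blast
    show "norm (p * (\<bar>z\<bar> powr (p - 2) * z)) \<le> p * m powr (p - 1)" if "z \<in> {-m..m}" for z
    proof -
      have "\<bar>z\<bar> powr (p - 2) * \<bar>z\<bar> = \<bar>z\<bar> powr (p - 1)"
        using powr_add[of "\<bar>z\<bar>" "p - 2" 1] by (cases "z = 0") auto
      moreover have "\<bar>z\<bar> powr (p - 1) \<le> m powr (p - 1)" using that assms by (intro powr_mono2) auto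
      ultimately show ?thesis using assms by (auto simp: abs_mult)
    qed
  qed (use assms in auto)
  then show ?thesis by simp
qed

lemma powr_sum_le:
  fixes a b p :: real
  assumes "0 \<le> a" "0 \<le> b" "0 \<le> p" shows "(a + b) powr p \<le> 2 powr p * (a powr p + b powr p)"
proof -
  have "(a + b) powr p \<le> (2 * max a b) powr p" using assms by (intro powr_mono2) auto
  also have "\<dots> = 2 powr p * max a b powr p" using assms by (simp add: powr_mult)
  also have "max a b powr p \<le> a powr p + b powr p" by (simp add: max_def)
  finally show ?thesis by simp
qed

lemma abs_add_powr_le:
  fixes a b p :: real
  assumes "0 \<le> p" shows "\<bar>a + b\<bar> powr p \<le> 2 powr p * (\<bar>a\<bar> powr p + \<bar>b\<bar> powr p)"
  by (rule order_trans[OF powr_mono2 powr_sum_le]) (use assms abs_triangle_ineq in auto)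

text \<open>Linear in \<bar>e\<bar> and of the same power \<open>p\<close> in both functions: this
  yields a dominating function for difference quotients that is independent of \<open>e\<close> and
  integrable whenever the two power integrals are finite.\<close>

lemma abs_powr_increment:
  fixes f g e p :: real
  assumes "1 < p" "\<bar>e\<bar> \<le> 1"
  shows "\<bar>\<bar>f + e * g\<bar> powr p - \<bar>f\<bar> powr p\<bar> \<le> \<bar>e\<bar> * (p * (\<bar>f\<bar> + \<bar>g\<bar>) powr p)"
proof -
  define m where "m = \<bar>f\<bar> + \<bar>g\<bar>"
  have eg: "\<bar>e * g\<bar> \<le> \<bar>g\<bar>" using assms by (simp add: abs_mult mult_left_le_one_le)
  have "\<bar>\<bar>f + e * g\<bar> powr p - \<bar>f\<bar> powr p\<bar> \<le> p * m powr (p - 1) * \<bar>(f + e * g) - f\<bar>"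
    using eg by (intro abs_powr_diff_le assms) (auto simp: m_def)
  also have "\<dots> \<le> p * m powr (p - 1) * (\<bar>e\<bar> * m)"
    using assms by (intro mult_left_mono) (auto simp: m_def abs_mult intro!: mult_left_mono)
  also have "\<dots> = \<bar>e\<bar> * (p * (m powr (p - 1) * m))" by (simp only: mult_ac)
  also have "m powr (p - 1) * m = m powr p"
    using powr_add[of m "p - 1" 1] by (cases "m = 0") (auto simp: m_def)
  finally show ?thesis by (simp add: m_def)
qed

text \<open>Dominated convergence for the difference quotients at 0, which the increment bound keeps
  below \<open>G\<close>. The bound holds only for \<bar>e\<bar> up to 1, so sequences tending to 0
  are shifted by finitely many indices.\<close>

lemma deriv_integral_at_0:
  fixes \<Phi> :: "real \<Rightarrow> 'b \<Rightarrow> real"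
  assumes int: "\<And>e. integrable M (\<Phi> e)"
    and [measurable]: "\<phi> \<in> borel_measurable M"
    and der: "AE z in M. ((\<lambda>e. \<Phi> e z) has_real_derivative \<phi> z) (at 0)"
    and bound: "\<And>e. \<bar>e\<bar> \<le> 1 \<Longrightarrow> AE z in M. \<bar>\<Phi> e z - \<Phi> 0 z\<bar> \<le> \<bar>e\<bar> * G z"
    and G: "integrable M G"
  shows "((\<lambda>e. \<integral>z. \<Phi> e z \<partial>M) has_real_derivative (\<integral>z. \<phi> z \<partial>M)) (at 0)"
  unfolding DERIV_def tendsto_at_iff_sequentially
proof (intro allI impI)
  fix X :: "nat \<Rightarrow> real"
  assume X0: "\<forall>i. X i \<in> UNIV - {0}" and X: "X \<longlonglongrightarrow> 0"
  have ne: "X i \<noteq> 0" for i using X0 by auto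
  have lim0: "filterlim X (at 0) sequentially" using X ne by (auto simp: filterlim_at)
  have "eventually (\<lambda>i. \<bar>X i\<bar> \<le> 1) sequentially"
    using tendstoD[OF X, of 1] by (auto simp: dist_real_def elim: eventually_mono)
  then obtain m where m: "\<And>i. i \<ge> m \<Longrightarrow> \<bar>X i\<bar> \<le> 1" by (auto simp: eventually_sequentially)
  have "(\<lambda>i. \<integral>z. (\<Phi> (X (i + m)) z - \<Phi> 0 z) / X (i + m) \<partial>M) \<longlonglongrightarrow> (\<integral>z. \<phi> z \<partial>M)"
  proof (rule integral_dominated_convergence[where w = G])
    show "(\<lambda>z. (\<Phi> (X (i + m)) z - \<Phi> 0 z) / X (i + m)) \<in> borel_measurable M" for i
      using int[THEN borel_measurable_integrable] by measurable
    show "AE z in M. (\<lambda>i. (\<Phi> (X (i + m)) z - \<Phi> 0 z) / X (i + m)) \<longlonglongrightarrow> \<phi> z"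
      using der
    proof eventually_elim
      case (elim z)
      then have "((\<lambda>h. (\<Phi> h z - \<Phi> 0 z) / h) \<longlongrightarrow> \<phi> z) (at 0)" by (simp add: DERIV_def)
      from filterlim_compose[OF this lim0] show ?case by (rule LIMSEQ_ignore_initial_segment)
    qed
    show "AE z in M. norm ((\<Phi> (X (i + m)) z - \<Phi> 0 z) / X (i + m)) \<le> G z" for i
      using bound[OF m, of "i + m", simplified]
      by eventually_elim (use ne in \<open>simp add: divide_le_eq mult.commute\<close>)
  qed (use G in auto)
  moreover have eq: "(\<integral>z. (\<Phi> (X (i + m)) z - \<Phi> 0 z) / X (i + m) \<partial>M)
      = ((\<integral>z. \<Phi> (X (i + m)) z \<partial>M) - (\<integral>z. \<Phi> 0 z \<partial>M)) / X (i + m)" for i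
    using int by simp
  ultimately have "(\<lambda>i. ((\<integral>z. \<Phi> (X (i + m)) z \<partial>M) - (\<integral>z. \<Phi> 0 z \<partial>M)) / X (i + m)) \<longlonglongrightarrow> (\<integral>z. \<phi> z \<partial>M)"
    by (simp only: eq)
  then have "(\<lambda>i. ((\<integral>z. \<Phi> (X i) z \<partial>M) - (\<integral>z. \<Phi> 0 z \<partial>M)) / X i) \<longlonglongrightarrow> (\<integral>z. \<phi> z \<partial>M)"
    by (rule LIMSEQ_offset[of _ m])
  then show "((\<lambda>h. ((\<integral>z. \<Phi> (0 + h) z \<partial>M) - (\<integral>z. \<Phi> 0 z \<partial>M)) / h) \<circ> X) \<longlonglongrightarrow> (\<integral>z. \<phi> z \<partial>M)"
    by (simp add: o_def)
qed

lemma integrable_abs_add_powr: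
  fixes f g w :: "'b \<Rightarrow> real"
  assumes [measurable]: "f \<in> borel_measurable M" "g \<in> borel_measurable M" "w \<in> borel_measurable M"
    and "0 \<le> p" and int: "integrable M (\<lambda>z. \<bar>f z\<bar> powr p * w z)" "integrable M (\<lambda>z. \<bar>g z\<bar> powr p * w z)"
  shows "integrable M (\<lambda>z. (\<bar>f z\<bar> + \<bar>g z\<bar>) powr p * w z)"
proof (rule Bochner_Integration.integrable_bound)
  show "integrable M (\<lambda>z. 2 powr p * (\<bar>\<bar>f z\<bar> powr p * w z\<bar> + \<bar>\<bar>g z\<bar> powr p * w z\<bar>))"
    using int by auto
  have "(\<bar>f z\<bar> + \<bar>g z\<bar>) powr p * \<bar>w z\<bar> \<le> 2 powr p * (\<bar>f z\<bar> powr p + \<bar>g z\<bar> powr p) * \<bar>w z\<bar>" for z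
    using assms by (intro mult_right_mono powr_sum_le) auto
  then show "AE z in M. norm ((\<bar>f z\<bar> + \<bar>g z\<bar>) powr p * w z)
      \<le> norm (2 powr p * (\<bar>\<bar>f z\<bar> powr p * w z\<bar> + \<bar>\<bar>g z\<bar> powr p * w z\<bar>))"
    by (auto simp: abs_mult algebra_simps)
qed measurable

text \<open>Covers both kinds of variation: with differences of \<open>u\<close> and the singular
  kernel as weight it gives the Gagliardo forms, with \<open>u\<close> itself and the sign-changing
  coefficient as weight the term with \<lambda>.\<close>

lemma deriv_power_integral:
  fixes f g w :: "'b \<Rightarrow> real"
  assumes [measurable]: "f \<in> borel_measurable M" "g \<in> borel_measurable M" "w \<in> borel_measurable M"
    and p: "1 < p" and int: "integrable M (\<lambda>z. \<bar>f z\<bar> powr p * w z)" "integrable M (\<lambda>z. \<bar>g z\<bar> powr p * w z)"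
  shows "((\<lambda>e. \<integral>z. \<bar>f z + e * g z\<bar> powr p * w z \<partial>M) has_real_derivative
      p * (\<integral>z. \<bar>f z\<bar> powr (p - 2) * f z * g z * w z \<partial>M)) (at 0)"
proof -
  have "((\<lambda>e. \<integral>z. \<bar>f z + e * g z\<bar> powr p * w z \<partial>M) has_real_derivative
      (\<integral>z. p * (\<bar>f z\<bar> powr (p - 2) * f z * g z * w z) \<partial>M)) (at 0)"
  proof (rule deriv_integral_at_0)
    show "integrable M (\<lambda>z. \<bar>f z + e * g z\<bar> powr p * w z)" for e
    proof (rule Bochner_Integration.integrable_bound)
      have "integrable M (\<lambda>z. \<bar>e * g z\<bar> powr p * w z)"
        using integrable_mult_right[OF int(2), of "\<bar>e\<bar> powr p"] by (simp add: abs_mult powr_mult mult.assoc)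
      then show "integrable M (\<lambda>z. (\<bar>f z\<bar> + \<bar>e * g z\<bar>) powr p * w z)"
        using p int by (intro integrable_abs_add_powr) auto
      show "AE z in M. norm (\<bar>f z + e * g z\<bar> powr p * w z) \<le> norm ((\<bar>f z\<bar> + \<bar>e * g z\<bar>) powr p * w z)"
        using p by (auto simp: abs_mult[of _ "w _"] intro!: mult_right_mono powr_mono2)
    qed measurable
    have d: "((\<lambda>e. \<bar>f z + e * g z\<bar> powr p) has_real_derivative p * (\<bar>f z\<bar> powr (p - 2) * f z) * g z) (at 0)" for z
    proof (rule DERIV_chain2[where f = "\<lambda>t. \<bar>t\<bar> powr p"])
      show "((\<lambda>e. f z + e * g z) has_real_derivative g z) (at 0)" by (auto intro!: derivative_eq_intros)
    qed (use abs_powr_deriv[OF p, of "f z"] in simp)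
    show "AE z in M. ((\<lambda>e. \<bar>f z + e * g z\<bar> powr p * w z) has_real_derivative
        p * (\<bar>f z\<bar> powr (p - 2) * f z * g z * w z)) (at 0)"
    proof (intro always_eventually allI)
      fix z
      show "((\<lambda>e. \<bar>f z + e * g z\<bar> powr p * w z) has_real_derivative
        p * (\<bar>f z\<bar> powr (p - 2) * f z * g z * w z)) (at 0)"
        using DERIV_cmult_right[OF d[of z], of "w z"] by (simp add: mult_ac)
    qed
    show "AE z in M. \<bar>\<bar>f z + e * g z\<bar> powr p * w z - \<bar>f z + 0 * g z\<bar> powr p * w z\<bar>
       \<le> \<bar>e\<bar> * (p * ((\<bar>f z\<bar> + \<bar>g z\<bar>) powr p * \<bar>w z\<bar>))" if "\<bar>e\<bar> \<le> 1" for e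
    proof (intro always_eventually allI)
      fix z
      have "\<bar>\<bar>f z + e * g z\<bar> powr p * w z - \<bar>f z + 0 * g z\<bar> powr p * w z\<bar>
          = \<bar>\<bar>f z + e * g z\<bar> powr p - \<bar>f z\<bar> powr p\<bar> * \<bar>w z\<bar>"
        by (simp flip: left_diff_distrib abs_mult)
      also have "\<dots> \<le> \<bar>e\<bar> * (p * (\<bar>f z\<bar> + \<bar>g z\<bar>) powr p) * \<bar>w z\<bar>"
        by (intro mult_right_mono abs_powr_increment p that) auto
      finally show "\<bar>\<bar>f z + e * g z\<bar> powr p * w z - \<bar>f z + 0 * g z\<bar> powr p * w z\<bar>
       \<le> \<bar>e\<bar> * (p * ((\<bar>f z\<bar> + \<bar>g z\<bar>) powr p * \<bar>w z\<bar>))" by (simp add: mult_ac)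
    qed
    have "integrable M (\<lambda>z. \<bar>(\<bar>f z\<bar> + \<bar>g z\<bar>) powr p * w z\<bar>)"
      using p int by (intro integrable_abs integrable_abs_add_powr) auto
    then show "integrable M (\<lambda>z. p * ((\<bar>f z\<bar> + \<bar>g z\<bar>) powr p * \<bar>w z\<bar>))"
      by (simp add: abs_mult)
  qed measurable
  then show ?thesis by simp
qed

section \<open>Singular kernels\<close>

lemma borel_cball [measurable]: "cball c R \<in> sets borel"
  by (simp add: borel_closed)

lemma nn_integral_lborel_pair:
  fixes f :: "'a::euclidean_space \<times> 'b::euclidean_space \<Rightarrow> ennreal"
  assumes "f \<in> borel_measurable borel"
  shows "(\<integral>\<^sup>+z. f z \<partial>lborel) = (\<integral>\<^sup>+x. \<integral>\<^sup>+y. f (x, y) \<partial>lborel \<partial>lborel)"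
    and "(\<integral>\<^sup>+z. f z \<partial>lborel) = (\<integral>\<^sup>+y. \<integral>\<^sup>+x. f (x, y) \<partial>lborel \<partial>lborel)"
proof -
  have m: "f \<in> borel_measurable (lborel \<Otimes>\<^sub>M lborel)" using assms by (simp add: lborel_prod)
  show "(\<integral>\<^sup>+z. f z \<partial>lborel) = (\<integral>\<^sup>+x. \<integral>\<^sup>+y. f (x, y) \<partial>lborel \<partial>lborel)"
    using lborel.nn_integral_fst[OF m] by (simp add: lborel_prod)
  then show "(\<integral>\<^sup>+z. f z \<partial>lborel) = (\<integral>\<^sup>+y. \<integral>\<^sup>+x. f (x, y) \<partial>lborel \<partial>lborel)"
    using lborel_pair.Fubini[OF m] by simp
qed

lemma nn_integral_lborel_translate:
  fixes f :: "'a::euclidean_space \<Rightarrow> ennreal"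
  assumes [measurable]: "f \<in> borel_measurable borel"
  shows "(\<integral>\<^sup>+y. f (x - y) \<partial>lborel) = (\<integral>\<^sup>+z. f z \<partial>lborel)"
proof -
  have "(lborel :: 'a measure) = distr lborel borel (\<lambda>y. x - y)"
    using lborel_affine[of "-1" x] by (simp add: density_1)
  then have "(\<integral>\<^sup>+z. f z \<partial>lborel) = (\<integral>\<^sup>+z. f z \<partial>distr lborel borel (\<lambda>y. x - y))" by simp
  also have "\<dots> = (\<integral>\<^sup>+y. f (x - y) \<partial>lborel)" by (rule nn_integral_distr) auto
  finally show ?thesis ..
qed

text \<open>\<open>f\<close> is dominated by the series of the functions equal to \<open>c k\<close>
  on the full ball of radius \<open>R k\<close>, whose volume is proportional to
  \<open>R k ^ DIM('a)\<close>. Using balls instead of shells loses only a constant when the radii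
  form a geometric sequence.\<close>

lemma nn_integral_shells_finite:
  fixes f :: "'a::euclidean_space \<Rightarrow> ennreal" and c R :: "nat \<Rightarrow> real"
  assumes [measurable]: "f \<in> borel_measurable borel"
    and le: "\<And>z. f z \<noteq> 0 \<Longrightarrow> \<exists>k. f z \<le> ennreal (c k) \<and> norm z \<le> R k"
    and nn: "\<And>k. 0 \<le> c k" "\<And>k. 0 \<le> R k"
    and sm: "summable (\<lambda>k. c k * R k ^ DIM('a))"
  shows "(\<integral>\<^sup>+z. f z \<partial>lborel) < \<infinity>"
proof -
  have "(\<integral>\<^sup>+z. f z \<partial>lborel) \<le> (\<integral>\<^sup>+(z::'a). (\<Sum>k. ennreal (c k) * indicator (cball 0 (R k)) z) \<partial>lborel)"
  proof (rule nn_integral_mono)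
    fix z :: 'a
    show "f z \<le> (\<Sum>k. ennreal (c k) * indicator (cball 0 (R k)) z)"
    proof (cases "f z = 0")
      case False
      then obtain k where k: "f z \<le> ennreal (c k)" "norm z \<le> R k" using le by blast
      have "f z \<le> (\<Sum>i\<in>{k}. ennreal (c i) * indicator (cball 0 (R i)) z)" using k by simp
      also have "\<dots> \<le> (\<Sum>k. ennreal (c k) * indicator (cball 0 (R k)) z)"
        by (rule sum_le_suminf) auto
      finally show ?thesis .
    qed simp
  qed
  also have "\<dots> = (\<Sum>k. \<integral>\<^sup>+(z::'a). ennreal (c k) * indicator (cball 0 (R k)) z \<partial>lborel)"
    by (rule nn_integral_suminf) measurable
  also have "\<dots> = (\<Sum>k. ennreal (unit_ball_vol DIM('a) * (c k * R k ^ DIM('a))))"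
    using nn by (intro suminf_cong) (simp add: nn_integral_cmult emeasure_cball flip: ennreal_mult'' ennreal_mult' mult.assoc)
  also have "\<dots> < \<infinity>"
  proof -
    have "(\<Sum>k. ennreal (unit_ball_vol DIM('a) * (c k * R k ^ DIM('a)))) \<noteq> top"
      using nn by (intro ennreal_suminf_neq_top summable_mult sm mult_nonneg_nonneg) auto
    then show ?thesis by (metis infinity_ennreal_def less_top)
  qed
  finally show ?thesis .
qed

text \<open>On dyadic shells shrinking to the origin the integrals form a geometric series of ratio
  \<open>(1/2) powr (DIM('a) - \<beta>)\<close>. The maxima defining \<beta> and \<open>T\<close>
  allow negative \<alpha> and arbitrary \<open>R\<close>.\<close>

lemma nn_integral_kernel_near:
  fixes R \<alpha> :: real
  assumes "\<alpha> < DIM('a)"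
  shows "(\<integral>\<^sup>+(z::'a::euclidean_space). ennreal (norm z powr (- \<alpha>)) * indicator (cball 0 R) z \<partial>lborel) < \<infinity>"
proof (rule nn_integral_shells_finite)
  define \<beta> where "\<beta> = max \<alpha> 0"
  define T where "T = max R 1"
  let ?R = "\<lambda>k. T * (1/2) ^ k"
  let ?c = "\<lambda>k. T powr (\<beta> - \<alpha>) * (T / 2 * (1/2) ^ k) powr (- \<beta>)"
  have \<beta>: "0 \<le> \<beta>" "\<alpha> \<le> \<beta>" "\<beta> < DIM('a)" and T: "0 < T" using assms by (auto simp: \<beta>_def T_def)
  show "\<exists>k. ennreal (norm z powr (- \<alpha>)) * indicator (cball 0 R) z \<le> ennreal (?c k) \<and> norm z \<le> ?R k"
    if "ennreal (norm z powr (- \<alpha>)) * indicator (cball 0 R) z \<noteq> 0" for z :: 'a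
  proof -
    have z: "0 < norm z" "norm z \<le> T" using that by (auto simp: T_def split: split_indicator_asm)
    have "\<exists>n. (1/2) ^ n < norm z / (T / 2)" using z T by (intro real_arch_pow_inv) auto
    then have ex: "\<exists>n. T / 2 * (1/2) ^ n < norm z" using T by (auto simp: field_simps)
    \<comment> \<open>Minimality gives the upper bound on the norm: the inner radius of shell
      \<open>k - 1\<close> is the outer radius of shell \<open>k\<close>.\<close>
    define k where "k = (LEAST n. T / 2 * (1/2) ^ n < norm z)"
    have k: "T / 2 * (1/2) ^ k < norm z" unfolding k_def by (rule LeastI_ex[OF ex])
    have up: "norm z \<le> ?R k"
    proof (cases k)
      case (Suc j)
      then have "\<not> T / 2 * (1/2) ^ j < norm z" unfolding k_def by (metis lessI not_less_Least)
      then show ?thesis using Suc by simp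
    qed (use z in simp)
    have "norm z powr (- \<alpha>) = norm z powr (\<beta> - \<alpha>) * norm z powr (- \<beta>)" by (simp flip: powr_add)
    also have "\<dots> \<le> T powr (\<beta> - \<alpha>) * (T / 2 * (1/2) ^ k) powr (- \<beta>)"
      using z k \<beta> T by (intro mult_mono powr_mono2 powr_mono2') auto
    finally show ?thesis using up by (intro exI[of _ k]) (auto split: split_indicator simp: ennreal_leI)
  qed
  have "?c k * ?R k ^ DIM('a) = T powr (\<beta> - \<alpha>) * (T / 2) powr (- \<beta>) * T ^ DIM('a) * ((1/2) powr (DIM('a) - \<beta>)) ^ k" for k
  proof -
    have "((1/2) ^ k) powr (- \<beta>) * ((1/2) ^ k) ^ DIM('a) = ((1/2) powr (DIM('a) - \<beta>)) ^ k"
      by (simp add: powr_realpow[symmetric] powr_powr algebra_simps flip: powr_add)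
    moreover have "(T / 2 * (1/2) ^ k) powr (- \<beta>) = (T / 2) powr (- \<beta>) * ((1/2) ^ k) powr (- \<beta>)"
      using T by (subst powr_mult) auto
    moreover have "?R k ^ DIM('a) = T ^ DIM('a) * ((1/2) ^ k) ^ DIM('a)" by (rule power_mult_distrib)
    ultimately show ?thesis by (simp only: mult_ac)
  qed
  moreover have "summable (\<lambda>k. T powr (\<beta> - \<alpha>) * (T / 2) powr (- \<beta>) * T ^ DIM('a) * ((1/2) powr (DIM('a) - \<beta>)) ^ k)"
  proof (intro summable_mult summable_geometric)
    have "(1/2 :: real) powr (DIM('a) - \<beta>) < (1/2) powr 0" using \<beta> by (intro powr_less_mono') auto
    then show "norm ((1/2 :: real) powr (DIM('a) - \<beta>)) < 1" by simp
  qed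
  ultimately show "summable (\<lambda>k. ?c k * ?R k ^ DIM('a))" by presburger
  show "0 \<le> ?R k" for k using T by simp
  show "(\<lambda>z::'a. ennreal (norm z powr (- \<alpha>)) * indicator (cball 0 R) z) \<in> borel_measurable borel"
    by measurable
qed auto

text \<open>The same with dyadic shells growing to infinity, where the ratio is
  \<open>2 powr (DIM('a) - \<alpha>)\<close>.\<close>

lemma nn_integral_kernel_far:
  fixes R \<alpha> :: real
  assumes "DIM('a) < \<alpha>" "0 < R"
  shows "(\<integral>\<^sup>+(z::'a::euclidean_space). ennreal (norm z powr (- \<alpha>)) * indicator (- ball 0 R) z \<partial>lborel) < \<infinity>"
proof (rule nn_integral_shells_finite)
  let ?R = "\<lambda>k. 2 * R * 2 ^ k"
  let ?c = "\<lambda>k. (R * 2 ^ k) powr (- \<alpha>)"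
  show "\<exists>k. ennreal (norm z powr (- \<alpha>)) * indicator (- ball 0 R) z \<le> ennreal (?c k) \<and> norm z \<le> ?R k"
    if "ennreal (norm z powr (- \<alpha>)) * indicator (- ball 0 R) z \<noteq> 0" for z :: 'a
  proof -
    have z: "R \<le> norm z" using that by (auto split: split_indicator_asm)
    have "\<exists>n. norm z / (2 * R) < 2 ^ n" by (intro real_arch_pow) auto
    then have ex: "\<exists>n. norm z < ?R n" using assms by (auto simp: field_simps)
    define k where "k = (LEAST n. norm z < ?R n)"
    have k: "norm z < ?R k" unfolding k_def by (rule LeastI_ex[OF ex])
    have low: "R * 2 ^ k \<le> norm z"
    proof (cases k)
      case (Suc j)
      then have "\<not> norm z < ?R j" unfolding k_def by (metis lessI not_less_Least)
      then show ?thesis using Suc by simp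
    qed (use z in simp)
    have "norm z powr (- \<alpha>) \<le> ?c k" using low assms by (intro powr_mono2') auto
    then show ?thesis using k by (intro exI[of _ k]) (auto split: split_indicator simp: ennreal_leI)
  qed
  have "?c k * ?R k ^ DIM('a) = R powr (- \<alpha>) * (2 * R) ^ DIM('a) * (2 powr (DIM('a) - \<alpha>)) ^ k" for k
  proof -
    have "(2 ^ k) powr (- \<alpha>) * (2 ^ k) ^ DIM('a) = ((2::real) powr (DIM('a) - \<alpha>)) ^ k"
      by (simp add: powr_realpow[symmetric] powr_powr algebra_simps flip: powr_add)
    moreover have "(R * 2 ^ k) powr (- \<alpha>) = R powr (- \<alpha>) * (2 ^ k) powr (- \<alpha>)"
      using assms by (subst powr_mult) auto
    moreover have "?R k ^ DIM('a) = (2 * R) ^ DIM('a) * (2 ^ k) ^ DIM('a)" by (rule power_mult_distrib)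
    ultimately show ?thesis by (simp only: mult_ac)
  qed
  moreover have "summable (\<lambda>k. R powr (- \<alpha>) * (2 * R) ^ DIM('a) * (2 powr (DIM('a) - \<alpha>)) ^ k)"
  proof (intro summable_mult summable_geometric)
    have "(2 :: real) powr (DIM('a) - \<alpha>) < 2 powr 0" using assms by (intro powr_less_mono) auto
    then show "norm ((2 :: real) powr (DIM('a) - \<alpha>)) < 1" by simp
  qed
  ultimately show "summable (\<lambda>k. ?c k * ?R k ^ DIM('a))" by presburger
  show "0 \<le> ?R k" for k using assms by simp
  show "(\<lambda>z::'a. ennreal (norm z powr (- \<alpha>)) * indicator (- ball 0 R) z) \<in> borel_measurable borel"
    by measurable
qed auto

section \<open>Fractional Sobolev inequalities\<close>

definition gagliardo_density :: "real \<Rightarrow> real \<Rightarrow> ('a::euclidean_space \<Rightarrow> real) \<Rightarrow> 'a \<times> 'a \<Rightarrow> real" where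
  "gagliardo_density p s u z =
     \<bar>u (fst z) - u (snd z)\<bar> powr p * norm (fst z - snd z) powr (- (real DIM('a) + p * s))"

text \<open>Integrates over all pairs instead of \<open>Q_set \<Omega>\<close>. For functions
  vanishing off \<Omega> the omitted set, both points outside, contributes nothing, and the full
  product permits Fubini and translation.\<close>

definition gagliardo :: "real \<Rightarrow> real \<Rightarrow> ('a::euclidean_space \<Rightarrow> real) \<Rightarrow> ennreal" where
  "gagliardo p s u = (\<integral>\<^sup>+z. ennreal (gagliardo_density p s u z) \<partial>lborel)"

text \<open>Borel representatives that vanish at every point off \<Omega>, not merely almost
  everywhere, so that pointwise estimates may distinguish cases by membership in \<Omega>.\<close>

definition bsupp :: "'a::euclidean_space set \<Rightarrow> ('a \<Rightarrow> real) set" where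
  "bsupp \<Omega> = {u \<in> borel_measurable borel. \<forall>x. x \<notin> \<Omega> \<longrightarrow> u x = 0}"

lemma bsuppD: "u \<in> bsupp \<Omega> \<Longrightarrow> u \<in> borel_measurable borel" "u \<in> bsupp \<Omega> \<Longrightarrow> x \<notin> \<Omega> \<Longrightarrow> u x = 0"
  by (auto simp: bsupp_def)

lemma measurable_fst_snd [measurable]:
  fixes u :: "'a::euclidean_space \<Rightarrow> 'b::topological_space"
  assumes [measurable]: "u \<in> borel_measurable borel"
  shows "(\<lambda>z::'a \<times> 'a. u (fst z)) \<in> borel_measurable borel"
    and "(\<lambda>z::'a \<times> 'a. u (snd z)) \<in> borel_measurable borel"
  by (simp_all add: borel_prod[symmetric])

lemma gagliardo_density_measurable [measurable]:
  assumes [measurable]: "u \<in> borel_measurable borel"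
  shows "gagliardo_density p s u \<in> borel_measurable borel"
  unfolding gagliardo_density_def[abs_def] by measurable

lemma gagliardo_density_nonneg [simp]: "0 \<le> gagliardo_density p s u z"
  by (simp add: gagliardo_density_def)

lemma gagliardo_iterated:
  assumes "u \<in> borel_measurable borel"
  shows "gagliardo p s u = (\<integral>\<^sup>+x. \<integral>\<^sup>+y. ennreal (gagliardo_density p s u (x, y)) \<partial>lborel \<partial>lborel)"
  unfolding gagliardo_def by (rule nn_integral_lborel_pair) (use assms in measurable)

lemma nn_integral_convolution:
  fixes f k :: "'a::euclidean_space \<Rightarrow> ennreal"
  assumes [measurable]: "f \<in> borel_measurable borel" "k \<in> borel_measurable borel"
  shows "(\<integral>\<^sup>+z. f (fst z) * k (fst z - snd z) \<partial>lborel) = (\<integral>\<^sup>+x. f x \<partial>lborel) * (\<integral>\<^sup>+x. k x \<partial>lborel)"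
    and "(\<integral>\<^sup>+z. f (snd z) * k (fst z - snd z) \<partial>lborel) = (\<integral>\<^sup>+x. f x \<partial>lborel) * (\<integral>\<^sup>+x. k x \<partial>lborel)"
proof -
  show "(\<integral>\<^sup>+z. f (fst z) * k (fst z - snd z) \<partial>lborel) = (\<integral>\<^sup>+x. f x \<partial>lborel) * (\<integral>\<^sup>+x. k x \<partial>lborel)"
    by (subst nn_integral_lborel_pair(1))
       (simp_all add: nn_integral_cmult nn_integral_lborel_translate nn_integral_multc)
  have tr: "(\<integral>\<^sup>+x. k (x - y) \<partial>lborel) = (\<integral>\<^sup>+x. k x \<partial>lborel)" for y
  proof -
    have "(\<integral>\<^sup>+x. k x \<partial>lborel) = (\<integral>\<^sup>+x. k x \<partial>distr lborel borel ((+) (- y)))"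
      by (simp only: lborel_distr_plus)
    also have "\<dots> = (\<integral>\<^sup>+x. k (- y + x) \<partial>lborel)" by (rule nn_integral_distr) auto
    finally show ?thesis by simp
  qed
  show "(\<integral>\<^sup>+z. f (snd z) * k (fst z - snd z) \<partial>lborel) = (\<integral>\<^sup>+x. f x \<partial>lborel) * (\<integral>\<^sup>+x. k x \<partial>lborel)"
    by (subst nn_integral_lborel_pair(2))
       (simp_all add: nn_integral_cmult tr nn_integral_multc)
qed

lemma integrable_convolution:
  fixes g k :: "'a::euclidean_space \<Rightarrow> real"
  assumes g: "integrable lborel g" "\<And>x. 0 \<le> g x" and k: "integrable lborel k" "\<And>x. 0 \<le> k x"
  shows "integrable lborel (\<lambda>z. g (fst z) * k (fst z - snd z))"
    and "integrable lborel (\<lambda>z. g (snd z) * k (fst z - snd z))"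
proof -
  have [measurable]: "g \<in> borel_measurable borel" "k \<in> borel_measurable borel"
    using g k by (auto dest: borel_measurable_integrable)
  have "(\<integral>\<^sup>+x. ennreal (g x) \<partial>lborel) * (\<integral>\<^sup>+x. ennreal (k x) \<partial>lborel) < \<infinity>"
    using g k by (simp add: nn_integral_eq_integral ennreal_mult_less_top)
  then show "integrable lborel (\<lambda>z. g (fst z) * k (fst z - snd z))"
    "integrable lborel (\<lambda>z. g (snd z) * k (fst z - snd z))"
    using nn_integral_convolution[of "\<lambda>x. ennreal (g x)" "\<lambda>x. ennreal (k x)"] g(2) k(2)
    by (auto intro!: integrableI_bounded simp: abs_mult ennreal_mult)
qed

text \<open>A ball \<open>B\<close> away from \<Omega> but at bounded distance is enough: for
  \<open>x\<close> in \<Omega> and \<open>y\<close> in \<open>B\<close> the difference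
  \<open>u x - u y\<close> is \<open>u x\<close> and the kernel is bounded below, so the inner
  integral over \<open>B\<close> alone controls \<open>\<bar>u x\<bar> powr p\<close>.\<close>

lemma fractional_poincare:
  fixes \<Omega> :: "'a::euclidean_space set"
  assumes "bounded \<Omega>" "0 < p" "0 \<le> s"
  shows "\<exists>C>0. \<forall>u\<in>bsupp \<Omega>. (\<integral>\<^sup>+x. ennreal (\<bar>u x\<bar> powr p) \<partial>lborel) \<le> ennreal C * gagliardo p s u"
proof -
  obtain R where R: "0 < R" "\<Omega> \<subseteq> ball 0 R"
    using bounded_subset_ballD[OF assms(1), of 0] by blast
  obtain e :: 'a where e: "e \<in> Basis" using nonempty_Basis by blast
  \<comment> \<open>With the centre at distance \<open>3 * R\<close> and radius \<open>R\<close>,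
    the ball misses \<open>ball 0 R\<close>, and its points are at distance at most
    \<open>5 * R\<close> from those of \<Omega>.\<close>
  define B where "B = ball ((3 * R) *\<^sub>R e) R"
  have B: "y \<notin> \<Omega>" "0 < norm (x - y)" "norm (x - y) \<le> 5 * R" if "x \<in> \<Omega>" "y \<in> B" for x y
  proof -
    have "norm ((3 * R) *\<^sub>R e) = 3 * R" using e R by simp
    moreover have "norm ((3 * R) *\<^sub>R e - y) < R" using that by (simp add: B_def dist_norm)
    ultimately have "2 * R < norm y" "norm y < 4 * R"
      using norm_triangle_ineq2[of "(3 * R) *\<^sub>R e" y] norm_triangle_ineq2[of y "(3 * R) *\<^sub>R e"]
      by (auto simp: norm_minus_commute)
    moreover have "norm x < R" using that R by auto
    ultimately show "y \<notin> \<Omega>" "0 < norm (x - y)" "norm (x - y) \<le> 5 * R"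
      using R norm_triangle_ineq4[of x y] by (auto simp: subset_iff)
  qed
  define V where "V = measure lborel B"
  have V: "0 < V" "emeasure lborel B = ennreal V"
  proof -
    show "0 < V" using R by (simp add: V_def B_def)
    have "emeasure lborel B \<noteq> top"
      using emeasure_lborel_ball_finite unfolding B_def by (metis infinity_ennreal_def less_irrefl)
    then show "emeasure lborel B = ennreal V" unfolding V_def by (rule emeasure_eq_ennreal_measure)
  qed
  define c where "c = (5 * R) powr (- (real DIM('a) + p * s)) * V"
  have c: "0 < c" using R V by (simp add: c_def)
  have "(\<integral>\<^sup>+x. ennreal (\<bar>u x\<bar> powr p) \<partial>lborel) \<le> ennreal (1 / c) * gagliardo p s u" if u: "u \<in> bsupp \<Omega>" for u
  proof -
    have [measurable]: "u \<in> borel_measurable borel" using u by (rule bsuppD)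
    have "ennreal (\<bar>u x\<bar> powr p) * ennreal c \<le> (\<integral>\<^sup>+y. ennreal (gagliardo_density p s u (x, y)) \<partial>lborel)" for x
    proof (cases "x \<in> \<Omega>")
      case True
      have "ennreal (\<bar>u x\<bar> powr p) * ennreal c
          = (\<integral>\<^sup>+y. ennreal (\<bar>u x\<bar> powr p * (5 * R) powr (- (real DIM('a) + p * s))) * indicator B y \<partial>lborel)"
        using V c R by (subst nn_integral_cmult_indicator) (auto simp: B_def c_def mult.assoc simp flip: ennreal_mult'')
      also have "\<dots> \<le> (\<integral>\<^sup>+y. ennreal (gagliardo_density p s u (x, y)) \<partial>lborel)"
      proof (intro nn_integral_mono)
        fix y
        show "ennreal (\<bar>u x\<bar> powr p * (5 * R) powr (- (real DIM('a) + p * s))) * indicator B y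
           \<le> ennreal (gagliardo_density p s u (x, y))"
        proof (cases "y \<in> B")
          case yB: True
          have "(5 * R) powr (- (real DIM('a) + p * s)) \<le> norm (x - y) powr (- (real DIM('a) + p * s))"
          proof (rule powr_mono2')
            have "0 \<le> p * s" using assms by simp
            then show "- (real DIM('a) + p * s) \<le> 0" by linarith
          qed (use B[OF True yB] in auto)
          then show ?thesis using yB bsuppD(2)[OF u B(1)[OF True yB]]
            by (auto simp: gagliardo_density_def intro!: ennreal_leI mult_left_mono)
        qed simp
      qed
      finally show ?thesis .
    qed (use bsuppD(2)[OF u] assms in simp)
    then have "(\<integral>\<^sup>+x. ennreal (\<bar>u x\<bar> powr p) * ennreal c \<partial>lborel) \<le> gagliardo p s u"
      by (subst gagliardo_iterated) (auto intro!: nn_integral_mono)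
    then have "(\<integral>\<^sup>+x. ennreal (\<bar>u x\<bar> powr p) \<partial>lborel) * ennreal c \<le> gagliardo p s u"
      by (subst (asm) nn_integral_multc) auto
    then have "ennreal (1 / c) * ((\<integral>\<^sup>+x. ennreal (\<bar>u x\<bar> powr p) \<partial>lborel) * ennreal c) \<le> ennreal (1 / c) * gagliardo p s u"
      by (rule mult_left_mono) simp
    moreover have "ennreal (1 / c) * (I * ennreal c) = I" for I
    proof -
      have "ennreal (1 / c) * ennreal c = 1" using c by (simp flip: ennreal_mult')
      then show ?thesis by (metis mult.left_commute mult.right_neutral)
    qed
    ultimately show ?thesis by simp
  qed
  then show ?thesis using c by (intro exI[of _ "1 / c"]) auto
qed

text \<open>
  On a ball of volume twice the Chebyshev bound for \<open>{\<bar>u\<bar> \<ge> \<bar>u x\<bar> / 2}\<close>, the function \<open>u\<close> differs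
  from \<open>u x\<close> by at least \<open>\<bar>u x\<bar> / 2\<close> on half of the ball.
\<close>
lemma sobolev_gain:
  fixes s \<sigma> m :: real
  assumes s: "0 < s" and \<sigma>: "0 < \<sigma>" and m: "0 < m"
  shows "\<exists>C>0. \<forall>u\<in>borel_measurable borel. (\<integral>\<^sup>+(x::'a::euclidean_space). ennreal (\<bar>u x\<bar> powr \<sigma>) \<partial>lborel) \<le> ennreal m \<longrightarrow>
    (\<integral>\<^sup>+x. ennreal (\<bar>u x\<bar> powr (2 + 2 * s / real DIM('a) * \<sigma>)) \<partial>lborel) \<le> ennreal C * gagliardo 2 s u"
proof -
  define N where "N = real DIM('a)"
  define \<omega> where "\<omega> = unit_ball_vol N"
  have N: "0 < N" by (simp add: N_def)
  have \<omega>: "0 < \<omega>" using N by (simp add: \<omega>_def)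
  \<comment> \<open>Makes the volume of the ball of radius \<open>t\<close> below, with
    \<open>t powr N = A * \<tau> powr (- \<sigma>)\<close>, exactly twice the Chebyshev bound
    \<open>m * (\<tau> / 2) powr (- \<sigma>)\<close>.\<close>
  define A where "A = 2 * m * 2 powr \<sigma> / \<omega>"
  have A: "0 < A" using m \<omega> by (simp add: A_def)
  \<comment> \<open>The factor 1/8 combines 1/4 from the squared difference \<tau>/2 with 1/2 from
    the proportion of the ball that is used.\<close>
  define c where "c = \<omega> / 8 * A powr (- 2 * s / N)"
  have c: "0 < c" using \<omega> A by (simp add: c_def)
  have "(\<integral>\<^sup>+x. ennreal (\<bar>u x\<bar> powr (2 + 2 * s / N * \<sigma>)) \<partial>lborel) \<le> ennreal (1 / c) * gagliardo 2 s u"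
    if u[measurable]: "u \<in> borel_measurable borel" and um: "(\<integral>\<^sup>+x. ennreal (\<bar>u x\<bar> powr \<sigma>) \<partial>lborel) \<le> ennreal m" for u :: "'a \<Rightarrow> real"
  proof -
    have "ennreal c * ennreal (\<bar>u x\<bar> powr (2 + 2 * s / N * \<sigma>)) \<le> (\<integral>\<^sup>+y. ennreal (gagliardo_density 2 s u (x, y)) \<partial>lborel)" for x
    proof (cases "u x = 0")
      case False
      define \<tau> where "\<tau> = \<bar>u x\<bar>"
      have \<tau>: "0 < \<tau>" using False by (simp add: \<tau>_def)
      define t where "t = (A * \<tau> powr (- \<sigma>)) powr (1 / N)"
      have t: "0 < t" using A \<tau> by (simp add: t_def)
      have tN: "t powr N = A * \<tau> powr (- \<sigma>)" using N A \<tau> by (simp add: t_def powr_powr)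
      define V where "V = \<omega> * t powr N"
      have V0: "0 < V" using \<omega> t by (simp add: V_def)
      define E where "E = {y. \<tau> / 2 \<le> \<bar>u y\<bar>}"
      have [measurable]: "E \<in> sets borel" unfolding E_def by measurable
      define B where "B = cball x t"
      have emB: "emeasure lborel B = ennreal V"
        using t by (simp add: B_def emeasure_cball V_def \<omega>_def N_def powr_realpow)
      have "ennreal ((\<tau> / 2) powr \<sigma>) * emeasure lborel E = (\<integral>\<^sup>+y. ennreal ((\<tau> / 2) powr \<sigma>) * indicator E y \<partial>lborel)"
        by (simp add: nn_integral_cmult_indicator)
      also have "\<dots> \<le> (\<integral>\<^sup>+x. ennreal (\<bar>u x\<bar> powr \<sigma>) \<partial>lborel)"
        using \<tau> \<sigma> by (intro nn_integral_mono) (auto simp: E_def split: split_indicator intro!: ennreal_leI powr_mono2)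
      also note um
      finally have "ennreal ((\<tau> / 2) powr (- \<sigma>)) * (ennreal ((\<tau> / 2) powr \<sigma>) * emeasure lborel E) \<le> ennreal ((\<tau> / 2) powr (- \<sigma>)) * ennreal m"
        by (rule mult_left_mono) simp
      moreover have "ennreal ((\<tau> / 2) powr (- \<sigma>)) * (ennreal ((\<tau> / 2) powr \<sigma>) * emeasure lborel E) = emeasure lborel E"
      proof -
        have "ennreal ((\<tau> / 2) powr (- \<sigma>)) * ennreal ((\<tau> / 2) powr \<sigma>) = 1"
          using \<tau> by (simp flip: ennreal_mult'' powr_add)
        then show ?thesis by (simp add: mult.assoc[symmetric])
      qed
      moreover have "(\<tau> / 2) powr (- \<sigma>) * m = V / 2"
        using \<omega> \<tau> by (simp add: V_def tN A_def powr_divide powr_minus field_simps)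
      ultimately have emE: "emeasure lborel E \<le> ennreal (V / 2)"
        using m by (simp flip: ennreal_mult'')
      have "ennreal (V / 2) + ennreal (V / 2) = emeasure lborel B" using V0 emB by (simp flip: ennreal_plus)
      also have "\<dots> \<le> emeasure lborel (B - E \<union> E)" by (intro emeasure_mono) (auto simp: B_def)
      also have "\<dots> \<le> emeasure lborel (B - E) + emeasure lborel E"
        by (intro emeasure_subadditive) (auto simp: B_def)
      also have "\<dots> \<le> emeasure lborel (B - E) + ennreal (V / 2)" by (intro add_left_mono emE)
      finally have half: "ennreal (V / 2) \<le> emeasure lborel (B - E)"
        by (simp add: ennreal_add_left_cancel_le add.commute)
      \<comment> \<open>The source of the gain: kernel times volume is of order
        \<open>t powr (- 2 * s)\<close>, and as \<open>t\<close> is the power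
        \<open>- \<sigma> / N\<close> of \<tau> up to a constant, this contributes the exponent
        \<open>2 * s / N * \<sigma>\<close>.\<close>
      have "c * \<tau> powr (2 + 2 * s / N * \<sigma>) = (\<tau> / 2)\<^sup>2 * t powr (- (N + 2 * s)) * (V / 2)"
      proof -
        have "t powr (- (N + 2 * s)) * V = \<omega> * t powr (- 2 * s)" by (simp add: V_def flip: powr_add)
        moreover have "t powr (- 2 * s) = A powr (- 2 * s / N) * \<tau> powr (2 * s / N * \<sigma>)"
          using A \<tau> N by (simp add: t_def powr_powr powr_mult mult_ac)
        moreover have "\<tau> powr (2 + 2 * s / N * \<sigma>) = \<tau>\<^sup>2 * \<tau> powr (2 * s / N * \<sigma>)"
          using \<tau> by (simp add: powr_add)
        ultimately show ?thesis by (simp add: c_def power_divide)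
      qed
      then have "ennreal c * ennreal (\<tau> powr (2 + 2 * s / N * \<sigma>))
          = ennreal ((\<tau> / 2)\<^sup>2 * t powr (- (N + 2 * s))) * ennreal (V / 2)"
        using c V0 by (simp flip: ennreal_mult'')
      also have "\<dots> \<le> ennreal ((\<tau> / 2)\<^sup>2 * t powr (- (N + 2 * s))) * emeasure lborel (B - E)"
        by (intro mult_left_mono half) simp
      also have "\<dots> = (\<integral>\<^sup>+y. ennreal ((\<tau> / 2)\<^sup>2 * t powr (- (N + 2 * s))) * indicator (B - E) y \<partial>lborel)"
        by (subst nn_integral_cmult_indicator) (auto simp: B_def)
      also have "\<dots> \<le> (\<integral>\<^sup>+y. ennreal (gagliardo_density 2 s u (x, y)) \<partial>lborel)"
      proof (intro nn_integral_mono)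
        fix y
        show "ennreal ((\<tau> / 2)\<^sup>2 * t powr (- (N + 2 * s))) * indicator (B - E) y \<le> ennreal (gagliardo_density 2 s u (x, y))"
        proof (cases "y \<in> B - E")
          case True
          then have y: "norm (x - y) \<le> t" "\<bar>u y\<bar> < \<tau> / 2" by (auto simp: B_def E_def dist_norm)
          then have "x \<noteq> y" using \<tau> by (auto simp: \<tau>_def)
          have "t powr (- (N + 2 * s)) \<le> norm (x - y) powr (- (N + 2 * s))"
            using y \<open>x \<noteq> y\<close> s N by (intro powr_mono2') auto
          moreover have "\<tau> / 2 \<le> \<bar>u x - u y\<bar>" using y unfolding \<tau>_def by linarith
          then have "(\<tau> / 2)\<^sup>2 \<le> \<bar>u x - u y\<bar>\<^sup>2" using \<tau> by (intro power_mono) auto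
          ultimately have "(\<tau> / 2)\<^sup>2 * t powr (- (N + 2 * s)) \<le> gagliardo_density 2 s u (x, y)"
            unfolding gagliardo_density_def N_def by (auto intro!: mult_mono)
          then show ?thesis using True by (simp add: ennreal_leI)
        qed simp
      qed
      finally show ?thesis by (simp add: \<tau>_def)
    qed simp
    then have "(\<integral>\<^sup>+x. ennreal c * ennreal (\<bar>u x\<bar> powr (2 + 2 * s / N * \<sigma>)) \<partial>lborel) \<le> gagliardo 2 s u"
      by (subst gagliardo_iterated) (auto intro!: nn_integral_mono)
    then have "ennreal c * (\<integral>\<^sup>+x. ennreal (\<bar>u x\<bar> powr (2 + 2 * s / N * \<sigma>)) \<partial>lborel) \<le> gagliardo 2 s u"
      by (subst (asm) nn_integral_cmult) auto
    then have "ennreal (1 / c) * (ennreal c * (\<integral>\<^sup>+x. ennreal (\<bar>u x\<bar> powr (2 + 2 * s / N * \<sigma>)) \<partial>lborel)) \<le> ennreal (1 / c) * gagliardo 2 s u"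
      by (rule mult_left_mono) simp
    moreover have "ennreal (1 / c) * (ennreal c * I) = I" for I
    proof -
      have "ennreal (1 / c) * ennreal c = 1" using c by (simp flip: ennreal_mult')
      then show ?thesis by (metis mult.assoc mult.left_neutral)
    qed
    ultimately show ?thesis by simp
  qed
  then show ?thesis using c unfolding N_def by (intro exI[of _ "1 / c"]) auto
qed

text \<open>The critical exponent is the fixed point of the map from \<sigma> to
  \<open>2 + \<theta> * \<sigma>\<close> with \<open>\<theta> = 2 * s / n\<close>, so each step
  multiplies the distance to it by \<theta>.\<close>

lemma affine_iteration:
  fixes S \<theta> a :: real
  assumes "S = 2 + \<theta> * S" shows "S - (S - 2) * (\<theta> * a) = 2 + \<theta> * (S - (S - 2) * a)"
  using assms by (simp add: algebra_simps)

text \<open>For \<open>k = 0\<close> the exponent is 2 and the bound is the Poincare inequality;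
  every further step is one application of \<open>sobolev_gain\<close>. Since
  \<open>2 * s < n\<close>, the exponents increase to the critical one.\<close>

lemma fractional_sobolev_iterated:
  fixes \<Omega> :: "'a::euclidean_space set" and s M :: real and k :: nat
  assumes \<Omega>: "bounded \<Omega>" and s: "0 < s" "2 * s < DIM('a)" and M: "0 < M"
  shows "\<exists>C>0. \<forall>u\<in>bsupp \<Omega>. gagliardo 2 s u \<le> ennreal M \<longrightarrow>
    (\<integral>\<^sup>+x. ennreal (\<bar>u x\<bar> powr (crit_sobolev (real DIM('a)) s
       - (crit_sobolev (real DIM('a)) s - 2) * (2 * s / real DIM('a)) ^ k)) \<partial>lborel) \<le> ennreal C"
proof (induction k)
  case 0
  obtain C where C: "C > 0" "\<And>u. u \<in> bsupp \<Omega> \<Longrightarrow> (\<integral>\<^sup>+x. ennreal (\<bar>u x\<bar> powr 2) \<partial>lborel) \<le> ennreal C * gagliardo 2 s u"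
    using fractional_poincare[OF \<Omega>, of 2 s] s by (auto simp del: powr_numeral)
  have "(\<integral>\<^sup>+x. ennreal (\<bar>u x\<bar> powr 2) \<partial>lborel) \<le> ennreal (C * M)"
    if "u \<in> bsupp \<Omega>" "gagliardo 2 s u \<le> ennreal M" for u
    using C(2)[OF that(1)] mult_left_mono[OF that(2), of "ennreal C"] C(1) M
    by (simp add: ennreal_mult del: powr_numeral)
  then show ?case using C M by (intro exI[of _ "C * M"]) (auto simp del: powr_numeral)
next
  case (Suc k)
  define N where "N = real DIM('a)"
  define S where "S = crit_sobolev N s"
  define \<sigma> where "\<sigma> j = S - (S - 2) * (2 * s / N) ^ j" for j
  have N: "2 * s < N" "0 < N" using s by (auto simp: N_def)
  have S2: "2 < S" using N s by (simp add: S_def crit_sobolev_def field_simps)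
  have "(2 * s / N) ^ k \<le> 1" using s N by (intro power_le_one) auto
  then have "(S - 2) * (2 * s / N) ^ k \<le> S - 2" using S2 by (simp add: mult_left_le)
  then have \<sigma>0: "0 < \<sigma> k" using S2 unfolding \<sigma>_def by linarith
  have "S = 2 + 2 * s / N * S" using N by (simp add: S_def crit_sobolev_def field_simps)
  then have \<sigma>S: "\<sigma> (Suc k) = 2 + 2 * s / N * \<sigma> k"
    using affine_iteration[of S "2 * s / N"] unfolding \<sigma>_def power_Suc by blast
  obtain C where C: "C > 0" "\<And>u. u \<in> bsupp \<Omega> \<Longrightarrow> gagliardo 2 s u \<le> ennreal M \<Longrightarrow>
      (\<integral>\<^sup>+x. ennreal (\<bar>u x\<bar> powr \<sigma> k) \<partial>lborel) \<le> ennreal C"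
    using Suc unfolding \<sigma>_def S_def N_def by auto
  obtain D where D: "D > 0" "\<And>u::'a \<Rightarrow> real. u \<in> borel_measurable borel \<Longrightarrow>
      (\<integral>\<^sup>+x. ennreal (\<bar>u x\<bar> powr \<sigma> k) \<partial>lborel) \<le> ennreal C \<Longrightarrow>
      (\<integral>\<^sup>+x. ennreal (\<bar>u x\<bar> powr (2 + 2 * s / N * \<sigma> k)) \<partial>lborel) \<le> ennreal D * gagliardo 2 s u"
    using sobolev_gain[OF s(1) \<sigma>0 C(1), where 'a = 'a] unfolding N_def by auto
  have "(\<integral>\<^sup>+x. ennreal (\<bar>u x\<bar> powr \<sigma> (Suc k)) \<partial>lborel) \<le> ennreal (D * M)"
    if u: "u \<in> bsupp \<Omega>" "gagliardo 2 s u \<le> ennreal M" for u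
  proof -
    have "(\<integral>\<^sup>+x. ennreal (\<bar>u x\<bar> powr \<sigma> (Suc k)) \<partial>lborel) \<le> ennreal D * gagliardo 2 s u"
      unfolding \<sigma>S by (rule D(2)[OF bsuppD(1)[OF u(1)] C(2)[OF u]])
    also have "\<dots> \<le> ennreal D * ennreal M" by (rule mult_left_mono[OF u(2)]) simp
    finally show ?thesis using D M by (simp add: ennreal_mult)
  qed
  then show ?case using D M unfolding \<sigma>_def S_def N_def by (intro exI[of _ "D * M"]) auto
qed

text \<open>Some iterated exponent reaches \<sigma>. The power \<sigma> is then dominated by that
  larger power plus the indicator of \<Omega>, which has finite measure.\<close>

lemma fractional_sobolev_subcritical:
  fixes \<Omega> :: "'a::euclidean_space set" and s M \<sigma> :: real
  assumes \<Omega>: "bounded \<Omega>" "\<Omega> \<in> sets borel" and s: "0 < s" "2 * s < DIM('a)"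
    and \<sigma>: "0 < \<sigma>" "\<sigma> < crit_sobolev (real DIM('a)) s"
  shows "\<exists>C>0. \<forall>u\<in>bsupp \<Omega>. gagliardo 2 s u \<le> ennreal M \<longrightarrow>
    (\<integral>\<^sup>+x. ennreal (\<bar>u x\<bar> powr \<sigma>) \<partial>lborel) \<le> ennreal C"
proof -
  define N where "N = real DIM('a)"
  define S where "S = crit_sobolev N s"
  have N: "2 * s < N" "0 < N" using s by (auto simp: N_def)
  have S2: "2 < S" using N s by (simp add: S_def crit_sobolev_def field_simps)
  have \<sigma>S: "\<sigma> < S" using \<sigma> by (simp add: S_def N_def)
  obtain k where "(2 * s / N) ^ k < (S - \<sigma>) / (S - 2)"
    using real_arch_pow_inv[of "(S - \<sigma>) / (S - 2)" "2 * s / N"] N s S2 \<sigma>S by auto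
  then have k: "\<sigma> \<le> S - (S - 2) * (2 * s / N) ^ k" using S2 by (simp add: field_simps)
  obtain C where C: "C > 0" "\<And>u. u \<in> bsupp \<Omega> \<Longrightarrow> gagliardo 2 s u \<le> ennreal (max M 1) \<Longrightarrow>
      (\<integral>\<^sup>+x. ennreal (\<bar>u x\<bar> powr (S - (S - 2) * (2 * s / N) ^ k)) \<partial>lborel) \<le> ennreal C"
  proof -
    have "0 < max M 1" by simp
    from fractional_sobolev_iterated[OF \<Omega>(1) s this, of k] show thesis
      using that unfolding S_def N_def by blast
  qed
  have em: "emeasure lborel \<Omega> = ennreal (measure lborel \<Omega>)"
    using emeasure_bounded_finite[OF \<Omega>(1)] by (simp add: emeasure_eq_ennreal_measure less_top)
  have "(\<integral>\<^sup>+x. ennreal (\<bar>u x\<bar> powr \<sigma>) \<partial>lborel) \<le> ennreal (C + measure lborel \<Omega>)"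
    if u: "u \<in> bsupp \<Omega>" and M: "gagliardo 2 s u \<le> ennreal M" for u
  proof -
    have [measurable]: "u \<in> borel_measurable borel" "\<Omega> \<in> sets borel" using u \<Omega> by (auto intro: bsuppD)
    have "(\<integral>\<^sup>+x. ennreal (\<bar>u x\<bar> powr \<sigma>) \<partial>lborel)
        \<le> (\<integral>\<^sup>+x. ennreal (\<bar>u x\<bar> powr (S - (S - 2) * (2 * s / N) ^ k)) + indicator \<Omega> x \<partial>lborel)"
    proof (rule nn_integral_mono)
      fix x
      show "ennreal (\<bar>u x\<bar> powr \<sigma>) \<le> ennreal (\<bar>u x\<bar> powr (S - (S - 2) * (2 * s / N) ^ k)) + indicator \<Omega> x"
      proof (cases "\<bar>u x\<bar> \<le> 1")
        case True
        have "\<bar>u x\<bar> powr \<sigma> \<le> 1" using True \<sigma> powr_mono2[of \<sigma> "\<bar>u x\<bar>" 1] by simp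
        then have "ennreal (\<bar>u x\<bar> powr \<sigma>) \<le> indicator \<Omega> x" using bsuppD(2)[OF u, of x] \<sigma> by (cases "x \<in> \<Omega>") auto
        then show ?thesis by (simp add: add_increasing)
      next
        case False
        then have "\<bar>u x\<bar> powr \<sigma> \<le> \<bar>u x\<bar> powr (S - (S - 2) * (2 * s / N) ^ k)" using k by (intro powr_mono) auto
        then show ?thesis by (simp add: add_increasing2 ennreal_leI)
      qed
    qed
    also have "\<dots> = (\<integral>\<^sup>+x. ennreal (\<bar>u x\<bar> powr (S - (S - 2) * (2 * s / N) ^ k)) \<partial>lborel) + emeasure lborel \<Omega>"
      by (subst nn_integral_add) auto
    also have "\<dots> \<le> ennreal C + ennreal (measure lborel \<Omega>)"
      unfolding em by (intro add_right_mono C(2) u order_trans[OF M]) (simp add: ennreal_leI)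
    finally show ?thesis using C by simp
  qed
  then show ?thesis using C by (intro exI[of _ "C + measure lborel \<Omega>"]) (auto simp: add_pos_nonneg)
qed

lemma powr_young_interpolation:
  fixes X Y \<theta> :: real
  assumes "0 \<le> X" "0 \<le> Y" "0 \<le> \<theta>" "\<theta> \<le> 1"
  shows "X powr \<theta> * Y powr (1 - \<theta>) \<le> X + Y"
proof (cases "max X Y = 0")
  case False
  then have "0 < max X Y" using assms by linarith
  have "X powr \<theta> * Y powr (1 - \<theta>) \<le> max X Y powr \<theta> * max X Y powr (1 - \<theta>)"
    using assms by (intro mult_mono powr_mono2) auto
  also have "\<dots> = max X Y" using \<open>0 < max X Y\<close> by (simp flip: powr_add)
  finally show ?thesis using assms by linarith
qed (use assms in \<open>auto simp: max_def split: if_splits\<close>)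

text \<open>At distance at most 1 the \<open>p\<close>-density is a geometric mean, with weights
  \<open>p / 2\<close> and \<open>1 - p / 2\<close>, of the quadratic density and a pure kernel that
  is integrable near 0 because \<open>s2 < s1\<close>. At larger distances the difference is split
  into its two values, and the kernel is integrable at infinity.\<close>

lemma gagliardo_embedding:
  fixes \<Omega> :: "'a::euclidean_space set" and s1 s2 p M :: real
  assumes \<Omega>: "bounded \<Omega>" "\<Omega> \<in> sets borel" and s: "0 < s2" "s2 < s1" "2 * s1 < DIM('a)" and p: "1 < p" "p < 2"
  shows "\<exists>C>0. \<forall>u\<in>bsupp \<Omega>. gagliardo 2 s1 u \<le> ennreal M \<longrightarrow> gagliardo p s2 u \<le> ennreal C"
proof -
  define N where "N = real DIM('a)"
  have N: "2 * s1 < N" "0 < N" using s by (auto simp: N_def)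
  \<comment> \<open>Solves
    \<open>N + p * s2 = (N + 2 * s1) * (p / 2) + \<alpha> * (1 - p / 2)\<close>, the balance of
    exponents in the geometric mean.\<close>
  define \<alpha> where "\<alpha> = N - 2 * p * (s1 - s2) / (2 - p)"
  define \<beta> where "\<beta> = N + p * s2"
  define kn where "kn z = ennreal (norm z powr (- \<alpha>)) * indicator (cball 0 1) z" for z :: 'a
  define kf where "kf z = ennreal (norm z powr (- \<beta>)) * indicator (- ball 0 1) z" for z :: 'a
  have [measurable]: "kn \<in> borel_measurable borel" "kf \<in> borel_measurable borel" "\<Omega> \<in> sets borel"
    unfolding kn_def[abs_def] kf_def[abs_def] using \<Omega> by measurable
  have "(\<integral>\<^sup>+z. kn z \<partial>lborel) < \<infinity>" "(\<integral>\<^sup>+z. kf z \<partial>lborel) < \<infinity>"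
    unfolding kn_def kf_def \<alpha>_def \<beta>_def N_def using s p
    by (intro nn_integral_kernel_near nn_integral_kernel_far; simp)+
  then obtain In If where In: "(\<integral>\<^sup>+z. kn z \<partial>lborel) = ennreal In" "0 \<le> In"
      and If: "(\<integral>\<^sup>+z. kf z \<partial>lborel) = ennreal If" "0 \<le> If"
    by (metis ennreal_cases infinity_ennreal_def less_irrefl)
  have em: "emeasure lborel \<Omega> = ennreal (measure lborel \<Omega>)"
    using emeasure_bounded_finite[OF \<Omega>(1)] by (simp add: emeasure_eq_ennreal_measure less_top)
  have "p < crit_sobolev (real DIM('a)) s1"
  proof -
    have "2 < crit_sobolev N s1" using N s by (simp add: crit_sobolev_def field_simps)
    then show ?thesis using p by (simp add: N_def)
  qed
  then obtain C where C: "C > 0" "\<And>u. u \<in> bsupp \<Omega> \<Longrightarrow> gagliardo 2 s1 u \<le> ennreal M \<Longrightarrow>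
      (\<integral>\<^sup>+x. ennreal (\<bar>u x\<bar> powr p) \<partial>lborel) \<le> ennreal C"
    using fractional_sobolev_subcritical[OF \<Omega>, of s1 p M] s p by auto
  define D where "D = max M 0 + 2 * (measure lborel \<Omega> * In) + 2 * (2 powr p * C * If)"
  have "gagliardo p s2 u \<le> ennreal D"
    if u: "u \<in> bsupp \<Omega>" and M: "gagliardo 2 s1 u \<le> ennreal M" for u
  proof -
    have [measurable]: "u \<in> borel_measurable borel" using u by (rule bsuppD)
    define F where "F x = ennreal (2 powr p) * ennreal (\<bar>u x\<bar> powr p)" for x
    have [measurable]: "F \<in> borel_measurable borel" unfolding F_def by measurable
    have "(\<integral>\<^sup>+x. F x \<partial>lborel) = ennreal (2 powr p) * (\<integral>\<^sup>+x. ennreal (\<bar>u x\<bar> powr p) \<partial>lborel)"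
      unfolding F_def by (rule nn_integral_cmult) measurable
    also have "\<dots> \<le> ennreal (2 powr p) * ennreal C" by (intro mult_left_mono C u M) simp
    finally have F: "(\<integral>\<^sup>+x. F x \<partial>lborel) \<le> ennreal (2 powr p * C)" using C(1) by (simp add: ennreal_mult'')
    have pointwise: "ennreal (gagliardo_density p s2 u z) \<le> ennreal (gagliardo_density 2 s1 u z)
        + indicator \<Omega> (fst z) * kn (fst z - snd z) + indicator \<Omega> (snd z) * kn (fst z - snd z)
        + F (fst z) * kf (fst z - snd z) + F (snd z) * kf (fst z - snd z)" for z
    proof -
      obtain x y where z: "z = (x, y)" by (cases z)
      define d where "d = norm (x - y)"
      show ?thesis
      proof (cases "d \<le> 1")
        case near: True
        show ?thesis
        proof (cases "x \<in> \<Omega> \<or> y \<in> \<Omega>")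
          case True
          have e: "- (N + p * s2) = - (N + 2 * s1) * (p / 2) + - \<alpha> * (1 - p / 2)"
            using p by (simp add: \<alpha>_def field_simps)
          have "gagliardo_density p s2 u z = (\<bar>u x - u y\<bar> powr 2) powr (p / 2) * (d powr (- (N + 2 * s1) * (p / 2)) * d powr (- \<alpha> * (1 - p / 2)))"
            unfolding gagliardo_density_def z N_def[symmetric] fst_conv snd_conv d_def[symmetric] e powr_add
            by (simp add: powr_powr del: powr_numeral)
          also have "\<dots> = (gagliardo_density 2 s1 u z) powr (p / 2) * (d powr (- \<alpha>)) powr (1 - p / 2)"
            unfolding gagliardo_density_def z N_def[symmetric] fst_conv snd_conv d_def[symmetric]
            by (simp add: powr_mult powr_powr del: powr_numeral)
          also have "\<dots> \<le> gagliardo_density 2 s1 u z + d powr (- \<alpha>)"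
            using p by (intro powr_young_interpolation) auto
          finally have "ennreal (gagliardo_density p s2 u z) \<le> ennreal (gagliardo_density 2 s1 u z) + ennreal (d powr (- \<alpha>))"
            by (simp add: ennreal_leI flip: ennreal_plus)
          \<comment> \<open>The indicators of \<Omega> keep the kernel integrable over pairs; they
            may be inserted because one of the two points lies in \<Omega>.\<close>
          also have "ennreal (d powr (- \<alpha>)) \<le> indicator \<Omega> x * kn (x - y) + indicator \<Omega> y * kn (x - y)"
            using True near by (auto simp: kn_def d_def split: split_indicator)
          finally have le: "ennreal (gagliardo_density p s2 u z) \<le> ennreal (gagliardo_density 2 s1 u z)
              + (indicator \<Omega> x * kn (x - y) + indicator \<Omega> y * kn (x - y))" by (simp add: add_left_mono)
          show ?thesis
            using add_increasing2[OF _ le, of "F x * kf (x - y) + F y * kf (x - y)"] by (simp add: z add.assoc)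
        next
          case False
          then show ?thesis using bsuppD(2)[OF u] p by (simp add: z gagliardo_density_def)
        qed
      next
        case False
        have "gagliardo_density p s2 u z \<le> 2 powr p * (\<bar>u x\<bar> powr p + \<bar>u y\<bar> powr p) * d powr (- \<beta>)"
          unfolding gagliardo_density_def z \<beta>_def N_def fst_conv snd_conv d_def
          using abs_add_powr_le[of p "u x" "- u y"] p by (intro mult_right_mono) auto
        then have "ennreal (gagliardo_density p s2 u z) \<le> ennreal (2 powr p * (\<bar>u x\<bar> powr p + \<bar>u y\<bar> powr p) * d powr (- \<beta>))"
          by (rule ennreal_leI)
        also have "\<dots> = (F x + F y) * ennreal (d powr (- \<beta>))"
          by (simp add: F_def ennreal_mult'' ennreal_mult distrib_left distrib_right)
        also have "\<dots> = F x * kf (x - y) + F y * kf (x - y)"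
          using False by (simp add: kf_def d_def distrib_right)
        finally show ?thesis by (simp add: z add_increasing add.assoc)
      qed
    qed
    have "gagliardo p s2 u \<le> (\<integral>\<^sup>+z. ennreal (gagliardo_density 2 s1 u z)
        + indicator \<Omega> (fst z) * kn (fst z - snd z) + indicator \<Omega> (snd z) * kn (fst z - snd z)
        + F (fst z) * kf (fst z - snd z) + F (snd z) * kf (fst z - snd z) \<partial>lborel)"
      unfolding gagliardo_def by (intro nn_integral_mono pointwise)
    also have "\<dots> = gagliardo 2 s1 u + (\<integral>\<^sup>+z. indicator \<Omega> (fst z) * kn (fst z - snd z) \<partial>lborel)
        + (\<integral>\<^sup>+z. indicator \<Omega> (snd z) * kn (fst z - snd z) \<partial>lborel)
        + (\<integral>\<^sup>+z. F (fst z) * kf (fst z - snd z) \<partial>lborel) + (\<integral>\<^sup>+z. F (snd z) * kf (fst z - snd z) \<partial>lborel)"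
      unfolding gagliardo_def by (simp add: nn_integral_add)
    also have "\<dots> = gagliardo 2 s1 u + emeasure lborel \<Omega> * ennreal In + emeasure lborel \<Omega> * ennreal In
        + (\<integral>\<^sup>+x. F x \<partial>lborel) * ennreal If + (\<integral>\<^sup>+x. F x \<partial>lborel) * ennreal If"
      by (subst (1 2) nn_integral_convolution(1), simp_all, subst (1 2) nn_integral_convolution(2), simp_all add: In If)
    also have "\<dots> \<le> ennreal (max M 0) + ennreal (measure lborel \<Omega>) * ennreal In + ennreal (measure lborel \<Omega>) * ennreal In
        + ennreal (2 powr p * C) * ennreal If + ennreal (2 powr p * C) * ennreal If"
      unfolding em by (intro add_mono mult_right_mono F order_trans[OF M] ennreal_leI) auto
    also have "\<dots> = ennreal D"
      using C In If by (simp add: D_def flip: ennreal_mult'' ennreal_plus)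
    finally show ?thesis .
  qed
  then have "\<forall>u\<in>bsupp \<Omega>. gagliardo 2 s1 u \<le> ennreal M \<longrightarrow> gagliardo p s2 u \<le> ennreal (max D 1)"
    by (meson ennreal_leI max.cobounded1 order_trans)
  then show ?thesis by (intro exI[of _ "max D 1"]) auto
qed

section \<open>Compactness\<close>

text \<open>The integer coordinates of the half-open dyadic cube of side \<open>1 / 2 ^ k\<close>
  containing \<open>x\<close>. The vector is not scaled back to a corner of the cube, since it
  serves only as a label.\<close>

definition grid :: "nat \<Rightarrow> 'a::euclidean_space \<Rightarrow> 'a" where
  "grid k x = (\<Sum>i\<in>Basis. of_int \<lfloor>x \<bullet> i * 2 ^ k\<rfloor> *\<^sub>R i)"

definition cell :: "nat \<Rightarrow> 'a::euclidean_space \<Rightarrow> 'a set" where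
  "cell k z = {x. grid k x = z}"

lemma grid_inner: "i \<in> Basis \<Longrightarrow> grid k x \<bullet> i = of_int \<lfloor>x \<bullet> i * 2 ^ k\<rfloor>"
  by (simp add: grid_def)

lemma grid_eq_iff: "grid k x = grid k y \<longleftrightarrow> (\<forall>i\<in>Basis. \<lfloor>x \<bullet> i * 2 ^ k\<rfloor> = \<lfloor>y \<bullet> i * 2 ^ k\<rfloor>)"
  by (subst euclidean_eq_iff) (simp add: grid_inner)

lemma borel_cell [measurable]: "cell k z \<in> sets borel"
proof -
  have [measurable]: "grid k \<in> borel_measurable borel" unfolding grid_def[abs_def] by measurable
  have "{x \<in> space borel. grid k x = z} \<in> sets borel" by measurable
  then show ?thesis by (simp add: cell_def)
qed

lemma cell_diameter:
  assumes "x \<in> cell k z" "y \<in> cell k z"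
  shows "norm (x - y :: 'a::euclidean_space) \<le> DIM('a) / 2 ^ k"
proof -
  have "grid k x = grid k y" using assms by (simp add: cell_def)
  then have fl: "\<lfloor>x \<bullet> i * 2 ^ k\<rfloor> = \<lfloor>y \<bullet> i * 2 ^ k\<rfloor>" if "i \<in> Basis" for i using that by (simp add: grid_eq_iff)
  have "\<bar>(x - y) \<bullet> i\<bar> \<le> 1 / 2 ^ k" if "i \<in> Basis" for i
  proof -
    have "\<bar>x \<bullet> i * 2 ^ k - y \<bullet> i * 2 ^ k\<bar> \<le> 1" using fl[OF that] by linarith
    also have "x \<bullet> i * 2 ^ k - y \<bullet> i * 2 ^ k = ((x - y) \<bullet> i) * 2 ^ k" by (simp add: inner_diff_left algebra_simps)
    finally show ?thesis by (simp add: abs_mult field_simps)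
  qed
  then have "(\<Sum>i\<in>Basis. \<bar>(x - y) \<bullet> i\<bar>) \<le> (\<Sum>i\<in>(Basis::'a set). 1 / 2 ^ k)" by (intro sum_mono)
  then show ?thesis using norm_le_l1[of "x - y"] by simp
qed

lemma cell_measure:
  assumes "x \<in> cell k z"
  shows "emeasure lborel (cell k z) = ennreal (measure lborel (cell k z :: 'a::euclidean_space set))"
    and "(1 / 2 ^ k) ^ DIM('a) \<le> measure lborel (cell k z :: 'a set)"
proof -
  have bdd: "bounded (cell k z)"
    unfolding bounded_def using cell_diameter[OF assms] by (auto simp: dist_norm)
  then show em: "emeasure lborel (cell k z) = ennreal (measure lborel (cell k z))"
    using emeasure_bounded_finite[OF bdd] by (simp add: emeasure_eq_ennreal_measure less_top)
  define l where "l = (\<Sum>i\<in>Basis. (of_int \<lfloor>x \<bullet> i * 2 ^ k\<rfloor> / 2 ^ k) *\<^sub>R i)"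
  define u where "u = (\<Sum>i\<in>Basis. ((of_int \<lfloor>x \<bullet> i * 2 ^ k\<rfloor> + 1) / 2 ^ k) *\<^sub>R i)"
  have li: "l \<bullet> i = of_int \<lfloor>x \<bullet> i * 2 ^ k\<rfloor> / 2 ^ k" "u \<bullet> i = (of_int \<lfloor>x \<bullet> i * 2 ^ k\<rfloor> + 1) / 2 ^ k" if "i \<in> Basis" for i
    using that by (simp_all add: l_def u_def)
  have "box l u \<subseteq> cell k z"
  proof
    fix y assume y: "y \<in> box l u"
    have "\<lfloor>y \<bullet> i * 2 ^ k\<rfloor> = \<lfloor>x \<bullet> i * 2 ^ k\<rfloor>" if i: "i \<in> Basis" for i
    proof -
      have "of_int \<lfloor>x \<bullet> i * 2 ^ k\<rfloor> / 2 ^ k < y \<bullet> i" "y \<bullet> i < (of_int \<lfloor>x \<bullet> i * 2 ^ k\<rfloor> + 1) / 2 ^ k"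
        using y i li[OF i] by (auto simp: mem_box)
      then show ?thesis by (intro floor_unique) (auto simp: field_simps)
    qed
    then have "grid k y = grid k x" by (simp add: grid_eq_iff)
    then show "y \<in> cell k z" using assms by (simp add: cell_def)
  qed
  then have "emeasure lborel (box l u) \<le> emeasure lborel (cell k z)" by (intro emeasure_mono) auto
  moreover have "emeasure lborel (box l u) = ennreal ((1 / 2 ^ k) ^ DIM('a))"
  proof -
    have "(u - l) \<bullet> i = 1 / 2 ^ k" if "i \<in> Basis" for i
      using li[OF that] by (simp add: inner_diff_left diff_divide_distrib[symmetric])
    then show ?thesis by (subst emeasure_lborel_box) (auto simp: li divide_right_mono)
  qed
  ultimately show "(1 / 2 ^ k) ^ DIM('a) \<le> measure lborel (cell k z)" using em by simp
qed

lemma finite_grid_image: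
  fixes \<Omega> :: "'a::euclidean_space set"
  assumes "bounded \<Omega>" shows "finite (grid k ` \<Omega>)"
proof -
  obtain R where R: "0 < R" "\<Omega> \<subseteq> ball 0 R" using bounded_subset_ballD[OF assms, of 0] by blast
  define m where "m = \<lceil>R * 2 ^ k\<rceil> + 1"
  have "grid k x \<in> (\<lambda>f. \<Sum>i\<in>Basis. of_int (f i) *\<^sub>R i) ` (Basis \<rightarrow>\<^sub>E {-m..m})" if "x \<in> \<Omega>" for x
  proof (rule image_eqI)
    let ?f = "\<lambda>i\<in>Basis. \<lfloor>x \<bullet> i * 2 ^ k\<rfloor>"
    show "grid k x = (\<Sum>i\<in>Basis. of_int (?f i) *\<^sub>R i)" by (simp add: grid_def)
    have "\<lfloor>x \<bullet> i * 2 ^ k\<rfloor> \<in> {-m..m}" if i: "i \<in> Basis" for i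
    proof -
      have "\<bar>x \<bullet> i\<bar> \<le> R" using Basis_le_norm[OF i, of x] R \<open>x \<in> \<Omega>\<close> by (auto simp: subset_iff)
      then have "\<bar>x \<bullet> i * 2 ^ k\<bar> \<le> R * 2 ^ k" by (simp add: abs_mult)
      then show ?thesis unfolding m_def by simp linarith
    qed
    then show "?f \<in> Basis \<rightarrow>\<^sub>E {-m..m}" by auto
  qed
  then have "grid k ` \<Omega> \<subseteq> (\<lambda>f. \<Sum>i\<in>Basis. of_int (f i) *\<^sub>R i) ` (Basis \<rightarrow>\<^sub>E {-m..m})" by blast
  moreover have "finite \<dots>" by (intro finite_imageI finite_PiE) auto
  ultimately show ?thesis by (rule finite_subset)
qed

text \<open>Splits the square integral over a cell into the square of the mean and an oscillation
  over pairs. The latter is what the Gagliardo density controls, as points of one cell are close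
  together.\<close>

lemma nn_integral_variance:
  fixes w :: "'a::euclidean_space \<Rightarrow> real"
  assumes [measurable]: "w \<in> borel_measurable borel" "c \<in> sets borel"
    and em: "emeasure lborel c = ennreal V" "0 \<le> V"
    and int: "integrable lborel (\<lambda>x. w x * indicator c x)" "integrable lborel (\<lambda>x. (w x)\<^sup>2 * indicator c x)"
  shows "(\<integral>\<^sup>+x. \<integral>\<^sup>+y. ennreal ((w x - w y)\<^sup>2 * indicator c x * indicator c y) \<partial>lborel \<partial>lborel)
    = ennreal (2 * V * (\<integral>x. (w x)\<^sup>2 * indicator c x \<partial>lborel) - 2 * (\<integral>x. w x * indicator c x \<partial>lborel)\<^sup>2)"
proof -
  define a where "a = (\<integral>x. w x * indicator c x \<partial>lborel)"
  define b where "b = (\<integral>x. (w x)\<^sup>2 * indicator c x \<partial>lborel)"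
  have ic: "integrable lborel (indicator c :: 'a \<Rightarrow> real)" using em by (simp add: integrable_indicator_iff)
  have mc: "measure lborel c = V" using em by (simp add: measure_def)
  have inner: "(\<integral>\<^sup>+y. ennreal ((w x - w y)\<^sup>2 * indicator c x * indicator c y) \<partial>lborel)
     = ennreal (((w x)\<^sup>2 * V - 2 * w x * a + b) * indicator c x)" for x
  proof (cases "x \<in> c")
    case True
    have eq: "(w x - w y)\<^sup>2 * indicator c x * indicator c y
       = (w x)\<^sup>2 * indicator c y - 2 * w x * (w y * indicator c y) + (w y)\<^sup>2 * indicator c y" for y
      using True by (simp add: power2_diff algebra_simps)
    have "(\<integral>\<^sup>+y. ennreal ((w x - w y)\<^sup>2 * indicator c x * indicator c y) \<partial>lborel)
      = ennreal (\<integral>y. (w x - w y)\<^sup>2 * indicator c x * indicator c y \<partial>lborel)"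
    proof (rule nn_integral_eq_integral)
      show "integrable lborel (\<lambda>y. (w x - w y)\<^sup>2 * indicator c x * indicator c y)"
        unfolding eq by (intro Bochner_Integration.integrable_add Bochner_Integration.integrable_diff integrable_mult_right ic int)
    qed simp
    also have "(\<integral>y. (w x - w y)\<^sup>2 * indicator c x * indicator c y \<partial>lborel) = (w x)\<^sup>2 * V - 2 * w x * a + b"
      unfolding eq a_def b_def using ic int mc by (simp add: integrable_mult_right del: integrable_mult_right_iff)
    finally show ?thesis using True by simp
  qed simp
  have eq2: "((w x)\<^sup>2 * V - 2 * w x * a + b) * indicator c x = V * ((w x)\<^sup>2 * indicator c x) - 2 * a * (w x * indicator c x) + b * indicator c x" for x
    by (simp add: algebra_simps)
  have pos: "0 \<le> ((w x)\<^sup>2 * V - 2 * w x * a + b) * indicator c x" for x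
  proof (cases "x \<in> c")
    case True
    have eq: "(w x - w y)\<^sup>2 * indicator c y
       = (w x)\<^sup>2 * indicator c y - 2 * w x * (w y * indicator c y) + (w y)\<^sup>2 * indicator c y" for y
      by (simp add: power2_diff algebra_simps)
    have "(\<integral>y. (w x - w y)\<^sup>2 * indicator c y \<partial>lborel) = (w x)\<^sup>2 * V - 2 * w x * a + b"
      unfolding eq a_def b_def using ic int mc by (simp add: integrable_mult_right del: integrable_mult_right_iff)
    moreover have "0 \<le> (\<integral>y. (w x - w y)\<^sup>2 * indicator c y \<partial>lborel)" by simp
    ultimately show ?thesis using True by simp
  qed simp
  have "(\<integral>\<^sup>+x. \<integral>\<^sup>+y. ennreal ((w x - w y)\<^sup>2 * indicator c x * indicator c y) \<partial>lborel \<partial>lborel)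
    = (\<integral>\<^sup>+x. ennreal (((w x)\<^sup>2 * V - 2 * w x * a + b) * indicator c x) \<partial>lborel)" by (simp only: inner)
  also have "\<dots> = ennreal (\<integral>x. ((w x)\<^sup>2 * V - 2 * w x * a + b) * indicator c x \<partial>lborel)"
    using pos by (intro nn_integral_eq_integral)
      (auto simp: eq2[abs_def] intro!: Bochner_Integration.integrable_add Bochner_Integration.integrable_diff integrable_mult_right ic int)
  also have "(\<integral>x. ((w x)\<^sup>2 * V - 2 * w x * a + b) * indicator c x \<partial>lborel) = V * b - 2 * a * a + b * V"
    unfolding eq2 using ic int mc by (simp add: integrable_mult_right del: integrable_mult_right_iff flip: a_def b_def)
  finally show ?thesis by (simp add: a_def b_def power2_eq_square algebra_simps)
qed

text \<open>On a cell the oscillation is at most the power \<open>n + 2 * s\<close> of the diameter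
  bound times the Gagliardo energy of pairs inside that cell. The squares of distinct cells are
  disjoint in the product space, so these energies sum to at most \<open>M\<close>; the factor on
  the left is a lower bound for the volume of a cell.\<close>

lemma grid_estimate:
  fixes \<Omega> :: "'a::euclidean_space set" and w :: "'a \<Rightarrow> real"
  assumes \<Omega>: "bounded \<Omega>" and s: "0 < s" and w: "w \<in> bsupp \<Omega>"
    and int: "integrable lborel w" "integrable lborel (\<lambda>x. (w x)\<^sup>2)"
    and M: "gagliardo 2 s w \<le> ennreal M" "0 \<le> M"
  shows "(1 / 2 ^ k) ^ DIM('a) * (\<integral>x. (w x)\<^sup>2 \<partial>lborel)
    \<le> (\<Sum>z\<in>grid k ` \<Omega>. (\<integral>x. w x * indicator (cell k z) x \<partial>lborel)\<^sup>2)
      + (real DIM('a) / 2 ^ k) powr (real DIM('a) + 2 * s) * M / 2"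
proof -
  have [measurable]: "w \<in> borel_measurable borel" using w by (rule bsuppD)
  define \<alpha> where "\<alpha> = real DIM('a) + 2 * s"
  define L where "L = (real DIM('a) / 2 ^ k) powr \<alpha>"
  have \<alpha>: "0 < \<alpha>" and L: "0 < L" using s by (auto simp: \<alpha>_def L_def)
  define Z where "Z = grid k ` \<Omega>"
  have Z: "finite Z" unfolding Z_def by (rule finite_grid_image[OF \<Omega>])
  define V a b where "V z = measure lborel (cell k z)"
    and "a z = (\<integral>x. w x * indicator (cell k z) x \<partial>lborel)"
    and "b z = (\<integral>x. (w x)\<^sup>2 * indicator (cell k z) x \<partial>lborel)" for z :: 'a
  have intc: "integrable lborel (\<lambda>x. w x * indicator (cell k z) x)"
    "integrable lborel (\<lambda>x. (w x)\<^sup>2 * indicator (cell k z) x)" for z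
    by (rule Bochner_Integration.integrable_bound[OF int(1)] Bochner_Integration.integrable_bound[OF int(2)];
        auto split: split_indicator)+
  have V: "emeasure lborel (cell k z) = ennreal (V z)" "(1 / 2 ^ k) ^ DIM('a) \<le> V z" if "z \<in> Z" for z
  proof -
    obtain x where "x \<in> cell k z" using \<open>z \<in> Z\<close> by (auto simp: Z_def cell_def)
    from cell_measure[OF this] show "emeasure lborel (cell k z) = ennreal (V z)" "(1 / 2 ^ k) ^ DIM('a) \<le> V z"
      by (simp_all add: V_def)
  qed
  have V0: "0 \<le> V z" for z by (simp add: V_def)
  have ind: "(indicator (cell k z) x :: ennreal) = (if z = grid k x then 1 else 0)" for z x
    by (auto simp: cell_def)
  define G where "G z = (\<integral>\<^sup>+x. \<integral>\<^sup>+y. ennreal (gagliardo_density 2 s w (x, y)) * indicator (cell k z) x * indicator (cell k z) y \<partial>lborel \<partial>lborel)" for z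
  have part: "ennreal (2 * V z * b z - 2 * (a z)\<^sup>2) \<le> ennreal L * G z" if z: "z \<in> Z" for z
  proof -
    have "ennreal (2 * V z * b z - 2 * (a z)\<^sup>2)
      = (\<integral>\<^sup>+x. \<integral>\<^sup>+y. ennreal ((w x - w y)\<^sup>2 * indicator (cell k z) x * indicator (cell k z) y) \<partial>lborel \<partial>lborel)"
      unfolding a_def b_def by (rule nn_integral_variance[symmetric]) (use V[OF z] V0 intc in auto)
    also have "\<dots> \<le> (\<integral>\<^sup>+x. \<integral>\<^sup>+y. ennreal L * (ennreal (gagliardo_density 2 s w (x, y)) * indicator (cell k z) x * indicator (cell k z) y) \<partial>lborel \<partial>lborel)"
    proof (intro nn_integral_mono)
      fix x y
      show "ennreal ((w x - w y)\<^sup>2 * indicator (cell k z) x * indicator (cell k z) y)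
         \<le> ennreal L * (ennreal (gagliardo_density 2 s w (x, y)) * indicator (cell k z) x * indicator (cell k z) y)"
      proof (cases "x \<in> cell k z \<and> y \<in> cell k z \<and> x \<noteq> y")
        case True
        then have "norm (x - y) \<le> real DIM('a) / 2 ^ k" using cell_diameter by blast
        then have "(real DIM('a) / 2 ^ k) powr (- \<alpha>) \<le> norm (x - y) powr (- \<alpha>)"
          using True \<alpha> by (intro powr_mono2') auto
        then have "L * (real DIM('a) / 2 ^ k) powr (- \<alpha>) \<le> L * norm (x - y) powr (- \<alpha>)" using L by (intro mult_left_mono) auto
        moreover have "L * (real DIM('a) / 2 ^ k) powr (- \<alpha>) = 1" by (simp add: L_def flip: powr_add)
        ultimately have "(w x - w y)\<^sup>2 * 1 \<le> (w x - w y)\<^sup>2 * (L * norm (x - y) powr (- \<alpha>))"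
          by (intro mult_left_mono) auto
        then have "(w x - w y)\<^sup>2 \<le> L * gagliardo_density 2 s w (x, y)"
          by (simp add: gagliardo_density_def \<alpha>_def mult_ac)
        then show ?thesis using True L by (simp add: ennreal_leI flip: ennreal_mult)
      qed auto
    qed
    also have "\<dots> = ennreal L * G z" unfolding G_def
      by (subst nn_integral_cmult, simp, measurable, subst nn_integral_cmult) (auto simp: borel_prod[symmetric])
    finally show ?thesis .
  qed
  have "(\<Sum>z\<in>Z. G z) = (\<integral>\<^sup>+x. \<integral>\<^sup>+y. (\<Sum>z\<in>Z. ennreal (gagliardo_density 2 s w (x, y)) * indicator (cell k z) x * indicator (cell k z) y) \<partial>lborel \<partial>lborel)"
    unfolding G_def by (subst nn_integral_sum, simp, subst nn_integral_sum) simp_all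
  also have "\<dots> \<le> (\<integral>\<^sup>+x. \<integral>\<^sup>+y. ennreal (gagliardo_density 2 s w (x, y)) \<partial>lborel \<partial>lborel)"
  proof (intro nn_integral_mono)
    fix x y
    have "(\<Sum>z\<in>Z. ennreal (gagliardo_density 2 s w (x, y)) * indicator (cell k z) x * indicator (cell k z) y)
      \<le> (\<Sum>z\<in>Z. if z = grid k x then ennreal (gagliardo_density 2 s w (x, y)) else 0)"
      by (intro sum_mono) (auto simp: ind)
    also have "\<dots> \<le> ennreal (gagliardo_density 2 s w (x, y))" using Z by (simp add: sum.delta)
    finally show "(\<Sum>z\<in>Z. ennreal (gagliardo_density 2 s w (x, y)) * indicator (cell k z) x * indicator (cell k z) y)
      \<le> ennreal (gagliardo_density 2 s w (x, y))" .
  qed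
  also have "\<dots> = gagliardo 2 s w" by (rule gagliardo_iterated[symmetric]) measurable
  also note M(1)
  finally have "ennreal L * (\<Sum>z\<in>Z. G z) \<le> ennreal L * ennreal M" by (rule mult_left_mono) simp
  \<comment> \<open>The maximum makes the truncation of negative reals by \<open>ennreal\<close>
    explicit before the sum is moved inside.\<close>
  moreover have "(\<Sum>z\<in>Z. ennreal (max 0 (2 * V z * b z - 2 * (a z)\<^sup>2))) \<le> ennreal L * (\<Sum>z\<in>Z. G z)"
    unfolding sum_distrib_left using part by (intro sum_mono) (simp add: max_def ennreal_neg)
  ultimately have "ennreal (\<Sum>z\<in>Z. max 0 (2 * V z * b z - 2 * (a z)\<^sup>2)) \<le> ennreal (L * M)"
    using L M(2) by (subst sum_ennreal[symmetric]) (auto simp: ennreal_mult)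
  then have "(\<Sum>z\<in>Z. max 0 (2 * V z * b z - 2 * (a z)\<^sup>2)) \<le> L * M" using L M(2) by simp
  moreover have "(\<Sum>z\<in>Z. 2 * ((1 / 2 ^ k) ^ DIM('a) * b z) - 2 * (a z)\<^sup>2) \<le> (\<Sum>z\<in>Z. max 0 (2 * V z * b z - 2 * (a z)\<^sup>2))"
  proof (intro sum_mono)
    fix z assume z: "z \<in> Z"
    have "0 \<le> b z" unfolding b_def by (intro Bochner_Integration.integral_nonneg) auto
    then have "(1 / 2 ^ k) ^ DIM('a) * b z \<le> V z * b z" using V(2)[OF z] by (intro mult_right_mono)
    then show "2 * ((1 / 2 ^ k) ^ DIM('a) * b z) - 2 * (a z)\<^sup>2 \<le> max 0 (2 * V z * b z - 2 * (a z)\<^sup>2)" by simp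
  qed
  moreover have "(\<Sum>z\<in>Z. 2 * ((1 / 2 ^ k) ^ DIM('a) * b z) - 2 * (a z)\<^sup>2)
      = 2 * ((1 / 2 ^ k) ^ DIM('a) * (\<Sum>z\<in>Z. b z)) - 2 * (\<Sum>z\<in>Z. (a z)\<^sup>2)"
    by (simp add: sum_subtractf sum_distrib_left)
  moreover have "(\<Sum>z\<in>Z. b z) = (\<integral>x. (w x)\<^sup>2 \<partial>lborel)"
  proof -
    have pw: "(\<Sum>z\<in>Z. (w x)\<^sup>2 * indicator (cell k z) x) = (w x)\<^sup>2" for x
    proof (cases "x \<in> \<Omega>")
      case True
      have "(\<Sum>z\<in>Z. (w x)\<^sup>2 * indicator (cell k z) x) = (\<Sum>z\<in>Z. if z = grid k x then (w x)\<^sup>2 else 0)"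
        by (intro sum.cong) (auto simp: cell_def)
      then show ?thesis using Z True by (simp add: Z_def)
    qed (use bsuppD(2)[OF w] in simp)
    have "(\<Sum>z\<in>Z. b z) = (\<integral>x. (\<Sum>z\<in>Z. (w x)\<^sup>2 * indicator (cell k z) x) \<partial>lborel)"
      unfolding b_def using intc(2) by (intro Bochner_Integration.integral_sum[symmetric]) auto
    then show ?thesis by (simp only: pw)
  qed
  ultimately show ?thesis unfolding L_def \<alpha>_def Z_def a_def by simp
qed

section \<open>From cell averages to compactness in Lebesgue spaces\<close>

lemma gagliardo_add_scaled:
  fixes u v :: "'a::euclidean_space \<Rightarrow> real"
  assumes [measurable]: "u \<in> borel_measurable borel" "v \<in> borel_measurable borel" and "0 < p"
  shows "gagliardo p s (\<lambda>x. u x + e * v x) \<le> ennreal (2 powr p) * (gagliardo p s u + ennreal (\<bar>e\<bar> powr p) * gagliardo p s v)"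
proof -
  have "gagliardo p s (\<lambda>x. u x + e * v x)
     \<le> (\<integral>\<^sup>+z. ennreal (2 powr p) * (ennreal (gagliardo_density p s u z) + ennreal (\<bar>e\<bar> powr p) * ennreal (gagliardo_density p s v z)) \<partial>lborel)"
    unfolding gagliardo_def
  proof (intro nn_integral_mono)
    fix z :: "'a \<times> 'a"
    have "\<bar>(u (fst z) - u (snd z)) + e * (v (fst z) - v (snd z))\<bar> powr p
      \<le> 2 powr p * (\<bar>u (fst z) - u (snd z)\<bar> powr p + \<bar>e * (v (fst z) - v (snd z))\<bar> powr p)"
      using assms by (intro abs_add_powr_le) auto
    also have "\<bar>e * (v (fst z) - v (snd z))\<bar> powr p = \<bar>e\<bar> powr p * \<bar>v (fst z) - v (snd z)\<bar> powr p"
      by (simp add: abs_mult powr_mult)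
    finally have "gagliardo_density p s (\<lambda>x. u x + e * v x) z
      \<le> (2 powr p * (\<bar>u (fst z) - u (snd z)\<bar> powr p + \<bar>e\<bar> powr p * \<bar>v (fst z) - v (snd z)\<bar> powr p)) * norm (fst z - snd z) powr (- (real DIM('a) + p * s))"
      unfolding gagliardo_density_def by (intro mult_right_mono) (auto simp: algebra_simps)
    also have "\<dots> = 2 powr p * (gagliardo_density p s u z + \<bar>e\<bar> powr p * gagliardo_density p s v z)"
      by (simp add: gagliardo_density_def algebra_simps)
    finally have "ennreal (gagliardo_density p s (\<lambda>x. u x + e * v x) z)
      \<le> ennreal (2 powr p * (gagliardo_density p s u z + \<bar>e\<bar> powr p * gagliardo_density p s v z))" by (rule ennreal_leI)
    then show "ennreal (gagliardo_density p s (\<lambda>x. u x + e * v x) z)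
      \<le> ennreal (2 powr p) * (ennreal (gagliardo_density p s u z) + ennreal (\<bar>e\<bar> powr p) * ennreal (gagliardo_density p s v z))"
      by (simp add: ennreal_mult)
  qed
  also have "\<dots> = ennreal (2 powr p) * (gagliardo p s u + ennreal (\<bar>e\<bar> powr p) * gagliardo p s v)"
    unfolding gagliardo_def by (simp add: nn_integral_cmult nn_integral_add)
  finally show ?thesis .
qed

lemma bsupp_add_scaled: "u \<in> bsupp \<Omega> \<Longrightarrow> v \<in> bsupp \<Omega> \<Longrightarrow> (\<lambda>x. u x + e * v x) \<in> bsupp \<Omega>"
  by (auto simp: bsupp_def)

lemma bsupp_integrable:
  fixes \<Omega> :: "'a::euclidean_space set" and s \<sigma> :: real
  assumes \<Omega>: "bounded \<Omega>" "\<Omega> \<in> sets borel" and s: "0 < s" "2 * s < DIM('a)"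
    and \<sigma>: "0 < \<sigma>" "\<sigma> < crit_sobolev (real DIM('a)) s"
    and u: "u \<in> bsupp \<Omega>" "gagliardo 2 s u < \<infinity>"
  shows "integrable lborel (\<lambda>x. \<bar>u x\<bar> powr \<sigma>)"
proof -
  have [measurable]: "u \<in> borel_measurable borel" using u(1) by (rule bsuppD)
  obtain M where M: "gagliardo 2 s u = ennreal M" using u(2) by (cases "gagliardo 2 s u") auto
  then obtain C where "(\<integral>\<^sup>+x. ennreal (\<bar>u x\<bar> powr \<sigma>) \<partial>lborel) \<le> ennreal C"
    using fractional_sobolev_subcritical[OF \<Omega> s \<sigma>, of M] u by auto
  then show ?thesis by (intro integrableI_bounded) (auto intro: le_less_trans)
qed

text \<open>A diagonal subsequence makes the integrals over all dyadic cells converge. For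
  differences of its members, \<open>grid_estimate\<close> at a fine level leaves an error that is
  small uniformly, and at that fixed level only finitely many cell integrals have to be
  close.\<close>

lemma fractional_rellich_L2:
  fixes \<Omega> :: "'a::euclidean_space set" and u :: "nat \<Rightarrow> 'a \<Rightarrow> real" and s M :: real
  assumes \<Omega>: "bounded \<Omega>" "\<Omega> \<in> sets borel" and s: "0 < s" "2 * s < DIM('a)"
    and u: "\<And>n. u n \<in> bsupp \<Omega>" "\<And>n. gagliardo 2 s (u n) \<le> ennreal M" and M: "0 \<le> M"
  shows "\<exists>k. strict_mono (k :: nat \<Rightarrow> nat) \<and>
    (\<forall>e>0. \<exists>n0. \<forall>n\<ge>n0. \<forall>m\<ge>n0. (\<integral>\<^sup>+x. ennreal ((u (k n) x - u (k m) x)\<^sup>2) \<partial>lborel) \<le> ennreal e)"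
proof -
  define N where "N = real DIM('a)"
  have S: "2 < crit_sobolev (real DIM('a)) s" using s by (simp add: crit_sobolev_def field_simps)
  have [measurable]: "u n \<in> borel_measurable borel" for n using u(1) by (rule bsuppD)
  obtain C where C: "C > 0" "\<And>w. w \<in> bsupp \<Omega> \<Longrightarrow> gagliardo 2 s w \<le> ennreal M \<Longrightarrow> (\<integral>\<^sup>+x. ennreal (\<bar>w x\<bar> powr 1) \<partial>lborel) \<le> ennreal C"
    using fractional_sobolev_subcritical[OF \<Omega> s, of 1 M] S by auto
  have int: "integrable lborel w" "integrable lborel (\<lambda>x. (w x)\<^sup>2)"
    if "w \<in> bsupp \<Omega>" "gagliardo 2 s w < \<infinity>" for w
  proof -
    have [measurable]: "w \<in> borel_measurable borel" using that(1) by (rule bsuppD)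
    have "integrable lborel (\<lambda>x. \<bar>w x\<bar> powr 1)" "integrable lborel (\<lambda>x. \<bar>w x\<bar> powr 2)"
      by (rule bsupp_integrable[OF \<Omega> s _ _ that]; use S in simp)+
    then have n: "integrable lborel (\<lambda>x. norm (w x))" and sq: "integrable lborel (\<lambda>x. (w x)\<^sup>2)" by simp_all
    show "integrable lborel w" by (rule integrable_norm_cancel[OF n]) measurable
    show "integrable lborel (\<lambda>x. (w x)\<^sup>2)" by (rule sq)
  qed
  have uint: "integrable lborel (u n)" for n
    using int(1)[OF u(1)] u(2)[of n] by (metis ennreal_less_top infinity_ennreal_def le_less_trans)
  define f where "f n c = (\<integral>x. u n x * indicator c x \<partial>lborel)" for n c
  define \<C> where "\<C> = (\<Union>k. cell k ` grid k ` \<Omega>)"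
  have "countable \<C>" unfolding \<C>_def
  proof (rule countable_UN)
    show "countable (cell i ` grid i ` \<Omega>)" for i
      by (rule countable_finite[OF finite_imageI[OF finite_grid_image[OF \<Omega>(1)]]])
  qed simp
  moreover have "norm (f n c) \<le> C" if "c \<in> \<C>" for n c
  proof -
    have [measurable]: "c \<in> sets borel" using that borel_cell by (auto simp: \<C>_def)
    have "norm (f n c) \<le> (\<integral>x. \<bar>u n x\<bar> \<partial>lborel)"
      unfolding f_def using uint
      by (intro order_trans[OF integral_norm_bound] integral_mono')
         (auto simp: abs_mult split: split_indicator)
    also have "\<dots> \<le> C"
    proof -
      have "ennreal (\<integral>x. \<bar>u n x\<bar> \<partial>lborel) = (\<integral>\<^sup>+x. ennreal (\<bar>u n x\<bar> powr 1) \<partial>lborel)"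
        using uint by (subst nn_integral_eq_integral[symmetric]) auto
      also have "\<dots> \<le> ennreal C" by (rule C(2)[OF u])
      finally show ?thesis using C by simp
    qed
    finally show ?thesis .
  qed
  ultimately obtain k where k: "strict_mono k" "\<And>c. c \<in> \<C> \<Longrightarrow> \<exists>l. (\<lambda>n. f (k n) c) \<longlonglongrightarrow> l"
    using function_convergent_subsequence[of \<C> f C] by metis
  then obtain l where l: "\<And>c. c \<in> \<C> \<Longrightarrow> (\<lambda>n. f (k n) c) \<longlonglongrightarrow> l c" by metis
  have main: "\<exists>n0. \<forall>n\<ge>n0. \<forall>m\<ge>n0. (\<integral>\<^sup>+x. ennreal ((u (k n) x - u (k m) x)\<^sup>2) \<partial>lborel) \<le> ennreal e" if e: "e > 0" for e
  proof -
    \<comment> \<open>\<open>8 * M\<close> bounds the energy of a difference of two members of the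
      sequence: \<open>gagliardo_add_scaled\<close> gives the factor \<open>2 powr 2\<close> times
      \<open>M + M\<close>.\<close>
    define B where "B = N powr (N + 2 * s) * (8 * M) / 2"
    have B: "0 \<le> B" using M by (simp add: B_def)
    have q: "(1/2 :: real) powr (2 * s) < 1" using powr_less_mono'[of "1/2 :: real" 0 "2 * s"] s by simp
    obtain j where "((1/2 :: real) powr (2 * s)) ^ j < e / 2 / (B + 1)"
      using real_arch_pow_inv[OF _ q, of "e / 2 / (B + 1)"] e B by auto
    then have "(B + 1) * ((1/2 :: real) powr (2 * s)) ^ j < e / 2" using B by (simp add: field_simps)
    moreover have "B * ((1/2 :: real) powr (2 * s)) ^ j \<le> (B + 1) * ((1/2 :: real) powr (2 * s)) ^ j"
      by (intro mult_right_mono) auto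
    ultimately have j: "B * ((1/2 :: real) powr (2 * s)) ^ j < e / 2" by linarith
    define h where "h = (1 / 2 ^ j :: real) ^ DIM('a)"
    have h: "0 < h" by (simp add: h_def)
    \<comment> \<open>Relative to the cell volume \<open>h\<close> the error is of order
      \<open>2 powr (- 2 * s * j)\<close>; this is where positive smoothness enters.\<close>
    have scale: "(N / 2 ^ j) powr (N + 2 * s) * (8 * M) / 2 = h * (B * ((1/2 :: real) powr (2 * s)) ^ j)"
    proof -
      have "(N / 2 ^ j) powr (N + 2 * s) = N powr (N + 2 * s) * (1 / 2 ^ j) powr (N + 2 * s)"
        using powr_mult[of N "1 / 2 ^ j" "N + 2 * s"] by (simp add: N_def)
      moreover have "(1 / 2 ^ j :: real) powr (N + 2 * s) = h * ((1/2 :: real) powr (2 * s)) ^ j"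
      proof -
        have "h = (1 / 2 ^ j) powr N" by (simp add: h_def N_def powr_realpow)
        moreover have "((1/2 :: real) powr (2 * s)) ^ j = (1 / 2 ^ j) powr (2 * s)"
          by (simp add: powr_powr powr_divide powr_realpow[symmetric] mult.commute)
        ultimately show ?thesis by (simp add: powr_add)
      qed
      ultimately show ?thesis by (simp add: B_def)
    qed
    define Z where "Z = grid j ` \<Omega>"
    have Z: "finite Z" unfolding Z_def by (rule finite_grid_image[OF \<Omega>(1)])
    have ZC: "cell j z \<in> \<C>" if "z \<in> Z" for z using that by (auto simp: Z_def \<C>_def)
    \<comment> \<open>Permits the error \<open>h * (e / 2)\<close> in the sum over all cells; the
      added 1 keeps the quotient meaningful when there are no cells.\<close>
    define \<delta> where "\<delta> = sqrt (h * (e / 2) / (real (card Z) + 1))"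
    have \<delta>: "0 < \<delta>" "real (card Z) * \<delta>\<^sup>2 \<le> h * (e / 2)"
      using h e by (auto simp: \<delta>_def field_simps)
    have "eventually (\<lambda>n. \<forall>z\<in>Z. dist (f (k n) (cell j z)) (l (cell j z)) < \<delta> / 2) sequentially"
      using Z by (intro eventually_ball_finite ballI tendstoD l ZC) (use \<delta> in auto)
    then obtain n0 where n0: "\<And>n z. n \<ge> n0 \<Longrightarrow> z \<in> Z \<Longrightarrow> dist (f (k n) (cell j z)) (l (cell j z)) < \<delta> / 2"
      by (auto simp: eventually_sequentially)
    have "(\<integral>\<^sup>+x. ennreal ((u (k n) x - u (k m) x)\<^sup>2) \<partial>lborel) \<le> ennreal e" if nm: "n \<ge> n0" "m \<ge> n0" for n m
    proof -
      define w where "w x = u (k n) x + (-1) * u (k m) x" for x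
      have wb: "w \<in> bsupp \<Omega>" unfolding w_def by (intro bsupp_add_scaled u)
      have "gagliardo 2 s w \<le> ennreal (2 powr 2) * (gagliardo 2 s (u (k n)) + ennreal (\<bar>-1\<bar> powr 2) * gagliardo 2 s (u (k m)))"
        unfolding w_def by (rule gagliardo_add_scaled) auto
      also have "\<dots> \<le> ennreal (2 powr 2) * (ennreal M + ennreal (\<bar>-1\<bar> powr 2) * ennreal M)"
        by (intro mult_left_mono add_mono u) auto
      also have "\<dots> = ennreal (8 * M)" using M by (simp add: ennreal_mult'' flip: ennreal_plus)
      finally have gw: "gagliardo 2 s w \<le> ennreal (8 * M)" .
      then have iw: "integrable lborel w" "integrable lborel (\<lambda>x. (w x)\<^sup>2)"
        using int[OF wb] by (metis ennreal_less_top infinity_ennreal_def le_less_trans)+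
      have est: "h * (\<integral>x. (w x)\<^sup>2 \<partial>lborel) \<le> (\<Sum>z\<in>Z. (\<integral>x. w x * indicator (cell j z) x \<partial>lborel)\<^sup>2) + h * (B * ((1/2 :: real) powr (2 * s)) ^ j)"
        using grid_estimate[OF \<Omega>(1) s(1) wb iw gw, of j] M unfolding scale[symmetric] by (simp add: h_def Z_def N_def)
      have "(\<Sum>z\<in>Z. (\<integral>x. w x * indicator (cell j z) x \<partial>lborel)\<^sup>2) \<le> (\<Sum>z\<in>Z. \<delta>\<^sup>2)"
      proof (intro sum_mono)
        fix z assume z: "z \<in> Z"
        have ii: "integrable lborel (\<lambda>x. u i x * indicator (cell j z) x)" for i
          by (rule Bochner_Integration.integrable_bound[OF uint[of i]]) (auto split: split_indicator)
        have "(\<integral>x. w x * indicator (cell j z) x \<partial>lborel) = f (k n) (cell j z) - f (k m) (cell j z)"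
          unfolding f_def w_def using ii by (simp add: left_diff_distrib)
        then have "\<bar>\<integral>x. w x * indicator (cell j z) x \<partial>lborel\<bar> \<le> \<delta>"
          using n0[OF nm(1) z] n0[OF nm(2) z] unfolding dist_real_def by linarith
        then show "(\<integral>x. w x * indicator (cell j z) x \<partial>lborel)\<^sup>2 \<le> \<delta>\<^sup>2"
          using \<delta> by (simp add: abs_le_square_iff[symmetric])
      qed
      then have "(\<Sum>z\<in>Z. (\<integral>x. w x * indicator (cell j z) x \<partial>lborel)\<^sup>2) \<le> real (card Z) * \<delta>\<^sup>2" by simp
      then have "h * (\<integral>x. (w x)\<^sup>2 \<partial>lborel) \<le> h * (e / 2) + h * (e / 2)"
        using est \<delta>(2) mult_left_mono[OF less_imp_le[OF j] less_imp_le[OF h]] by linarith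
      then have "(\<integral>x. (w x)\<^sup>2 \<partial>lborel) \<le> e" using h by simp
      then have "(\<integral>\<^sup>+x. ennreal ((w x)\<^sup>2) \<partial>lborel) \<le> ennreal e"
        using iw by (subst nn_integral_eq_integral) (auto intro: ennreal_leI)
      then show ?thesis by (simp add: w_def)
    qed
    then show ?thesis by blast
  qed
  then show ?thesis using k by blast
qed

lemma AE_lborel_fst_snd:
  assumes "AE x in (lborel :: 'a::euclidean_space measure). Q x"
  shows "AE z in (lborel :: ('a \<times> 'b::euclidean_space) measure). Q (fst z)"
    and "AE z in (lborel :: ('b \<times> 'a) measure). Q (snd z)"
proof -
  obtain N where N: "N \<in> null_sets (lborel :: 'a measure)" "{x \<in> space lborel. \<not> Q x} \<subseteq> N"
    using assms unfolding eventually_ae_filter by blast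
  have s: "N \<in> sets lborel" and e: "emeasure lborel N = 0" using N by (auto simp: null_sets_def)
  have "N \<times> (UNIV :: 'b set) \<in> null_sets (lborel \<Otimes>\<^sub>M lborel)"
    using s e by (auto intro!: null_setsI simp: lborel.emeasure_pair_measure_Times)
  then show "AE z in (lborel :: ('a \<times> 'b) measure). Q (fst z)"
    unfolding lborel_prod by (rule AE_I') (use N in auto)
  have "(UNIV :: 'b set) \<times> N \<in> null_sets (lborel \<Otimes>\<^sub>M lborel)"
    using s e by (auto intro!: null_setsI simp: lborel.emeasure_pair_measure_Times)
  then show "AE z in (lborel :: ('b \<times> 'a) measure). Q (snd z)"
    unfolding lborel_prod by (rule AE_I') (use N in auto)
qed

lemma nn_integral_fatou_AE:
  fixes f :: "nat \<Rightarrow> 'b \<Rightarrow> ennreal"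
  assumes "\<And>n. f n \<in> borel_measurable M" "AE x in M. (\<lambda>n. f n x) \<longlonglongrightarrow> g x"
  shows "(\<integral>\<^sup>+x. g x \<partial>M) \<le> liminf (\<lambda>n. \<integral>\<^sup>+x. f n x \<partial>M)"
proof -
  have "(\<integral>\<^sup>+x. g x \<partial>M) = (\<integral>\<^sup>+x. liminf (\<lambda>n. f n x) \<partial>M)"
    using assms(2) by (intro nn_integral_cong_AE) (auto elim!: eventually_mono simp: lim_imp_Liminf)
  also have "\<dots> \<le> liminf (\<lambda>n. \<integral>\<^sup>+x. f n x \<partial>M)" by (rule nn_integral_liminf[OF assms(1)])
  finally show ?thesis .
qed

lemma gagliardo_fatou:
  fixes u :: "nat \<Rightarrow> 'a::euclidean_space \<Rightarrow> real"
  assumes u: "\<And>n. u n \<in> borel_measurable borel" and p: "0 < p"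
    and lim: "AE x in lborel. (\<lambda>n. u n x) \<longlonglongrightarrow> w x"
  shows "gagliardo p s w \<le> liminf (\<lambda>n. gagliardo p s (u n))"
  unfolding gagliardo_def
proof (rule nn_integral_fatou_AE)
  show "AE z in lborel. (\<lambda>n. ennreal (gagliardo_density p s (u n) z)) \<longlonglongrightarrow> ennreal (gagliardo_density p s w z)"
    using AE_lborel_fst_snd(1)[OF lim, where 'b = 'a] AE_lborel_fst_snd(2)[OF lim, where 'b = 'a]
  proof eventually_elim
    case (elim z)
    show ?case unfolding gagliardo_density_def
      by (intro tendsto_ennrealI tendsto_mult tendsto_const tendsto_powr' tendsto_rabs tendsto_diff elim) (use p in auto)
  qed
  show "(\<lambda>z. ennreal (gagliardo_density p s (u n) z)) \<in> borel_measurable lborel" for n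
    using u by measurable
qed

text \<open>The threshold \<open>T\<close> satisfies
  \<open>T powr (\<sigma> - \<tau>) = \<eta>\<close>: above it the power \<sigma> is at most \<eta>
  times the power \<tau>, below it the lower power \<open>a\<close> suffices.\<close>

lemma powr_interpolation:
  fixes a \<sigma> \<tau> \<eta> :: real
  assumes "a \<le> \<sigma>" "\<sigma> < \<tau>" "0 < \<eta>"
  shows "\<exists>C>0. \<forall>t\<ge>0. t powr \<sigma> \<le> \<eta> * t powr \<tau> + C * t powr a"
proof -
  define T where "T = \<eta> powr (- 1 / (\<tau> - \<sigma>))"
  have e: "- 1 / (\<tau> - \<sigma>) * (\<sigma> - \<tau>) = 1" using assms by (simp add: field_simps)
  have T: "0 < T" "T powr (\<sigma> - \<tau>) = \<eta>" using assms unfolding T_def powr_powr e by auto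
  have "t powr \<sigma> \<le> \<eta> * t powr \<tau> + T powr (\<sigma> - a) * t powr a" if t: "0 \<le> t" for t
  proof (cases "t \<le> T")
    case True
    have "t powr \<sigma> = t powr (\<sigma> - a) * t powr a" by (simp flip: powr_add)
    also have "\<dots> \<le> T powr (\<sigma> - a) * t powr a" using True t assms by (intro mult_right_mono powr_mono2) auto
    finally show ?thesis using assms by (simp add: add_increasing)
  next
    case False
    have "t powr \<sigma> = t powr (\<sigma> - \<tau>) * t powr \<tau>" by (simp flip: powr_add)
    also have "\<dots> \<le> T powr (\<sigma> - \<tau>) * t powr \<tau>" using False T assms by (intro mult_right_mono powr_mono2') auto
    finally show ?thesis using T by (simp add: add_increasing2)
  qed
  then show ?thesis using T by (intro exI[of _ "T powr (\<sigma> - a)"]) auto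
qed

text \<open>Interpolation between convergence in the square mean and boundedness for an exponent
  \<tau> halfway between \<sigma> and the critical one; the weight on the power \<tau> can be made
  arbitrarily small.\<close>

lemma fractional_rellich:
  fixes \<Omega> :: "'a::euclidean_space set" and u :: "nat \<Rightarrow> 'a \<Rightarrow> real" and s M \<sigma> :: real
  assumes \<Omega>: "bounded \<Omega>" "\<Omega> \<in> sets borel" and s: "0 < s" "2 * s < DIM('a)"
    and \<sigma>: "2 \<le> \<sigma>" "\<sigma> < crit_sobolev (real DIM('a)) s"
    and u: "\<And>n. u n \<in> bsupp \<Omega>" "\<And>n. gagliardo 2 s (u n) \<le> ennreal M" and M: "0 \<le> M"
  shows "\<exists>k. strict_mono (k :: nat \<Rightarrow> nat) \<and>
    (\<forall>e>0. \<exists>n0. \<forall>n\<ge>n0. \<forall>m\<ge>n0. (\<integral>\<^sup>+x. ennreal (\<bar>u (k n) x - u (k m) x\<bar> powr \<sigma>) \<partial>lborel) \<le> ennreal e)"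
proof -
  have [measurable]: "u n \<in> borel_measurable borel" for n using u(1) by (rule bsuppD)
  obtain k :: "nat \<Rightarrow> nat" where k: "strict_mono k" and c0: "\<forall>e>0. \<exists>n0. \<forall>n\<ge>n0. \<forall>m\<ge>n0. (\<integral>\<^sup>+x. ennreal ((u (k n) x - u (k m) x)\<^sup>2) \<partial>lborel) \<le> ennreal e"
    using fractional_rellich_L2[OF \<Omega> s, of u M, OF u M] by blast
  note cauchy = c0[rule_format]
  define \<tau> where "\<tau> = (\<sigma> + crit_sobolev (real DIM('a)) s) / 2"
  have \<tau>: "\<sigma> < \<tau>" "0 < \<tau>" "\<tau> < crit_sobolev (real DIM('a)) s" using \<sigma> by (auto simp: \<tau>_def)
  obtain C where C: "C > 0" "\<And>w. w \<in> bsupp \<Omega> \<Longrightarrow> gagliardo 2 s w \<le> ennreal (8 * M) \<Longrightarrow> (\<integral>\<^sup>+x. ennreal (\<bar>w x\<bar> powr \<tau>) \<partial>lborel) \<le> ennreal C"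
    using fractional_sobolev_subcritical[OF \<Omega> s \<tau>(2,3), of "8 * M"] by blast
  have "\<exists>n0. \<forall>n\<ge>n0. \<forall>m\<ge>n0. (\<integral>\<^sup>+x. ennreal (\<bar>u (k n) x - u (k m) x\<bar> powr \<sigma>) \<partial>lborel) \<le> ennreal e" if e: "0 < e" for e
  proof -
    obtain B where B: "0 < B" "\<And>t. 0 \<le> t \<Longrightarrow> t powr \<sigma> \<le> e / (2 * C) * t powr \<tau> + B * t powr 2"
      using powr_interpolation[OF \<sigma>(1) \<tau>(1), of "e / (2 * C)"] e C by auto
    obtain n0 where n0: "\<And>n m. n \<ge> n0 \<Longrightarrow> m \<ge> n0 \<Longrightarrow> (\<integral>\<^sup>+x. ennreal ((u (k n) x - u (k m) x)\<^sup>2) \<partial>lborel) \<le> ennreal (e / (2 * B))"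
      using cauchy[of "e / (2 * B)"] e B by auto
    have "(\<integral>\<^sup>+x. ennreal (\<bar>u (k n) x - u (k m) x\<bar> powr \<sigma>) \<partial>lborel) \<le> ennreal e" if nm: "n \<ge> n0" "m \<ge> n0" for n m
    proof -
      define w where "w x = u (k n) x + (-1) * u (k m) x" for x
      have [measurable]: "w \<in> borel_measurable borel" unfolding w_def[abs_def] by measurable
      have wb: "w \<in> bsupp \<Omega>" unfolding w_def by (intro bsupp_add_scaled u)
      have "gagliardo 2 s w \<le> ennreal (2 powr 2) * (gagliardo 2 s (u (k n)) + ennreal (\<bar>-1\<bar> powr 2) * gagliardo 2 s (u (k m)))"
        unfolding w_def by (rule gagliardo_add_scaled) auto
      also have "\<dots> \<le> ennreal (2 powr 2) * (ennreal M + ennreal (\<bar>-1\<bar> powr 2) * ennreal M)"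
        by (intro mult_left_mono add_mono u) auto
      also have "\<dots> = ennreal (8 * M)" using M by (simp add: ennreal_mult'' flip: ennreal_plus)
      finally have gw: "gagliardo 2 s w \<le> ennreal (8 * M)" .
      have "(\<integral>\<^sup>+x. ennreal (\<bar>w x\<bar> powr \<sigma>) \<partial>lborel)
         \<le> (\<integral>\<^sup>+x. ennreal (e / (2 * C)) * ennreal (\<bar>w x\<bar> powr \<tau>) + ennreal B * ennreal ((w x)\<^sup>2) \<partial>lborel)"
      proof (rule nn_integral_mono)
        fix x
        have "ennreal (\<bar>w x\<bar> powr \<sigma>) \<le> ennreal (e / (2 * C) * \<bar>w x\<bar> powr \<tau> + B * (w x)\<^sup>2)"
          using B(2)[of "\<bar>w x\<bar>"] by (intro ennreal_leI) simp
        also have "\<dots> = ennreal (e / (2 * C)) * ennreal (\<bar>w x\<bar> powr \<tau>) + ennreal B * ennreal ((w x)\<^sup>2)"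
          using e C B by (simp flip: ennreal_mult ennreal_plus)
        finally show "ennreal (\<bar>w x\<bar> powr \<sigma>) \<le> ennreal (e / (2 * C)) * ennreal (\<bar>w x\<bar> powr \<tau>) + ennreal B * ennreal ((w x)\<^sup>2)" .
      qed
      also have "\<dots> = ennreal (e / (2 * C)) * (\<integral>\<^sup>+x. ennreal (\<bar>w x\<bar> powr \<tau>) \<partial>lborel) + ennreal B * (\<integral>\<^sup>+x. ennreal ((w x)\<^sup>2) \<partial>lborel)"
        by (simp add: nn_integral_add nn_integral_cmult)
      also have "\<dots> \<le> ennreal (e / (2 * C)) * ennreal C + ennreal B * ennreal (e / (2 * B))"
        using n0[OF nm] by (intro add_mono mult_left_mono C(2)[OF wb gw]) (auto simp: w_def)
      also have "\<dots> = ennreal e" using e C B by (simp flip: ennreal_mult ennreal_plus)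
      finally show ?thesis by (simp add: w_def)
    qed
    then show ?thesis by blast
  qed
  then show ?thesis using k by blast
qed

text \<open>
  The subsequence is chosen so fast that the increments are almost everywhere dominated by a
  geometric series; by Fatou the distances to the limit then have summable integrals, and their
  sum is the dominating function.
\<close>
lemma Lp_cauchy_dominated_subsequence:
  fixes v :: "nat \<Rightarrow> 'a::euclidean_space \<Rightarrow> real" and \<sigma> :: real
  assumes v[measurable]: "\<And>n. v n \<in> borel_measurable borel" and \<sigma>: "1 \<le> \<sigma>"
    and int: "\<And>n. integrable lborel (\<lambda>x. \<bar>v n x\<bar> powr \<sigma>)"
    and cauchy: "\<And>e. e > 0 \<Longrightarrow> \<exists>n0. \<forall>n\<ge>n0. \<forall>m\<ge>n0. (\<integral>\<^sup>+x. ennreal (\<bar>v n x - v m x\<bar> powr \<sigma>) \<partial>lborel) \<le> ennreal e"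
  shows "\<exists>j w W. strict_mono (j :: nat \<Rightarrow> nat) \<and> w \<in> borel_measurable borel \<and> integrable lborel W \<and>
    (AE x in lborel. (\<lambda>n. v (j n) x) \<longlonglongrightarrow> w x) \<and>
    (AE x in lborel. \<forall>n. \<bar>v (j n) x\<bar> powr \<sigma> \<le> W x) \<and> (AE x in lborel. \<bar>w x\<bar> powr \<sigma> \<le> W x) \<and>
    (\<forall>x. w x = (if Cauchy (\<lambda>n. v (j n) x) then lim (\<lambda>n. v (j n) x) else 0))"
proof -
  \<comment> \<open>The first factor makes the integrals of the increments summable after weighting
    with \<open>(2 ^ n) powr \<sigma>\<close>; the weight in turn forces the increments themselves
    to decay like \<open>(1/2) ^ n\<close> almost everywhere.\<close>
  define \<epsilon> where "\<epsilon> n = (1/2 :: real) ^ n * (1 / (2 ^ n) powr \<sigma>)" for n :: nat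
  have \<epsilon>: "0 < \<epsilon> n" for n by (simp add: \<epsilon>_def)
  obtain N where N: "\<And>i n m. n \<ge> N i \<Longrightarrow> m \<ge> N i \<Longrightarrow> (\<integral>\<^sup>+x. ennreal (\<bar>v n x - v m x\<bar> powr \<sigma>) \<partial>lborel) \<le> ennreal (\<epsilon> i)"
    using cauchy[OF \<epsilon>] by metis
  \<comment> \<open>The sum keeps \<open>j n\<close> above all thresholds \<open>N i\<close> with
    \<open>i \<le> n\<close>, and the summand \<open>n\<close> makes \<open>j\<close> strictly
    increasing.\<close>
  define j where "j n = (\<Sum>i\<le>n. N i) + n" for n
  have j: "strict_mono j" by (rule strict_mono_Suc_iff[THEN iffD2]) (simp add: j_def)
  have jN: "N i \<le> j n" if "i \<le> n" for i n
    using member_le_sum[of i "{..n}" N] that by (simp add: j_def)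
  have geo: "(\<Sum>n. ennreal ((1/2 :: real) ^ n)) \<noteq> top"
    by (rule ennreal_suminf_neq_top) (auto intro: summable_geometric)
  define y where "y n = v (j n)" for n
  have [measurable]: "y n \<in> borel_measurable borel" for n by (simp add: y_def)
  have yb: "(\<integral>\<^sup>+x. ennreal (\<bar>y n x - y m x\<bar> powr \<sigma>) \<partial>lborel) \<le> ennreal (\<epsilon> i)" if "i \<le> n" "i \<le> m" for i n m
    unfolding y_def by (rule N[OF jN[OF that(1)] jN[OF that(2)]])
  have "(\<integral>\<^sup>+x. (\<Sum>n. ennreal ((2 ^ n) powr \<sigma>) * ennreal (\<bar>y (Suc n) x - y n x\<bar> powr \<sigma>)) \<partial>lborel)
      = (\<Sum>n. ennreal ((2 ^ n) powr \<sigma>) * (\<integral>\<^sup>+x. ennreal (\<bar>y (Suc n) x - y n x\<bar> powr \<sigma>) \<partial>lborel))"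
    by (subst nn_integral_suminf) (auto simp: nn_integral_cmult)
  also have "\<dots> \<le> (\<Sum>n. ennreal ((1/2) ^ n))"
  proof (rule suminf_le)
    fix n
    have "ennreal ((2 ^ n) powr \<sigma>) * (\<integral>\<^sup>+x. ennreal (\<bar>y (Suc n) x - y n x\<bar> powr \<sigma>) \<partial>lborel) \<le> ennreal ((2 ^ n) powr \<sigma>) * ennreal (\<epsilon> n)"
      by (intro mult_left_mono yb) auto
    also have "\<dots> = ennreal ((1/2) ^ n)" by (simp add: \<epsilon>_def flip: ennreal_mult)
    finally show "ennreal ((2 ^ n) powr \<sigma>) * (\<integral>\<^sup>+x. ennreal (\<bar>y (Suc n) x - y n x\<bar> powr \<sigma>) \<partial>lborel) \<le> ennreal ((1/2) ^ n)" .
  qed auto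
  finally have "(\<integral>\<^sup>+x. (\<Sum>n. ennreal ((2 ^ n) powr \<sigma>) * ennreal (\<bar>y (Suc n) x - y n x\<bar> powr \<sigma>)) \<partial>lborel) \<noteq> \<infinity>"
    unfolding infinity_ennreal_def by (rule neq_top_trans[OF geo])
  then have "AE x in lborel. (\<Sum>n. ennreal ((2 ^ n) powr \<sigma>) * ennreal (\<bar>y (Suc n) x - y n x\<bar> powr \<sigma>)) \<noteq> \<infinity>"
    by (intro nn_integral_PInf_AE) auto
  then have conv: "AE x in lborel. convergent (\<lambda>n. y n x)"
  proof eventually_elim
    case (elim x)
    define S where "S = (\<Sum>n. ennreal ((2 ^ n) powr \<sigma>) * ennreal (\<bar>y (Suc n) x - y n x\<bar> powr \<sigma>))"
    obtain K where K: "S = ennreal K" "0 \<le> K" using elim unfolding S_def[symmetric] by (cases S) auto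
    have "\<bar>y (Suc n) x - y n x\<bar> \<le> K powr (1 / \<sigma>) * (1/2) ^ n" for n
    proof -
      have "(\<Sum>i\<in>{n}. ennreal ((2 ^ i) powr \<sigma>) * ennreal (\<bar>y (Suc i) x - y i x\<bar> powr \<sigma>)) \<le> S"
        unfolding S_def by (rule sum_le_suminf) auto
      then have "ennreal ((2 ^ n * \<bar>y (Suc n) x - y n x\<bar>) powr \<sigma>) \<le> ennreal K"
        using K by (simp add: powr_mult flip: ennreal_mult)
      then have le: "(2 ^ n * \<bar>y (Suc n) x - y n x\<bar>) powr \<sigma> \<le> K" using K(2) by simp
      have "2 ^ n * \<bar>y (Suc n) x - y n x\<bar> = ((2 ^ n * \<bar>y (Suc n) x - y n x\<bar>) powr \<sigma>) powr (1 / \<sigma>)"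
        using \<sigma> by (simp add: powr_powr)
      also have "\<dots> \<le> K powr (1 / \<sigma>)" using \<sigma> by (intro powr_mono2 le) auto
      finally show ?thesis by (simp add: field_simps)
    qed
    then have "summable (\<lambda>n. y (Suc n) x - y n x)"
      by (intro summable_comparison_test'[OF summable_mult[OF summable_geometric[of "1/2::real"]], of 0]) auto
    then have "convergent (\<lambda>n. \<Sum>i<n. y (Suc i) x - y i x)" by (simp add: summable_iff_convergent)
    then have "convergent (\<lambda>n. y n x - y 0 x)"
      using sum_lessThan_telescope[of "\<lambda>n. y n x"] by simp
    from convergent_add[OF this convergent_const[of "y 0 x"]] show ?case by simp
  qed
  \<comment> \<open>An explicit limit with default value 0, so that vanishing off \<Omega> and
    nonnegativity pass to \<open>w\<close> at every point.\<close>
  define w where "w x = (if Cauchy (\<lambda>n. y n x) then lim (\<lambda>n. y n x) else 0)" for x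
  have w[measurable]: "w \<in> borel_measurable borel"
  proof -
    have "{x \<in> space borel. Cauchy (\<lambda>n. y n x)} \<in> sets borel" by (rule sets_Collect_Cauchy) measurable
    then have [measurable]: "Measurable.pred borel (\<lambda>x. Cauchy (\<lambda>n. y n x))" by (simp add: pred_def)
    show ?thesis unfolding w_def[abs_def] by measurable
  qed
  have lim: "AE x in lborel. (\<lambda>n. y n x) \<longlonglongrightarrow> w x"
    using conv
  proof eventually_elim
    case (elim x)
    then show ?case by (simp add: w_def convergent_Cauchy convergent_LIMSEQ_iff)
  qed
  have wb: "(\<integral>\<^sup>+x. ennreal (\<bar>y n x - w x\<bar> powr \<sigma>) \<partial>lborel) \<le> ennreal (\<epsilon> n)" for n
  proof -
    have "(\<integral>\<^sup>+x. ennreal (\<bar>y n x - w x\<bar> powr \<sigma>) \<partial>lborel) \<le> liminf (\<lambda>m. \<integral>\<^sup>+x. ennreal (\<bar>y n x - y m x\<bar> powr \<sigma>) \<partial>lborel)"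
    proof (rule nn_integral_fatou_AE)
      show "AE x in lborel. (\<lambda>m. ennreal (\<bar>y n x - y m x\<bar> powr \<sigma>)) \<longlonglongrightarrow> ennreal (\<bar>y n x - w x\<bar> powr \<sigma>)"
        using lim by eventually_elim (intro tendsto_ennrealI tendsto_powr' tendsto_rabs tendsto_diff tendsto_const, use \<sigma> in auto)
    qed measurable
    also have "\<dots> \<le> liminf (\<lambda>m. ennreal (\<epsilon> n))"
      by (intro Liminf_mono) (use yb[of n n] in \<open>auto simp: eventually_sequentially\<close>)
    finally show ?thesis by (simp add: Liminf_const)
  qed
  define G where "G x = (\<Sum>n. ennreal (\<bar>y n x - w x\<bar> powr \<sigma>))" for x
  have [measurable]: "G \<in> borel_measurable borel" unfolding G_def[abs_def] by measurable
  have "(\<integral>\<^sup>+x. G x \<partial>lborel) = (\<Sum>n. \<integral>\<^sup>+x. ennreal (\<bar>y n x - w x\<bar> powr \<sigma>) \<partial>lborel)"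
    unfolding G_def by (rule nn_integral_suminf) measurable
  also have "\<dots> \<le> (\<Sum>n. ennreal ((1/2) ^ n))"
  proof (rule suminf_le)
    fix n
    have "(1::real) \<le> (2 ^ n) powr \<sigma>" using \<sigma> by (intro ge_one_powr_ge_zero) auto
    then have "\<epsilon> n \<le> (1/2) ^ n" by (simp add: \<epsilon>_def divide_simps)
    then show "(\<integral>\<^sup>+x. ennreal (\<bar>y n x - w x\<bar> powr \<sigma>) \<partial>lborel) \<le> ennreal ((1/2) ^ n)"
      using wb[of n] by (meson ennreal_leI order_trans)
  qed auto
  finally have Gfin: "(\<integral>\<^sup>+x. G x \<partial>lborel) \<noteq> \<infinity>"
    unfolding infinity_ennreal_def by (rule neq_top_trans[OF geo])
  then have GAE: "AE x in lborel. G x \<noteq> \<infinity>" by (intro nn_integral_PInf_AE) auto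
  have Gint: "integrable lborel (\<lambda>x. enn2real (G x))"
  proof (rule integrableI_bounded)
    have "(\<integral>\<^sup>+x. ennreal (norm (enn2real (G x))) \<partial>lborel) \<le> (\<integral>\<^sup>+x. G x \<partial>lborel)"
      by (intro nn_integral_mono) (simp add: ennreal_enn2real_if)
    then show "(\<integral>\<^sup>+x. ennreal (norm (enn2real (G x))) \<partial>lborel) < \<infinity>"
      using Gfin by (metis infinity_ennreal_def less_top order_le_less_trans)
  qed measurable
  have bd: "AE x in lborel. \<forall>n. \<bar>y n x - w x\<bar> powr \<sigma> \<le> enn2real (G x)"
    using GAE
  proof eventually_elim
    case (elim x)
    show ?case
    proof
      fix n
      have "(\<Sum>i\<in>{n}. ennreal (\<bar>y i x - w x\<bar> powr \<sigma>)) \<le> G x" unfolding G_def by (rule sum_le_suminf) auto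
      then have "ennreal (\<bar>y n x - w x\<bar> powr \<sigma>) \<le> ennreal (enn2real (G x))" using elim by (simp add: less_top)
      then show "\<bar>y n x - w x\<bar> powr \<sigma> \<le> enn2real (G x)" by simp
    qed
  qed
  \<comment> \<open>\<open>Y\<close> dominates the power of the limit through the single function
    \<open>y 0\<close>; \<open>W\<close> then dominates all members through the limit and their
    distance to it.\<close>
  define Y where "Y x = 2 powr \<sigma> * (\<bar>y 0 x\<bar> powr \<sigma> + enn2real (G x))" for x
  define W where "W x = Y x + 2 powr \<sigma> * (Y x + enn2real (G x))" for x
  have "integrable lborel Y" unfolding Y_def using int Gint by (auto simp: y_def)
  then have W: "integrable lborel W" unfolding W_def using Gint by auto
  have wY: "AE x in lborel. \<bar>w x\<bar> powr \<sigma> \<le> Y x"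
    using bd
  proof eventually_elim
    case (elim x)
    have "\<bar>y 0 x + - (y 0 x - w x)\<bar> powr \<sigma> \<le> 2 powr \<sigma> * (\<bar>y 0 x\<bar> powr \<sigma> + \<bar>- (y 0 x - w x)\<bar> powr \<sigma>)"
      using \<sigma> by (intro abs_add_powr_le) auto
    also have "\<dots> \<le> Y x" unfolding Y_def using elim[rule_format, of 0]
      by (intro mult_left_mono add_left_mono) (auto simp: abs_minus_commute[of "w x"])
    finally show ?case by simp
  qed
  have Y0: "0 \<le> Y x" for x by (simp add: Y_def)
  have "AE x in lborel. \<bar>w x\<bar> powr \<sigma> \<le> W x"
    using wY by eventually_elim (use Y0 in \<open>simp add: W_def add_increasing2\<close>)
  moreover have "AE x in lborel. \<forall>n. \<bar>y n x\<bar> powr \<sigma> \<le> W x"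
    using wY bd
  proof eventually_elim
    case (elim x)
    show ?case
    proof
      fix n
      have "\<bar>w x + (y n x - w x)\<bar> powr \<sigma> \<le> 2 powr \<sigma> * (\<bar>w x\<bar> powr \<sigma> + \<bar>y n x - w x\<bar> powr \<sigma>)"
        using \<sigma> by (intro abs_add_powr_le) auto
      also have "\<dots> \<le> 2 powr \<sigma> * (Y x + enn2real (G x))" using elim by (intro mult_left_mono add_mono) auto
      also have "\<dots> \<le> W x" using Y0 by (simp add: W_def)
      finally show "\<bar>y n x\<bar> powr \<sigma> \<le> W x" by simp
    qed
  qed
  ultimately show ?thesis using j w W lim unfolding w_def y_def by blast
qed

section \<open>The energy of the problem\<close>

text \<open>
  Pointwise form of Young's convolution inequality: the three products on the right enter with the
  weights \<open>2 / m - 1\<close>, \<open>1 - 1 / m\<close>, \<open>1 - 1 / m\<close>.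
\<close>
lemma powr_young_three:
  fixes X Y k m :: real
  assumes "0 \<le> X" "0 \<le> Y" "0 \<le> k" "1 < m" "m \<le> 2"
  defines "\<kappa> \<equiv> m / (2 * (m - 1))"
  shows "X * Y * k \<le> X powr m * Y powr m + X powr m * k powr \<kappa> + Y powr m * k powr \<kappa>"
proof -
  define a b c where "a = X powr m * Y powr m" and "b = X powr m * k powr \<kappa>" and "c = Y powr m * k powr \<kappa>"
  define M where "M = max a (max b c)"
  have nn: "0 \<le> a" "0 \<le> b" "0 \<le> c" by (auto simp: a_def b_def c_def)
  define \<alpha> \<beta> where "\<alpha> = 2 / m - 1" and "\<beta> = 1 - 1 / m"
  have "\<beta> = (m - 1) / m" using assms(4) by (simp add: \<beta>_def field_simps)
  then have "\<kappa> * \<beta> = 1 / 2" using assms(4) by (simp add: \<kappa>_def)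
  then have e: "m * \<alpha> + m * \<beta> = 1" "\<kappa> * \<beta> + \<kappa> * \<beta> = 1"
  proof -
    show "m * \<alpha> + m * \<beta> = 1" using assms(4) by (simp add: \<alpha>_def \<beta>_def field_simps)
    show "\<kappa> * \<beta> + \<kappa> * \<beta> = 1" using \<open>\<kappa> * \<beta> = 1 / 2\<close> by linarith
  qed
  have "(X powr m) powr \<alpha> * (X powr m) powr \<beta> = X" "(Y powr m) powr \<alpha> * (Y powr m) powr \<beta> = Y"
    "(k powr \<kappa>) powr \<beta> * (k powr \<kappa>) powr \<beta> = k"
    using assms(1-3) by (simp_all only: powr_powr powr_add[symmetric] e) auto
  moreover have "a powr \<alpha> * b powr \<beta> * c powr \<beta> = ((X powr m) powr \<alpha> * (X powr m) powr \<beta>) *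
      ((Y powr m) powr \<alpha> * (Y powr m) powr \<beta>) * ((k powr \<kappa>) powr \<beta> * (k powr \<kappa>) powr \<beta>)"
    unfolding a_def b_def c_def by (simp add: powr_mult mult_ac)
  ultimately have "X * Y * k = a powr \<alpha> * b powr \<beta> * c powr \<beta>" by simp
  also have "\<dots> \<le> M powr \<alpha> * M powr \<beta> * M powr \<beta>"
    using nn assms(4,5) by (intro mult_mono powr_mono2) (auto simp: M_def \<alpha>_def \<beta>_def)
  also have "\<dots> = M powr 1" by (simp flip: powr_add) (simp add: \<alpha>_def \<beta>_def)
  also have "\<dots> \<le> a + b + c" using nn by (auto simp: M_def)
  finally show ?thesis by (simp add: a_def b_def c_def)
qed

lemma powr_le_one_plus: "0 \<le> t \<Longrightarrow> 0 < a \<Longrightarrow> a \<le> b \<Longrightarrow> t powr a \<le> 1 + t powr (b::real)"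
proof (cases "t \<le> 1")
  case True assume "0 \<le> t" "0 < a" "a \<le> b"
  then have "t powr a \<le> 1" using True powr_mono2[of a t 1] by simp
  then show ?thesis by (simp add: add_increasing2)
next
  case False assume "0 \<le> t" "0 < a" "a \<le> b"
  then have "t powr a \<le> t powr b" using False by (intro powr_mono) auto
  then show ?thesis by simp
qed

text \<open>The weight is taken to be a Borel function on the whole space that is zero off \<Omega>,
  so that every functional becomes an integral over \<open>lborel\<close>.\<close>

locale choquard_data =
  fixes \<Omega> :: "'a::euclidean_space set" and a :: "'a \<Rightarrow> real" and s1 s2 \<mu> p q r d :: real
  assumes \<Omega>: "bounded \<Omega>" "open \<Omega>"
    and s: "0 < s2" "s2 < s1" "s1 < 1" "2 * s1 < real DIM('a)"
    and \<mu>: "0 < \<mu>" "\<mu> < real DIM('a)"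
    and pq: "1 < q" "q < p" "p < 2"
    and d: "q < d" "d < crit_sobolev (real DIM('a)) s1"
    and a_meas [measurable]: "a \<in> borel_measurable borel"
    and a_int: "integrable lborel (\<lambda>x. \<bar>a x\<bar> powr (d / (d - q)))"
    and a_off: "x \<notin> \<Omega> \<Longrightarrow> a x = 0"
    and a_pos: "\<not> (AE x in lborel. max (a x) 0 = 0)"
    and r: "1 < r" "r < crit_choquard (real DIM('a)) s1 \<mu>"
begin

lemma \<Omega>_borel [measurable]: "\<Omega> \<in> sets borel" using \<Omega> by simp

lemma S_gt_2: "2 < crit_sobolev (real DIM('a)) s1" using s by (simp add: crit_sobolev_def field_simps)

text \<open>The borderline is \<open>m = 2 * n / (2 * n - \<mu>)\<close>, the exponent of the
  Hardy-Littlewood-Sobolev inequality, at which the kernel power in the last condition equals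
  \<open>n\<close>. The bound on \<open>r\<close> says exactly that \<open>r\<close> times this
  value is below the critical Sobolev exponent, which leaves room for a slightly larger
  \<open>m\<close> with an integrable kernel.\<close>

lemma exponent_exists: "\<exists>m. 1 < m \<and> m \<le> 2 \<and> r * m < crit_sobolev (real DIM('a)) s1 \<and> \<mu> * (m / (2 * (m - 1))) < real DIM('a)"
proof -
  have "2 * real DIM('a) / (2 * real DIM('a) - \<mu>) < crit_sobolev (real DIM('a)) s1 / r"
  proof -
    have "r * (real DIM('a) - 2 * s1) < 2 * real DIM('a) - \<mu>"
      using r s unfolding crit_choquard_def by (simp add: pos_less_divide_eq)
    then have "2 * real DIM('a) / (2 * real DIM('a) - \<mu>) < 2 * real DIM('a) / (r * (real DIM('a) - 2 * s1))"
      using r s \<mu> by (intro divide_strict_left_mono) auto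
    then show ?thesis by (simp add: crit_sobolev_def mult.commute)
  qed
  moreover have "2 * real DIM('a) / (2 * real DIM('a) - \<mu>) < 2" using \<mu> by (simp add: field_simps)
  ultimately have "2 * real DIM('a) / (2 * real DIM('a) - \<mu>) < min 2 (crit_sobolev (real DIM('a)) s1 / r)" by simp
  then obtain m where m: "2 * real DIM('a) / (2 * real DIM('a) - \<mu>) < m" "m < min 2 (crit_sobolev (real DIM('a)) s1 / r)" using dense by blast
  have "1 < 2 * real DIM('a) / (2 * real DIM('a) - \<mu>)" using \<mu> by (simp add: field_simps)
  then have m1: "1 < m" using m by linarith
  have "2 * real DIM('a) < m * (2 * real DIM('a) - \<mu>)" using m(1) \<mu> by (simp add: field_simps)
  then have "\<mu> * m < real DIM('a) * (2 * (m - 1))" by (simp add: algebra_simps)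
  then have "\<mu> * (m / (2 * (m - 1))) < real DIM('a)" using m1 by (simp add: field_simps)
  moreover have "r * m < crit_sobolev (real DIM('a)) s1" using m r by (simp add: field_simps)
  ultimately show ?thesis using m1 m by auto
qed

definition "m = (SOME m. 1 < m \<and> m \<le> 2 \<and> r * m < crit_sobolev (real DIM('a)) s1 \<and> \<mu> * (m / (2 * (m - 1))) < real DIM('a))"

lemma m: "1 < m" "m \<le> 2" "r * m < crit_sobolev (real DIM('a)) s1" "\<mu> * (m / (2 * (m - 1))) < real DIM('a)"
  using someI_ex[OF exponent_exists] unfolding m_def by auto

text \<open>One subcritical exponent serving the Choquard term (\<open>r * m\<close>), the weighted
  term (\<open>d\<close>) and the interpolation from the square mean (2), so that a single dominated
  subsequence handles both lower-order functionals.\<close>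

definition "\<sigma> = max (max (r * m) d) 2"

lemma \<sigma>: "2 \<le> \<sigma>" "\<sigma> < crit_sobolev (real DIM('a)) s1" "d \<le> \<sigma>" "r * m \<le> \<sigma>"
  using d m S_gt_2 by (auto simp: \<sigma>_def)

definition "diam = (SOME D. \<forall>x\<in>\<Omega>. \<forall>y\<in>\<Omega>. norm (x - y) \<le> D)"

lemma diam: "x \<in> \<Omega> \<Longrightarrow> y \<in> \<Omega> \<Longrightarrow> norm (x - y) \<le> diam"
proof -
  have "\<exists>D. \<forall>x\<in>\<Omega>. \<forall>y\<in>\<Omega>. norm (x - y) \<le> D"
    using \<Omega>(1) unfolding bounded_two_points by (auto simp: dist_norm)
  from someI_ex[OF this] show "x \<in> \<Omega> \<Longrightarrow> y \<in> \<Omega> \<Longrightarrow> norm (x - y) \<le> diam"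
    unfolding diam_def by blast
qed

definition choquard_kernel :: "'a \<times> 'a \<Rightarrow> real" where
  "choquard_kernel z = norm (fst z - snd z) powr (- \<mu>)"

text \<open>The right-hand side of \<open>powr_young_three\<close> with \<open>g\<close> in place of
  \<open>\<bar>f\<bar> powr (r * m)\<close>. Differences of points of \<Omega> are bounded by
  \<open>diam\<close>; cutting off there makes the kernel power integrable.\<close>

definition choquard_dom :: "('a \<Rightarrow> real) \<Rightarrow> 'a \<times> 'a \<Rightarrow> real" where
  "choquard_dom g z = g (fst z) * g (snd z) + (g (fst z) + g (snd z)) *
     (norm (fst z - snd z) powr (- (\<mu> * (m / (2 * (m - 1))))) * indicator (cball 0 diam) (fst z - snd z))"

lemma choquard_kernel_measurable [measurable]: "choquard_kernel \<in> borel_measurable borel"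
  unfolding choquard_kernel_def[abs_def] by measurable

lemma choquard_pointwise:
  assumes f: "x \<notin> \<Omega> \<Longrightarrow> f x = 0" "y \<notin> \<Omega> \<Longrightarrow> f y = 0"
    and g: "\<bar>f x\<bar> powr (r * m) \<le> g x" "\<bar>f y\<bar> powr (r * m) \<le> g y"
  shows "\<bar>f x\<bar> powr r * \<bar>f y\<bar> powr r * choquard_kernel (x, y) \<le> choquard_dom g (x, y)"
proof -
  have g0: "0 \<le> g x" "0 \<le> g y" using g by (meson order_trans powr_ge_zero)+
  show ?thesis
  proof (cases "x \<in> \<Omega> \<and> y \<in> \<Omega>")
    case True
    have k: "(norm (x - y) powr (- \<mu>)) powr (m / (2 * (m - 1))) = norm (x - y) powr (- (\<mu> * (m / (2 * (m - 1)))))"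
      by (simp only: powr_powr mult_minus_left)
    have "\<bar>f x\<bar> powr r * \<bar>f y\<bar> powr r * norm (x - y) powr (- \<mu>)
      \<le> (\<bar>f x\<bar> powr r) powr m * (\<bar>f y\<bar> powr r) powr m + (\<bar>f x\<bar> powr r) powr m * (norm (x - y) powr (- \<mu>)) powr (m / (2 * (m - 1)))
        + (\<bar>f y\<bar> powr r) powr m * (norm (x - y) powr (- \<mu>)) powr (m / (2 * (m - 1)))"
      by (rule powr_young_three) (use m in auto)
    also have "\<dots> \<le> g x * g y + g x * (norm (x - y) powr (- \<mu>)) powr (m / (2 * (m - 1)))
        + g y * (norm (x - y) powr (- \<mu>)) powr (m / (2 * (m - 1)))"
      using g g0 by (intro add_mono mult_mono) (auto simp: powr_powr)
    also have "\<dots> = choquard_dom g (x, y)"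
      unfolding choquard_dom_def fst_conv snd_conv k using diam[of x y] True by (simp add: distrib_right)
    finally show ?thesis by (simp add: choquard_kernel_def)
  next
    case False
    then have "f x = 0 \<or> f y = 0" using f by blast
    then show ?thesis using g0 r by (auto simp: choquard_dom_def)
  qed
qed

lemma choquard_dom_integrable:
  assumes g: "integrable lborel g" "\<And>x. 0 \<le> g x"
  shows "integrable lborel (choquard_dom g)"
proof -
  have [measurable]: "g \<in> borel_measurable borel" using borel_measurable_integrable[OF g(1)] by simp
  define k :: "'a \<Rightarrow> real" where "k w = norm w powr (- (\<mu> * (m / (2 * (m - 1))))) * indicator (cball 0 diam) w" for w
  have [measurable]: "k \<in> borel_measurable borel" unfolding k_def[abs_def] by measurable
  have k0: "0 \<le> k w" for w by (simp add: k_def)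
  have "(\<integral>\<^sup>+w. ennreal (k w) \<partial>lborel) = (\<integral>\<^sup>+(w::'a). ennreal (norm w powr (- (\<mu> * (m / (2 * (m - 1)))))) * indicator (cball 0 diam) w \<partial>lborel)"
    unfolding k_def by (intro nn_integral_cong) (auto split: split_indicator)
  also have "\<dots> < \<infinity>" by (rule nn_integral_kernel_near) (use m in simp)
  finally have k: "integrable lborel k" using k0 by (intro integrableI_bounded) auto
  have gfin: "(\<integral>\<^sup>+x. ennreal (g x) \<partial>lborel) < \<infinity>"
    using g by (subst nn_integral_eq_integral) auto
  have 1: "integrable lborel (\<lambda>z::'a \<times> 'a. g (fst z) * g (snd z))"
  proof (rule integrableI_bounded)
    have "(\<integral>\<^sup>+(z::'a \<times> 'a). ennreal (norm (g (fst z) * g (snd z))) \<partial>lborel)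
       = (\<integral>\<^sup>+x. \<integral>\<^sup>+y. ennreal (g x) * ennreal (g y) \<partial>lborel \<partial>lborel)"
      using g(2) by (subst nn_integral_lborel_pair(1)) (auto simp: ennreal_mult abs_mult)
    also have "\<dots> = (\<integral>\<^sup>+x. ennreal (g x) \<partial>lborel) * (\<integral>\<^sup>+x. ennreal (g x) \<partial>lborel)"
      by (simp add: nn_integral_cmult nn_integral_multc)
    also have "\<dots> < \<infinity>" using gfin by (simp add: ennreal_mult_less_top)
    finally show "(\<integral>\<^sup>+(z::'a \<times> 'a). ennreal (norm (g (fst z) * g (snd z))) \<partial>lborel) < \<infinity>" .
  qed measurable
  have "choquard_dom g = (\<lambda>z. g (fst z) * g (snd z) + (g (fst z) * k (fst z - snd z) + g (snd z) * k (fst z - snd z)))"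
    by (auto simp: choquard_dom_def k_def algebra_simps)
  then show ?thesis using 1 integrable_convolution[OF g k k0] by simp
qed

section \<open>The function space, its functionals and their first variations\<close>

definition X :: "('a \<Rightarrow> real) set" where "X = {u \<in> bsupp \<Omega>. gagliardo 2 s1 u < \<infinity>}"

definition gform :: "real \<Rightarrow> real \<Rightarrow> ('a \<Rightarrow> real) \<Rightarrow> real" where
  "gform t s u = (\<integral>z. gagliardo_density t s u z \<partial>lborel)"

definition gform' :: "real \<Rightarrow> real \<Rightarrow> ('a \<Rightarrow> real) \<Rightarrow> ('a \<Rightarrow> real) \<Rightarrow> real" where
  "gform' t s u h = (\<integral>z. \<bar>u (fst z) - u (snd z)\<bar> powr (t - 2) * (u (fst z) - u (snd z)) * (h (fst z) - h (snd z))
     * norm (fst z - snd z) powr (- (real DIM('a) + t * s)) \<partial>lborel)"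

definition H :: "('a \<Rightarrow> real) \<Rightarrow> real" where "H u = (\<integral>x. \<bar>u x\<bar> powr q * a x \<partial>lborel)"

definition H' :: "('a \<Rightarrow> real) \<Rightarrow> ('a \<Rightarrow> real) \<Rightarrow> real" where
  "H' u h = (\<integral>x. \<bar>u x\<bar> powr (q - 2) * u x * h x * a x \<partial>lborel)"

definition A :: "('a \<Rightarrow> real) \<Rightarrow> real" where
  "A u = (\<integral>z. \<bar>u (fst z)\<bar> powr r * \<bar>u (snd z)\<bar> powr r * choquard_kernel z \<partial>lborel)"

definition A' :: "('a \<Rightarrow> real) \<Rightarrow> ('a \<Rightarrow> real) \<Rightarrow> real" where
  "A' u h = (\<integral>z. \<bar>u (snd z)\<bar> powr r * (\<bar>u (fst z)\<bar> powr (r - 2) * u (fst z) * h (fst z)) * choquard_kernel z \<partial>lborel)"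

lemma XD: "u \<in> X \<Longrightarrow> u \<in> bsupp \<Omega>" "u \<in> X \<Longrightarrow> u \<in> borel_measurable borel" "u \<in> X \<Longrightarrow> gagliardo 2 s1 u < \<infinity>"
  "u \<in> X \<Longrightarrow> x \<notin> \<Omega> \<Longrightarrow> u x = 0"
  by (auto simp: X_def bsupp_def)

lemma gagliardo_eq_gform:
  assumes "u \<in> borel_measurable borel" "gagliardo t s u < \<infinity>"
  shows "integrable lborel (gagliardo_density t s u)" "gagliardo t s u = ennreal (gform t s u)"
proof -
  have [measurable]: "u \<in> borel_measurable borel" by fact
  show i: "integrable lborel (gagliardo_density t s u)"
    using assms(2) unfolding gagliardo_def by (intro integrableI_bounded) auto
  show "gagliardo t s u = ennreal (gform t s u)"
    unfolding gagliardo_def gform_def using i by (intro nn_integral_eq_integral) auto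
qed

lemma gform_nonneg: "0 \<le> gform t s u"
  unfolding gform_def by (intro Bochner_Integration.integral_nonneg) simp

lemma X_gagliardo:
  assumes "u \<in> X"
  shows "gagliardo 2 s1 u = ennreal (gform 2 s1 u)" "gagliardo p s2 u = ennreal (gform p s2 u)"
    "integrable lborel (gagliardo_density 2 s1 u)" "integrable lborel (gagliardo_density p s2 u)"
proof -
  note u = XD[OF assms]
  show K: "gagliardo 2 s1 u = ennreal (gform 2 s1 u)" "integrable lborel (gagliardo_density 2 s1 u)"
    using gagliardo_eq_gform u by auto
  obtain C where "gagliardo p s2 u \<le> ennreal C"
    using gagliardo_embedding[OF \<Omega>(1) \<Omega>_borel s(1,2,4), of p "gform 2 s1 u"] pq u(1) K by auto
  then have "gagliardo p s2 u < \<infinity>" by (simp add: order_le_less_trans[OF _ ennreal_less_top])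
  then show "gagliardo p s2 u = ennreal (gform p s2 u)" "integrable lborel (gagliardo_density p s2 u)"
    using gagliardo_eq_gform u by auto
qed

lemma X_integrable: "u \<in> X \<Longrightarrow> 0 < t \<Longrightarrow> t < crit_sobolev (real DIM('a)) s1 \<Longrightarrow> integrable lborel (\<lambda>x. \<bar>u x\<bar> powr t)"
  using bsupp_integrable[OF \<Omega>(1) \<Omega>_borel _ s(4)] s XD by auto

lemma X_line: assumes "u \<in> X" "h \<in> X" shows "(\<lambda>x. u x + e * h x) \<in> X"
proof -
  have "gagliardo 2 s1 (\<lambda>x. u x + e * h x) \<le> ennreal (2 powr 2) * (gagliardo 2 s1 u + ennreal (\<bar>e\<bar> powr 2) * gagliardo 2 s1 h)"
    using XD assms by (intro gagliardo_add_scaled) auto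
  also have "\<dots> < \<infinity>" using X_gagliardo(1) assms by (simp add: ennreal_mult_less_top)
  finally show ?thesis by (simp add: X_def bsupp_add_scaled XD(1)[OF assms(1)] XD(1)[OF assms(2)])
qed

lemma gagliardo_density_scale: "gagliardo_density t s (\<lambda>x. c * u x) z = \<bar>c\<bar> powr t * gagliardo_density t s u z"
  by (simp add: gagliardo_density_def powr_mult abs_mult flip: right_diff_distrib)

lemma gform_scale: "gform t s (\<lambda>x. c * u x) = \<bar>c\<bar> powr t * gform t s u"
  unfolding gform_def gagliardo_density_scale by simp

lemma X_scale: assumes u: "u \<in> X" shows "(\<lambda>x. c * u x) \<in> X"
proof -
  have [measurable]: "u \<in> borel_measurable borel" using u by (rule XD)
  have "gagliardo 2 s1 (\<lambda>x. c * u x) = ennreal (\<bar>c\<bar> powr 2) * gagliardo 2 s1 u"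
    unfolding gagliardo_def gagliardo_density_scale
    by (subst nn_integral_cmult[symmetric]) (auto simp: ennreal_mult)
  then show ?thesis using XD[OF u] by (auto simp: X_def bsupp_def ennreal_mult_less_top)
qed

lemma gagliardo_density_abs: "0 \<le> t \<Longrightarrow> gagliardo_density t s (\<lambda>x. \<bar>u x\<bar>) z \<le> gagliardo_density t s u z"
  unfolding gagliardo_density_def by (intro mult_right_mono powr_mono2) auto

lemma X_abs: assumes u: "u \<in> X" shows "(\<lambda>x. \<bar>u x\<bar>) \<in> X"
proof -
  have "gagliardo 2 s1 (\<lambda>x. \<bar>u x\<bar>) \<le> gagliardo 2 s1 u"
    unfolding gagliardo_def by (intro nn_integral_mono ennreal_leI gagliardo_density_abs) simp
  then show ?thesis using XD[OF u] by (auto simp: X_def bsupp_def order_le_less_trans)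
qed

lemma gform_abs:
  assumes "u \<in> X" shows "gform 2 s1 (\<lambda>x. \<bar>u x\<bar>) \<le> gform 2 s1 u" "gform p s2 (\<lambda>x. \<bar>u x\<bar>) \<le> gform p s2 u"
  unfolding gform_def using X_gagliardo(3,4)[OF assms] X_gagliardo(3,4)[OF X_abs[OF assms]] pq
  by (auto intro!: integral_mono gagliardo_density_abs)

lemma gform_deriv:
  assumes u: "u \<in> X" and h: "h \<in> X"
  shows "((\<lambda>e. gform 2 s1 (\<lambda>x. u x + e * h x)) has_real_derivative 2 * gform' 2 s1 u h) (at 0)"
    and "((\<lambda>e. gform p s2 (\<lambda>x. u x + e * h x)) has_real_derivative p * gform' p s2 u h) (at 0)"
proof -
  have [measurable]: "u \<in> borel_measurable borel" "h \<in> borel_measurable borel" using u h XD by auto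
  have "((\<lambda>e. gform t s (\<lambda>x. u x + e * h x)) has_real_derivative t * gform' t s u h) (at 0)"
    if "1 < t" "integrable lborel (gagliardo_density t s u)" "integrable lborel (gagliardo_density t s h)" for t s
  proof -
    have eq: "gform t s (\<lambda>x. u x + e * h x) = (\<integral>z. \<bar>(u (fst z) - u (snd z)) + e * (h (fst z) - h (snd z))\<bar> powr t * norm (fst z - snd z) powr (- (real DIM('a) + t * s)) \<partial>lborel)" for e
      unfolding gform_def gagliardo_density_def by (simp add: algebra_simps)
    show ?thesis unfolding eq gform'_def
      by (rule deriv_power_integral) (use that in \<open>simp_all add: gagliardo_density_def[abs_def]\<close>)
  qed
  from this[of 2 s1] this[of p s2] show "((\<lambda>e. gform 2 s1 (\<lambda>x. u x + e * h x)) has_real_derivative 2 * gform' 2 s1 u h) (at 0)"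
    "((\<lambda>e. gform p s2 (\<lambda>x. u x + e * h x)) has_real_derivative p * gform' p s2 u h) (at 0)"
    using X_gagliardo(3,4) u h pq by auto
qed

text \<open>Pointwise Young inequality for the conjugate exponents \<open>d / q\<close> and
  \<open>d / (d - q)\<close>; it supplies dominating functions directly.\<close>

lemma weight_young: "0 \<le> t \<Longrightarrow> t powr q * \<bar>a x\<bar> \<le> t powr d + \<bar>a x\<bar> powr (d / (d - q))"
proof -
  assume t: "0 \<le> t"
  have "(t powr d) powr (q / d) * (\<bar>a x\<bar> powr (d / (d - q))) powr (1 - q / d) \<le> t powr d + \<bar>a x\<bar> powr (d / (d - q))"
    by (rule powr_young_interpolation) (use d pq in auto)
  moreover have "(t powr d) powr (q / d) = t powr q" using d pq by (simp add: powr_powr)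
  moreover have "d / (d - q) * (1 - q / d) = 1" using d pq by (simp add: field_simps)
  then have "(\<bar>a x\<bar> powr (d / (d - q))) powr (1 - q / d) = \<bar>a x\<bar>" by (simp only: powr_powr) simp
  ultimately show ?thesis by simp
qed

lemma H_integrable: assumes "u \<in> X" shows "integrable lborel (\<lambda>x. \<bar>u x\<bar> powr q * a x)"
proof (rule Bochner_Integration.integrable_bound)
  have [measurable]: "u \<in> borel_measurable borel" using assms XD by auto
  show "integrable lborel (\<lambda>x. \<bar>u x\<bar> powr d + \<bar>a x\<bar> powr (d / (d - q)))"
    using X_integrable[OF assms, of d] d pq a_int by auto
  show "AE x in lborel. norm (\<bar>u x\<bar> powr q * a x) \<le> norm (\<bar>u x\<bar> powr d + \<bar>a x\<bar> powr (d / (d - q)))"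
    using weight_young by (auto simp: abs_mult)
  show "(\<lambda>x. \<bar>u x\<bar> powr q * a x) \<in> borel_measurable lborel" by measurable
qed

lemma H_deriv:
  assumes "u \<in> X" "h \<in> X" shows "((\<lambda>e. H (\<lambda>x. u x + e * h x)) has_real_derivative q * H' u h) (at 0)"
  unfolding H_def H'_def using assms XD pq by (intro deriv_power_integral H_integrable) auto

lemma choquard_exponent: "0 < r * m" "r * m < crit_sobolev (real DIM('a)) s1" using m r by auto

text \<open>Stated with a majorant \<open>g\<close> of \<open>\<bar>f\<bar> powr (r * m)\<close>,
  since one \<open>g\<close> can serve a whole sequence; \<open>choquard_dom g\<close> is then the
  dominating function in the product space.\<close>

lemma choquard_integrable:
  assumes [measurable]: "f \<in> borel_measurable borel" and f: "\<And>x. x \<notin> \<Omega> \<Longrightarrow> f x = 0"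
    and g: "integrable lborel g" "\<And>x. 0 \<le> g x" "AE x in lborel. \<bar>f x\<bar> powr (r * m) \<le> g x"
  shows "AE z in lborel. \<bar>f (fst z)\<bar> powr r * \<bar>f (snd z)\<bar> powr r * choquard_kernel z \<le> choquard_dom g z"
    and "integrable lborel (\<lambda>z. \<bar>f (fst z)\<bar> powr r * \<bar>f (snd z)\<bar> powr r * choquard_kernel z)"
proof -
  show dom: "AE z in lborel. \<bar>f (fst z)\<bar> powr r * \<bar>f (snd z)\<bar> powr r * choquard_kernel z \<le> choquard_dom g z"
    using AE_lborel_fst_snd(1)[OF g(3), where 'b = 'a] AE_lborel_fst_snd(2)[OF g(3), where 'b = 'a]
  proof eventually_elim
    case (elim z)
    then show ?case using choquard_pointwise[of "fst z" f "snd z" g] f by simp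
  qed
  show "integrable lborel (\<lambda>z. \<bar>f (fst z)\<bar> powr r * \<bar>f (snd z)\<bar> powr r * choquard_kernel z)"
  proof (rule Bochner_Integration.integrable_bound[OF choquard_dom_integrable[OF g(1,2)]])
    show "AE z in lborel. norm (\<bar>f (fst z)\<bar> powr r * \<bar>f (snd z)\<bar> powr r * choquard_kernel z) \<le> norm (choquard_dom g z)"
      using dom by eventually_elim (simp add: choquard_kernel_def)
  qed measurable
qed

lemma A_integrable:
  assumes "u \<in> X"
  shows "integrable lborel (\<lambda>z. \<bar>u (fst z)\<bar> powr r * \<bar>u (snd z)\<bar> powr r * choquard_kernel z)"
  using XD[OF assms] X_integrable[OF assms choquard_exponent]
  by (intro choquard_integrable(2)[where g = "\<lambda>x. \<bar>u x\<bar> powr (r * m)"]) auto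

lemma A_nonneg: "0 \<le> A u"
  unfolding A_def by (intro Bochner_Integration.integral_nonneg) (simp add: choquard_kernel_def)

lemma A_scale: "A (\<lambda>x. c * u x) = \<bar>c\<bar> powr (2 * r) * A u"
proof -
  have pw: "\<bar>c * u x\<bar> powr r * \<bar>c * u y\<bar> powr r * k = \<bar>c\<bar> powr (2 * r) * (\<bar>u x\<bar> powr r * \<bar>u y\<bar> powr r * k)" for x y k
  proof -
    have sq: "\<bar>c\<bar> powr (2 * r) = \<bar>c\<bar> powr r * \<bar>c\<bar> powr r" by (simp only: mult_2 powr_add)
    show ?thesis unfolding sq by (simp add: abs_mult powr_mult)
  qed
  show ?thesis unfolding A_def pw by simp
qed

lemma H_scale: "H (\<lambda>x. c * u x) = \<bar>c\<bar> powr q * H u"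
  unfolding H_def by (simp add: abs_mult powr_mult mult.assoc)

text \<open>The product rule gives one term for each variable. The kernel is symmetric, so the two
  terms are exchanged by swapping the variables and have the same integral; this produces the factor
  \<open>2 * r\<close>, and \<open>A'\<close> keeps only the variation in the first variable. All
  quantities are dominated by powers of \<open>b = \<bar>u\<bar> + \<bar>h\<bar>\<close>.\<close>

lemma A_deriv:
  assumes u: "u \<in> X" and h: "h \<in> X"
  shows "((\<lambda>e. A (\<lambda>x. u x + e * h x)) has_real_derivative (2 * r) * A' u h) (at 0)"
proof -
  have [measurable]: "u \<in> borel_measurable borel" "h \<in> borel_measurable borel" using u h XD by auto
  define k where "k = choquard_kernel"
  have [measurable]: "k \<in> borel_measurable borel" by (simp add: k_def)
  have k0: "0 \<le> k z" for z by (simp add: k_def choquard_kernel_def)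
  have k_sym: "k (y, x) = k (x, y)" for x y by (simp add: k_def choquard_kernel_def norm_minus_commute)
  define b where "b x = \<bar>u x\<bar> + \<bar>h x\<bar>" for x
  have [measurable]: "b \<in> borel_measurable borel" unfolding b_def[abs_def] by measurable
  have b0: "0 \<le> b x" for x by (simp add: b_def)
  have "integrable lborel (\<lambda>x. (\<bar>u x\<bar> + \<bar>h x\<bar>) powr (r * m) * 1)"
    using X_integrable[OF u choquard_exponent] X_integrable[OF h choquard_exponent] choquard_exponent
    by (intro integrable_abs_add_powr) auto
  then have "integrable lborel (\<lambda>x. b x powr (r * m))" by (simp add: b_def)
  then have "integrable lborel (\<lambda>z. \<bar>b (fst z)\<bar> powr r * \<bar>b (snd z)\<bar> powr r * choquard_kernel z)"
    using b0 XD(4)[OF u] XD(4)[OF h] by (intro choquard_integrable(2)[where g = "\<lambda>x. b x powr (r * m)"]) (auto simp: b_def)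
  then have bint: "integrable lborel (\<lambda>z. b (fst z) powr r * b (snd z) powr r * k z)"
    using b0 by (simp add: k_def)
  define D where "D x = \<bar>u x\<bar> powr (r - 2) * u x * h x" for x
  have [measurable]: "D \<in> borel_measurable borel" unfolding D_def[abs_def] by measurable
  have Db: "\<bar>D x\<bar> \<le> b x powr r" for x
  proof -
    have "\<bar>u x\<bar> powr (r - 2) * \<bar>u x\<bar> = \<bar>u x\<bar> powr (r - 1)"
      using powr_add[of "\<bar>u x\<bar>" "r - 2" 1] by (cases "u x = 0") auto
    then have "\<bar>D x\<bar> = \<bar>u x\<bar> powr (r - 1) * \<bar>h x\<bar>" by (simp add: D_def abs_mult)
    also have "\<dots> \<le> b x powr (r - 1) * b x" using r by (intro mult_mono powr_mono2) (auto simp: b_def)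
    also have "\<dots> = b x powr r" using powr_add[of "b x" "r - 1" 1] b0[of x] by (cases "b x = 0") auto
    finally show ?thesis .
  qed
  have ub: "\<bar>u x + e * h x\<bar> powr r \<le> b x powr r" if "\<bar>e\<bar> \<le> 1" for e x
  proof (rule powr_mono2)
    have "\<bar>e * h x\<bar> \<le> \<bar>h x\<bar>" using that by (simp add: abs_mult mult_left_le_one_le)
    then show "\<bar>u x + e * h x\<bar> \<le> b x" unfolding b_def by linarith
  qed (use r in auto)
  have ub0: "\<bar>u x\<bar> powr r \<le> b x powr r" for x using ub[of 0 x] by simp
  have i1: "integrable lborel (\<lambda>z. \<bar>u (snd z)\<bar> powr r * D (fst z) * k z)"
  proof (rule Bochner_Integration.integrable_bound[OF bint])
    have "norm (\<bar>u (snd z)\<bar> powr r * D (fst z) * k z) \<le> norm (b (fst z) powr r * b (snd z) powr r * k z)" for z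
    proof -
      have "\<bar>u (snd z)\<bar> powr r * \<bar>D (fst z)\<bar> * k z \<le> b (snd z) powr r * b (fst z) powr r * k z"
        using Db ub0 k0 by (intro mult_right_mono mult_mono) auto
      then show ?thesis using k0 by (simp add: abs_mult mult_ac)
    qed
    then show "AE z in lborel. norm (\<bar>u (snd z)\<bar> powr r * D (fst z) * k z) \<le> norm (b (fst z) powr r * b (snd z) powr r * k z)"
      by simp
  qed measurable
  define F where "F z = \<bar>u (snd z)\<bar> powr r * D (fst z) * k z" for z
  have [measurable]: "F \<in> borel_measurable borel" unfolding F_def[abs_def] by measurable
  have swap: "(\<integral>z. F (snd z, fst z) \<partial>lborel) = (\<integral>z. F z \<partial>lborel)" and
    swap_int: "integrable lborel (\<lambda>z. F (snd z, fst z))"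
  proof -
    have m: "F \<in> borel_measurable (lborel \<Otimes>\<^sub>M lborel)" by (simp add: lborel_prod)
    have Fi: "integrable (lborel \<Otimes>\<^sub>M lborel) F" using i1 by (simp add: lborel_prod F_def[abs_def])
    show "(\<integral>z. F (snd z, fst z) \<partial>lborel) = (\<integral>z. F z \<partial>lborel)"
      using lborel_pair.integral_product_swap[OF m] by (simp add: lborel_prod case_prod_unfold)
    show "integrable lborel (\<lambda>z. F (snd z, fst z))"
      using lborel_pair.integrable_product_swap[OF Fi] by (simp add: lborel_prod case_prod_unfold)
  qed
  have "((\<lambda>e. A (\<lambda>x. u x + e * h x)) has_real_derivative (\<integral>z. r * F z + r * F (snd z, fst z) \<partial>lborel)) (at 0)"
    unfolding A_def k_def[symmetric]
  proof (rule deriv_integral_at_0)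
    show "integrable lborel (\<lambda>z. \<bar>u (fst z) + e * h (fst z)\<bar> powr r * \<bar>u (snd z) + e * h (snd z)\<bar> powr r * k z)" for e
      using A_integrable[OF X_line[OF u h, of e]] by (simp add: k_def)
    show "(\<lambda>z. r * F z + r * F (snd z, fst z)) \<in> borel_measurable lborel"
      using borel_measurable_integrable[OF swap_int] by measurable
    have d: "((\<lambda>e. \<bar>u x + e * h x\<bar> powr r) has_real_derivative r * D x) (at 0)" for x
    proof -
      have "((\<lambda>e. \<bar>u x + e * h x\<bar> powr r) has_real_derivative r * (\<bar>u x\<bar> powr (r - 2) * u x) * h x) (at 0)"
      proof (rule DERIV_chain2[where f = "\<lambda>t. \<bar>t\<bar> powr r"])
        show "((\<lambda>e. u x + e * h x) has_real_derivative h x) (at 0)" by (auto intro!: derivative_eq_intros)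
      qed (use abs_powr_deriv[OF r(1), of "u x"] in simp)
      then show ?thesis by (simp add: D_def mult_ac)
    qed
    show "AE z in lborel. ((\<lambda>e. \<bar>u (fst z) + e * h (fst z)\<bar> powr r * \<bar>u (snd z) + e * h (snd z)\<bar> powr r * k z)
        has_real_derivative r * F z + r * F (snd z, fst z)) (at 0)"
    proof (intro always_eventually allI)
      fix z :: "'a \<times> 'a"
      have "((\<lambda>e. \<bar>u (fst z) + e * h (fst z)\<bar> powr r * \<bar>u (snd z) + e * h (snd z)\<bar> powr r * k z)
        has_real_derivative (r * D (fst z) * \<bar>u (snd z) + 0 * h (snd z)\<bar> powr r + r * D (snd z) * \<bar>u (fst z) + 0 * h (fst z)\<bar> powr r) * k z) (at 0)"
        by (intro DERIV_cmult_right DERIV_mult d)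
      moreover have "k (snd z, fst z) = k z" using k_sym[of "snd z" "fst z"] by simp
      ultimately show "((\<lambda>e. \<bar>u (fst z) + e * h (fst z)\<bar> powr r * \<bar>u (snd z) + e * h (snd z)\<bar> powr r * k z)
        has_real_derivative r * F z + r * F (snd z, fst z)) (at 0)"
        by (simp add: F_def algebra_simps)
    qed
    show "AE z in lborel. \<bar>\<bar>u (fst z) + e * h (fst z)\<bar> powr r * \<bar>u (snd z) + e * h (snd z)\<bar> powr r * k z
        - \<bar>u (fst z) + 0 * h (fst z)\<bar> powr r * \<bar>u (snd z) + 0 * h (snd z)\<bar> powr r * k z\<bar>
        \<le> \<bar>e\<bar> * (2 * r * (b (fst z) powr r * b (snd z) powr r * k z))" if e: "\<bar>e\<bar> \<le> 1" for e
    proof (intro always_eventually allI)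
      fix z :: "'a \<times> 'a"
      define x y where "x = fst z" and "y = snd z"
      define fx fy gx gy where "fx = \<bar>u x + e * h x\<bar> powr r" and "fy = \<bar>u y + e * h y\<bar> powr r"
        and "gx = \<bar>u x\<bar> powr r" and "gy = \<bar>u y\<bar> powr r"
      have "\<bar>fx - gx\<bar> \<le> \<bar>e\<bar> * (r * b x powr r)" "\<bar>fy - gy\<bar> \<le> \<bar>e\<bar> * (r * b y powr r)"
        unfolding fx_def fy_def gx_def gy_def b_def by (intro abs_powr_increment r e)+
      moreover have "fy \<le> b y powr r" "gx \<le> b x powr r" "0 \<le> fy" "0 \<le> gx"
        unfolding fy_def gx_def using ub[OF e] ub0 by auto
      ultimately have "\<bar>fx - gx\<bar> * fy + gx * \<bar>fy - gy\<bar> \<le> \<bar>e\<bar> * (r * b x powr r) * b y powr r + b x powr r * (\<bar>e\<bar> * (r * b y powr r))"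
        using r by (intro add_mono mult_mono) auto
      moreover have "\<bar>fx * fy - gx * gy\<bar> \<le> \<bar>fx - gx\<bar> * fy + gx * \<bar>fy - gy\<bar>"
      proof -
        have "fx * fy - gx * gy = (fx - gx) * fy + gx * (fy - gy)" by (simp add: algebra_simps)
        then have "\<bar>fx * fy - gx * gy\<bar> \<le> \<bar>(fx - gx) * fy\<bar> + \<bar>gx * (fy - gy)\<bar>" by linarith
        then show ?thesis using \<open>0 \<le> fy\<close> \<open>0 \<le> gx\<close> by (simp add: abs_mult)
      qed
      ultimately have "\<bar>fx * fy - gx * gy\<bar> \<le> \<bar>e\<bar> * (2 * r * (b x powr r * b y powr r))" by (simp add: algebra_simps)
      then have "\<bar>fx * fy - gx * gy\<bar> * k z \<le> \<bar>e\<bar> * (2 * r * (b x powr r * b y powr r)) * k z"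
        using k0 by (rule mult_right_mono)
      moreover have "\<bar>fx * fy * k z - gx * gy * k z\<bar> = \<bar>fx * fy - gx * gy\<bar> * k z"
        using k0[of z] by (simp add: abs_mult flip: left_diff_distrib)
      ultimately show "\<bar>\<bar>u (fst z) + e * h (fst z)\<bar> powr r * \<bar>u (snd z) + e * h (snd z)\<bar> powr r * k z
        - \<bar>u (fst z) + 0 * h (fst z)\<bar> powr r * \<bar>u (snd z) + 0 * h (snd z)\<bar> powr r * k z\<bar>
        \<le> \<bar>e\<bar> * (2 * r * (b (fst z) powr r * b (snd z) powr r * k z))"
        unfolding fx_def fy_def gx_def gy_def x_def y_def by (simp add: mult_ac)
    qed
    show "integrable lborel (\<lambda>z. 2 * r * (b (fst z) powr r * b (snd z) powr r * k z))"
      using bint by simp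
  qed
  moreover have "(\<integral>z. r * F z + r * F (snd z, fst z) \<partial>lborel) = 2 * r * A' u h"
  proof -
    have "(\<integral>z. r * F z + r * F (snd z, fst z) \<partial>lborel) = r * (\<integral>z. F z \<partial>lborel) + r * (\<integral>z. F z \<partial>lborel)"
      using i1 swap_int by (simp add: swap F_def[abs_def, symmetric])
    moreover have "(\<integral>z. F z \<partial>lborel) = A' u h" by (simp add: A'_def F_def D_def k_def)
    ultimately show ?thesis by simp
  qed
  ultimately show ?thesis by simp
qed

text \<open>The kernel is positive off the diagonal. If the double integral vanishes, then for
  almost every \<open>x\<close> with \<open>u x \<noteq> 0\<close> the function must vanish at
  almost every \<open>y\<close>.\<close>

lemma AE_zero_of_A_zero:
  assumes u: "u \<in> X" and A0: "A u = 0" shows "AE x in lborel. u x = 0"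
proof (rule ccontr)
  assume not0: "\<not> (AE x in lborel. u x = 0)"
  have [measurable]: "u \<in> borel_measurable borel" using u XD by auto
  define f where "f z = \<bar>u (fst z)\<bar> powr r * \<bar>u (snd z)\<bar> powr r * choquard_kernel z" for z
  have [measurable]: "f \<in> borel_measurable borel" unfolding f_def[abs_def] by measurable
  have f0: "0 \<le> f z" for z by (simp add: f_def choquard_kernel_def)
  have "integrable lborel f" using A_integrable[OF u] by (simp add: f_def[abs_def])
  then have "(\<integral>\<^sup>+z. ennreal (f z) \<partial>lborel) = ennreal (A u)"
    unfolding A_def f_def[symmetric] using f0 by (intro nn_integral_eq_integral) auto
  then have "(\<integral>\<^sup>+x. \<integral>\<^sup>+y. ennreal (f (x, y)) \<partial>lborel \<partial>lborel) = 0"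
    using nn_integral_lborel_pair(1)[of "\<lambda>z. ennreal (f z)"] A0 by simp
  moreover have "(\<lambda>x. \<integral>\<^sup>+y. ennreal (f (x, y)) \<partial>lborel) \<in> borel_measurable lborel"
  proof -
    have "(\<lambda>z. ennreal (f z)) \<in> borel_measurable (lborel \<Otimes>\<^sub>M lborel)" by (simp add: lborel_prod)
    from lborel.borel_measurable_nn_integral_fst[OF this] show ?thesis .
  qed
  ultimately have "AE x in lborel. (\<integral>\<^sup>+y. ennreal (f (x, y)) \<partial>lborel) = 0"
    by (simp add: nn_integral_0_iff_AE)
  then have "AE x in lborel. u x = 0"
  proof eventually_elim
    case (elim x)
    show ?case
    proof (rule ccontr)
      assume ux: "u x \<noteq> 0"
      have "(\<lambda>y. ennreal (f (x, y))) \<in> borel_measurable lborel"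
        unfolding f_def choquard_kernel_def fst_conv snd_conv by measurable
      then have "AE y in lborel. ennreal (f (x, y)) = 0" using elim by (simp add: nn_integral_0_iff_AE)
      \<comment> \<open>The point \<open>y = x\<close> has to be excluded: there the kernel is
        \<open>0 powr (- \<mu>)\<close>, which is 0 by convention.\<close>
      then have "AE y in lborel. u y = 0" using AE_lborel_singleton[of x]
      proof eventually_elim
        case (elim y)
        then have "f (x, y) = 0" using f0[of "(x, y)"] by simp
        then show ?case using ux elim(2) by (auto simp: f_def choquard_kernel_def)
      qed
      then show False using not0 by blast
    qed
  qed
  then show False using not0 by blast
qed

lemma gform_zero: assumes "AE x in lborel. u x = 0" shows "gform t s u = 0"
proof -
  have "AE z in lborel. gagliardo_density t s u z = 0"
    using AE_lborel_fst_snd(1)[OF assms, where 'b = 'a] AE_lborel_fst_snd(2)[OF assms, where 'b = 'a]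
    by eventually_elim (simp add: gagliardo_density_def)
  then show ?thesis unfolding gform_def using integral_eq_zero_AE by blast
qed

lemma A_pos: assumes "u \<in> X" "0 < gform 2 s1 u" shows "0 < A u"
  using A_nonneg[of u] AE_zero_of_A_zero[OF assms(1)] gform_zero[of u 2 s1] assms(2) by (cases "A u = 0") auto

lemma functionals_continuous:
  assumes v: "\<And>n. v n \<in> X" and w: "w \<in> X" and W: "integrable lborel W"
    and lim: "AE x in lborel. (\<lambda>n. v n x) \<longlonglongrightarrow> w x"
    and dom: "AE x in lborel. \<forall>n. \<bar>v n x\<bar> powr \<sigma> \<le> W x"
  shows "(\<lambda>n. H (v n)) \<longlonglongrightarrow> H w" "(\<lambda>n. A (v n)) \<longlonglongrightarrow> A w"
proof -
  have [measurable]: "v n \<in> borel_measurable borel" "w \<in> borel_measurable borel" "W \<in> borel_measurable borel" for n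
    using v w XD borel_measurable_integrable[OF W] by auto
  \<comment> \<open>The indicator compensates for lower exponents: on \<Omega> every power between 0
    and \<sigma> is at most 1 plus the power \<sigma>, so the same \<open>g\<close> serves
    \<open>d\<close> and \<open>r * m\<close>.\<close>
  define g where "g x = indicator \<Omega> x + \<bar>W x\<bar>" for x
  have i\<Omega>: "integrable lborel (indicator \<Omega> :: 'a \<Rightarrow> real)"
    using emeasure_bounded_finite[OF \<Omega>(1)] by (simp add: integrable_indicator_iff)
  have g: "integrable lborel g" "\<And>x. 0 \<le> g x"
    unfolding g_def[abs_def] by (intro Bochner_Integration.integrable_add integrable_abs i\<Omega> W) simp
  have le: "AE x in lborel. \<forall>n. \<bar>v n x\<bar> powr t \<le> g x" if t: "0 < t" "t \<le> \<sigma>" for t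
    using dom
  proof eventually_elim
    case (elim x)
    show ?case
    proof
      fix n
      show "\<bar>v n x\<bar> powr t \<le> g x"
      proof (cases "x \<in> \<Omega>")
        case True
        have "\<bar>v n x\<bar> powr t \<le> 1 + \<bar>v n x\<bar> powr \<sigma>" using t by (intro powr_le_one_plus) auto
        also have "\<dots> \<le> g x" using elim[rule_format, of n] True by (simp add: g_def)
        finally show ?thesis .
      qed (use XD(4)[OF v] t g in simp)
    qed
  qed
  show "(\<lambda>n. H (v n)) \<longlonglongrightarrow> H w"
    unfolding H_def
  proof (rule integral_dominated_convergence[where w = "\<lambda>x. g x + \<bar>a x\<bar> powr (d / (d - q))"])
    show "integrable lborel (\<lambda>x. g x + \<bar>a x\<bar> powr (d / (d - q)))" using g a_int by auto
    show "AE x in lborel. (\<lambda>n. \<bar>v n x\<bar> powr q * a x) \<longlonglongrightarrow> \<bar>w x\<bar> powr q * a x"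
      using lim by eventually_elim (intro tendsto_mult tendsto_powr' tendsto_rabs tendsto_const, use pq in auto)
    have "AE x in lborel. \<forall>n. \<bar>v n x\<bar> powr d \<le> g x" using le[of d] d pq \<sigma> by auto
    then show "AE x in lborel. norm (\<bar>v n x\<bar> powr q * a x) \<le> g x + \<bar>a x\<bar> powr (d / (d - q))" for n
    proof eventually_elim
      case (elim x)
      show ?case using weight_young[of "\<bar>v n x\<bar>" x] elim[rule_format, of n] by (simp add: abs_mult)
    qed
  qed measurable
  have leA: "AE x in lborel. \<forall>n. \<bar>v n x\<bar> powr (r * m) \<le> g x" using le[of "r * m"] choquard_exponent \<sigma> by auto
  show "(\<lambda>n. A (v n)) \<longlonglongrightarrow> A w"
    unfolding A_def
  proof (rule integral_dominated_convergence[where w = "choquard_dom g"])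
    show "integrable lborel (choquard_dom g)" by (rule choquard_dom_integrable[OF g])
    show "AE z in lborel. (\<lambda>n. \<bar>v n (fst z)\<bar> powr r * \<bar>v n (snd z)\<bar> powr r * choquard_kernel z)
       \<longlonglongrightarrow> \<bar>w (fst z)\<bar> powr r * \<bar>w (snd z)\<bar> powr r * choquard_kernel z"
      using AE_lborel_fst_snd(1)[OF lim, where 'b = 'a] AE_lborel_fst_snd(2)[OF lim, where 'b = 'a]
      by eventually_elim (intro tendsto_mult tendsto_powr' tendsto_rabs tendsto_const, use r in auto)
    show "AE z in lborel. norm (\<bar>v n (fst z)\<bar> powr r * \<bar>v n (snd z)\<bar> powr r * choquard_kernel z) \<le> choquard_dom g z" for n
    proof -
      have "AE x in lborel. \<bar>v n x\<bar> powr (r * m) \<le> g x" using leA by eventually_elim simp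
      from choquard_integrable(1)[OF _ _ g this] show ?thesis
        using XD(4)[OF v] by (simp add: choquard_kernel_def)
    qed
  qed measurable
qed

text \<open>Almost everywhere convergence and Fatou's lemma give the lower semicontinuity usually
  taken from weak convergence; membership of the limit in \<open>X\<close> comes from the same
  inequality.\<close>

lemma gform_weak_limit:
  assumes v: "\<And>n. v n \<in> X" and w: "w \<in> bsupp \<Omega>"
    and lim: "AE x in lborel. (\<lambda>n. v n x) \<longlonglongrightarrow> w x"
    and K: "(\<lambda>n. gform 2 s1 (v n)) \<longlonglongrightarrow> \<kappa>" and P: "(\<lambda>n. gform p s2 (v n)) \<longlonglongrightarrow> \<pi>"
  shows "w \<in> X" "gform 2 s1 w \<le> \<kappa>" "gform p s2 w \<le> \<pi>"
proof -
  have bound: "gagliardo t s w \<le> ennreal l" if "0 < t" "(\<lambda>n. gform t s (v n)) \<longlonglongrightarrow> l" "\<And>n. gagliardo t s (v n) = ennreal (gform t s (v n))" for t s l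
  proof -
    have "gagliardo t s w \<le> liminf (\<lambda>n. gagliardo t s (v n))"
      using that v XD lim by (intro gagliardo_fatou) auto
    also have "\<dots> = ennreal l"
      unfolding that(3) by (intro lim_imp_Liminf tendsto_ennrealI that(2)) simp
    finally show ?thesis .
  qed
  have K1: "gagliardo 2 s1 w \<le> ennreal \<kappa>" by (rule bound[OF _ K]) (use X_gagliardo(1)[OF v] in auto)
  then show wX: "w \<in> X" using w by (auto simp: X_def order_le_less_trans[OF _ ennreal_less_top])
  have P1: "gagliardo p s2 w \<le> ennreal \<pi>" by (rule bound[OF _ P]) (use X_gagliardo(2)[OF v] pq in auto)
  have "0 \<le> \<kappa>" "0 \<le> \<pi>" using LIMSEQ_le_const[OF K] LIMSEQ_le_const[OF P] gform_nonneg by blast+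
  then show "gform 2 s1 w \<le> \<kappa>" "gform p s2 w \<le> \<pi>"
    using K1 P1 X_gagliardo(1,2)[OF wX] by simp_all
qed

text \<open>Three nested subsequences: \<open>k1\<close> makes both seminorms converge,
  \<open>k2\<close> gives the Cauchy property for exponent \<sigma>, and \<open>j\<close> gives
  dominated convergence almost everywhere.\<close>

lemma compactness:
  assumes U: "\<And>n. U n \<in> X" "\<And>n x. 0 \<le> U n x" "\<And>n. gform 2 s1 (U n) \<le> M"
  shows "\<exists>k w \<kappa> \<pi>. strict_mono (k :: nat \<Rightarrow> nat) \<and> w \<in> X \<and> (\<forall>x. 0 \<le> w x) \<and>
    (\<lambda>n. gform 2 s1 (U (k n))) \<longlonglongrightarrow> \<kappa> \<and> (\<lambda>n. gform p s2 (U (k n))) \<longlonglongrightarrow> \<pi> \<and>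
    (\<lambda>n. H (U (k n))) \<longlonglongrightarrow> H w \<and> (\<lambda>n. A (U (k n))) \<longlonglongrightarrow> A w \<and>
    gform 2 s1 w \<le> \<kappa> \<and> gform p s2 w \<le> \<pi>"
proof -
  have M: "0 \<le> M" using U(3)[of 0] gform_nonneg[of 2 s1 "U 0"] by linarith
  have UM: "gagliardo 2 s1 (U n) \<le> ennreal M" for n using U X_gagliardo(1)[OF U(1)] by (simp add: ennreal_leI)
  obtain C where C: "C > 0" "\<And>n. gagliardo p s2 (U n) \<le> ennreal C"
    using gagliardo_embedding[OF \<Omega>(1) \<Omega>_borel s(1,2,4), of p M] pq UM XD(1)[OF U(1)] by auto
  have "gform p s2 (U n) \<le> C" for n using C(1) C(2)[of n, unfolded X_gagliardo(2)[OF U(1)]] by simp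
  then have "bounded (range (\<lambda>n. (gform 2 s1 (U n), gform p s2 (U n))))"
    using U(3) gform_nonneg by (intro bounded_subset[OF bounded_Times[OF bounded_closed_interval[of 0 M] bounded_closed_interval[of 0 C]]]) auto
  from bounded_imp_convergent_subsequence[OF this] obtain l k1 where k1: "strict_mono (k1 :: nat \<Rightarrow> nat)"
    and l: "((\<lambda>n. (gform 2 s1 (U n), gform p s2 (U n))) \<circ> k1) \<longlonglongrightarrow> l" by blast
  have lK: "(\<lambda>n. gform 2 s1 (U (k1 n))) \<longlonglongrightarrow> fst l" and lP: "(\<lambda>n. gform p s2 (U (k1 n))) \<longlonglongrightarrow> snd l"
    using tendsto_fst[OF l] tendsto_snd[OF l] by (simp_all add: o_def)
  have s1: "0 < s1" using s by simp
  obtain k2 :: "nat \<Rightarrow> nat" where k2: "strict_mono k2" and cauchy: "\<forall>e>0. \<exists>n0. \<forall>n\<ge>n0. \<forall>m\<ge>n0.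
      (\<integral>\<^sup>+x. ennreal (\<bar>U (k1 (k2 n)) x - U (k1 (k2 m)) x\<bar> powr \<sigma>) \<partial>lborel) \<le> ennreal e"
    using fractional_rellich[OF \<Omega>(1) \<Omega>_borel s1 s(4) \<sigma>(1,2), of "\<lambda>n. U (k1 n)", OF XD(1)[OF U(1)] UM M] by blast
  define v where "v n = U (k1 (k2 n))" for n
  have vX: "v n \<in> X" for n using U by (simp add: v_def)
  have ex: "\<exists>j w W. strict_mono (j :: nat \<Rightarrow> nat) \<and> w \<in> borel_measurable borel \<and> integrable lborel W \<and>
    (AE x in lborel. (\<lambda>n. v (j n) x) \<longlonglongrightarrow> w x) \<and>
    (AE x in lborel. \<forall>n. \<bar>v (j n) x\<bar> powr \<sigma> \<le> W x) \<and> (AE x in lborel. \<bar>w x\<bar> powr \<sigma> \<le> W x) \<and>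
    (\<forall>x. w x = (if Cauchy (\<lambda>n. v (j n) x) then lim (\<lambda>n. v (j n) x) else 0))"
  proof (rule Lp_cauchy_dominated_subsequence)
    show "v n \<in> borel_measurable borel" for n using XD(2)[OF vX] .
    show "integrable lborel (\<lambda>x. \<bar>v n x\<bar> powr \<sigma>)" for n using X_integrable[OF vX] \<sigma> by simp
    show "\<exists>n0. \<forall>n\<ge>n0. \<forall>m\<ge>n0. (\<integral>\<^sup>+x. ennreal (\<bar>v n x - v m x\<bar> powr \<sigma>) \<partial>lborel) \<le> ennreal e" if "e > 0" for e
      using cauchy that unfolding v_def by blast
  qed (use \<sigma> in simp)
  then obtain j w W where j: "strict_mono (j :: nat \<Rightarrow> nat)" and wm: "w \<in> borel_measurable borel" and W: "integrable lborel W"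
    and lim: "AE x in lborel. (\<lambda>n. v (j n) x) \<longlonglongrightarrow> w x"
    and dom: "AE x in lborel. \<forall>n. \<bar>v (j n) x\<bar> powr \<sigma> \<le> W x"
    and wdef: "\<forall>x. w x = (if Cauchy (\<lambda>n. v (j n) x) then lim (\<lambda>n. v (j n) x) else 0)"
    by (elim exE conjE) (rule that)
  \<comment> \<open>Off \<Omega> the sequence is constantly 0, hence Cauchy with limit 0.\<close>
  have wb: "w \<in> bsupp \<Omega>"
    using wm wdef XD(4)[OF vX] by (auto simp: bsupp_def)
  have w0: "0 \<le> w x" for x
  proof (cases "Cauchy (\<lambda>n. v (j n) x)")
    case True
    then have "(\<lambda>n. v (j n) x) \<longlonglongrightarrow> lim (\<lambda>n. v (j n) x)" by (simp add: Cauchy_convergent_iff convergent_LIMSEQ_iff)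
    then have "0 \<le> lim (\<lambda>n. v (j n) x)" by (rule LIMSEQ_le_const) (use U(2) in \<open>auto simp: v_def\<close>)
    then show ?thesis using wdef True by simp
  qed (use wdef in simp)
  have k: "strict_mono (k1 \<circ> (k2 \<circ> j))" using k1 k2 j by (simp add: strict_mono_o)
  have k2j: "strict_mono (k2 \<circ> j)" using k2 j by (simp add: strict_mono_o)
  have lK': "(\<lambda>n. gform 2 s1 (v (j n))) \<longlonglongrightarrow> fst l" and lP': "(\<lambda>n. gform p s2 (v (j n))) \<longlonglongrightarrow> snd l"
    using LIMSEQ_subseq_LIMSEQ[OF lK k2j] LIMSEQ_subseq_LIMSEQ[OF lP k2j] by (simp_all add: v_def o_def)
  note wX = gform_weak_limit[OF vX wb lim lK' lP']
  have "(\<lambda>n. H (v (j n))) \<longlonglongrightarrow> H w" "(\<lambda>n. A (v (j n))) \<longlonglongrightarrow> A w"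
    using functionals_continuous[OF vX wX(1) W lim dom] by auto
  then show ?thesis
    using k wX w0 lK' lP' unfolding v_def
    by (intro exI[of _ "k1 \<circ> (k2 \<circ> j)"] exI[of _ w] exI[of _ "fst l"] exI[of _ "snd l"]) simp
qed

lemma H_abs: "H (\<lambda>x. \<bar>u x\<bar>) = H u" by (simp add: H_def)

lemma A_abs: "A (\<lambda>x. \<bar>u x\<bar>) = A u" by (simp add: A_def)

text \<open>If no constant worked, some sequence in the unit ball would have unbounded
  \<open>H\<close> or \<open>A\<close> along every subsequence, against \<open>compactness\<close>.
  Absolute values are taken because \<open>compactness\<close> is about nonnegative functions; they
  change neither \<open>H\<close> nor \<open>A\<close>.\<close>

lemma unit_bounds: "\<exists>C>0. \<forall>u\<in>X. gform 2 s1 u \<le> 1 \<longrightarrow> \<bar>H u\<bar> \<le> C \<and> \<bar>A u\<bar> \<le> C"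
proof (rule ccontr)
  assume "\<not> ?thesis"
  then have "\<exists>u\<in>X. gform 2 s1 u \<le> 1 \<and> \<not> (\<bar>H u\<bar> \<le> real (Suc n) \<and> \<bar>A u\<bar> \<le> real (Suc n))" for n
    by (metis of_nat_0_less_iff zero_less_Suc)
  then obtain u where u: "\<And>n. u n \<in> X" "\<And>n. gform 2 s1 (u n) \<le> 1" "\<And>n. \<not> (\<bar>H (u n)\<bar> \<le> real (Suc n) \<and> \<bar>A (u n)\<bar> \<le> real (Suc n))"
    by metis
  define U where "U n = (\<lambda>x. \<bar>u n x\<bar>)" for n
  have U: "U n \<in> X" "0 \<le> U n x" "gform 2 s1 (U n) \<le> 1" for n x
    using X_abs[OF u(1)] gform_abs(1)[OF u(1), of n] u(2)[of n] by (auto simp: U_def)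
  obtain k w where k: "strict_mono (k :: nat \<Rightarrow> nat)" and lim: "(\<lambda>n. H (U (k n))) \<longlonglongrightarrow> H w" "(\<lambda>n. A (U (k n))) \<longlonglongrightarrow> A w"
    using compactness[of U 1, OF U] by blast
  have "(\<lambda>n. max \<bar>H (U (k n))\<bar> \<bar>A (U (k n))\<bar>) \<longlonglongrightarrow> max \<bar>H w\<bar> \<bar>A w\<bar>"
    by (intro tendsto_max tendsto_rabs lim)
  then have "Bseq (\<lambda>n. max \<bar>H (U (k n))\<bar> \<bar>A (U (k n))\<bar>)"
    by (rule convergent_imp_Bseq[OF convergentI])
  then obtain B where B: "\<forall>n. norm (max \<bar>H (U (k n))\<bar> \<bar>A (U (k n))\<bar>) \<le> B" by (rule BseqE)
  obtain n where n: "B < real n" using reals_Archimedean2 by blast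
  have "n \<le> k n" using seq_suble[OF k] .
  then have "B \<le> real (Suc (k n))" using n by simp
  moreover have "max \<bar>H (U (k n))\<bar> \<bar>A (U (k n))\<bar> \<le> B" using B[rule_format, of n] by simp
  ultimately show False using u(3)[of "k n"] by (simp add: U_def H_abs A_abs)
qed

text \<open>Near the diagonal the squared Lipschitz bound lowers the kernel exponent to
  \<open>n + 2 * s1 - 2\<close>, which is below \<open>n\<close> because \<open>s1 < 1\<close>; far
  away the difference is at most 1 and the kernel is integrable.\<close>

lemma lipschitz_in_X:
  assumes lip: "\<And>x y. \<bar>u x - u y\<bar> \<le> L * norm (x - y)" and bd: "\<And>x. 0 \<le> u x" "\<And>x. u x \<le> 1"
    and off: "\<And>x. x \<notin> \<Omega> \<Longrightarrow> u x = 0" and L: "0 \<le> L" and [measurable]: "u \<in> borel_measurable borel"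
  shows "u \<in> X"
proof -
  define \<alpha> where "\<alpha> = real DIM('a) + 2 * s1"
  define kn where "kn z = ennreal (norm z powr (- (\<alpha> - 2))) * indicator (cball 0 1) z" for z :: 'a
  define kf where "kf z = ennreal (norm z powr (- \<alpha>)) * indicator (- ball 0 1) z" for z :: 'a
  define k where "k z = ennreal (L\<^sup>2) * kn z + kf z" for z
  have [measurable]: "kn \<in> borel_measurable borel" "kf \<in> borel_measurable borel"
    unfolding kn_def[abs_def] kf_def[abs_def] by measurable
  have [measurable]: "k \<in> borel_measurable borel" unfolding k_def[abs_def] by measurable
  have kn: "(\<integral>\<^sup>+z. kn z \<partial>lborel) < \<infinity>" unfolding kn_def \<alpha>_def using s by (intro nn_integral_kernel_near) auto
  have kf: "(\<integral>\<^sup>+z. kf z \<partial>lborel) < \<infinity>" unfolding kf_def \<alpha>_def using s by (intro nn_integral_kernel_far) auto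
  have "(\<integral>\<^sup>+z. k z \<partial>lborel) = ennreal (L\<^sup>2) * (\<integral>\<^sup>+z. kn z \<partial>lborel) + (\<integral>\<^sup>+z. kf z \<partial>lborel)"
    unfolding k_def by (simp add: nn_integral_add nn_integral_cmult)
  then have kfin: "(\<integral>\<^sup>+z. k z \<partial>lborel) < \<infinity>" using kn kf by (simp add: ennreal_mult_less_top)
  have pw: "ennreal (gagliardo_density 2 s1 u z) \<le> indicator \<Omega> (fst z) * k (fst z - snd z) + indicator \<Omega> (snd z) * k (fst z - snd z)" for z
  proof -
    obtain x y where z: "z = (x, y)" by (cases z)
    show ?thesis
    proof (cases "(x \<in> \<Omega> \<or> y \<in> \<Omega>) \<and> x \<noteq> y")
      case True
      have den: "gagliardo_density 2 s1 u z = \<bar>u x - u y\<bar> powr 2 * norm (x - y) powr (- \<alpha>)"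
        by (simp add: gagliardo_density_def z \<alpha>_def del: powr_numeral)
      have "ennreal (gagliardo_density 2 s1 u z) \<le> k (x - y)"
      proof (cases "norm (x - y) \<le> 1")
        case n: True
        have "\<bar>u x - u y\<bar> powr 2 \<le> (L * norm (x - y)) powr 2" using lip by (intro powr_mono2) auto
        also have "\<dots> = L\<^sup>2 * norm (x - y) powr 2" using L by (simp add: power_mult_distrib)
        finally have "gagliardo_density 2 s1 u z \<le> L\<^sup>2 * norm (x - y) powr 2 * norm (x - y) powr (- \<alpha>)"
          unfolding den by (intro mult_right_mono) auto
        also have "\<dots> = L\<^sup>2 * norm (x - y) powr (- (\<alpha> - 2))" by (simp add: mult.assoc flip: powr_add del: powr_numeral)
        finally have "ennreal (gagliardo_density 2 s1 u z) \<le> ennreal (L\<^sup>2) * kn (x - y)"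
          using n by (simp add: kn_def ennreal_leI flip: ennreal_mult)
        then show ?thesis by (simp add: k_def add_increasing2)
      next
        case f: False
        have "\<bar>u x - u y\<bar> \<le> 1" using bd[of x] bd[of y] by auto
        then have "\<bar>u x - u y\<bar> powr 2 \<le> 1" using powr_mono2[of 2 "\<bar>u x - u y\<bar>" 1] by (simp del: powr_numeral)
        then have "gagliardo_density 2 s1 u z \<le> 1 * norm (x - y) powr (- \<alpha>)"
          unfolding den by (intro mult_right_mono) auto
        then have "ennreal (gagliardo_density 2 s1 u z) \<le> kf (x - y)" using f by (simp add: kf_def ennreal_leI)
        then show ?thesis by (simp add: k_def add_increasing)
      qed
      also have "k (x - y) \<le> indicator \<Omega> x * k (x - y) + indicator \<Omega> y * k (x - y)"
        using True by (auto split: split_indicator)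
      finally show ?thesis by (simp add: z)
    next
      case False
      then have "gagliardo_density 2 s1 u z = 0" using off by (auto simp: gagliardo_density_def z)
      then show ?thesis by simp
    qed
  qed
  have "gagliardo 2 s1 u \<le> (\<integral>\<^sup>+z. indicator \<Omega> (fst z) * k (fst z - snd z) + indicator \<Omega> (snd z) * k (fst z - snd z) \<partial>lborel)"
    unfolding gagliardo_def by (intro nn_integral_mono pw)
  also have "\<dots> = (\<integral>\<^sup>+z. indicator \<Omega> (fst z) * k (fst z - snd z) \<partial>lborel) + (\<integral>\<^sup>+z. indicator \<Omega> (snd z) * k (fst z - snd z) \<partial>lborel)"
    by (rule nn_integral_add) measurable
  also have "\<dots> = emeasure lborel \<Omega> * (\<integral>\<^sup>+z. k z \<partial>lborel) + emeasure lborel \<Omega> * (\<integral>\<^sup>+z. k z \<partial>lborel)"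
    by (subst nn_integral_convolution(1), simp, simp, subst nn_integral_convolution(2), simp_all)
  also have "\<dots> < \<infinity>" using kfin emeasure_bounded_finite[OF \<Omega>(1)] by (simp add: ennreal_mult_less_top)
  finally show ?thesis using off by (simp add: X_def bsupp_def)
qed

lemma a_integrable: "integrable lborel a"
proof (rule Bochner_Integration.integrable_bound)
  have i\<Omega>: "integrable lborel (indicator \<Omega> :: 'a \<Rightarrow> real)"
    using emeasure_bounded_finite[OF \<Omega>(1)] by (simp add: integrable_indicator_iff)
  show "integrable lborel (\<lambda>x. indicator \<Omega> x + \<bar>a x\<bar> powr (d / (d - q)))"
    by (intro Bochner_Integration.integrable_add i\<Omega> a_int)
  have "\<bar>a x\<bar> \<le> indicator \<Omega> x + \<bar>a x\<bar> powr (d / (d - q))" for x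
  proof (cases "x \<in> \<Omega>")
    case True
    have "1 \<le> d / (d - q)" using d pq by (simp add: field_simps)
    then show ?thesis using powr_le_one_plus[of "\<bar>a x\<bar>" 1 "d / (d - q)"] True by simp
  qed (simp add: a_off)
  then show "AE x in lborel. norm (a x) \<le> norm (indicator \<Omega> x + \<bar>a x\<bar> powr (d / (d - q)))" by simp
qed measurable

text \<open>
  Otherwise \<open>\<integral>\<^sub>T a \<le> 0\<close> for every open \<open>T \<subseteq> \<Omega>\<close>, by testing with Lipschitz functions increasing to the
  indicator of \<open>T\<close>, and hence, by outer regularity, also for \<open>T = {a > 0}\<close>.
\<close>
lemma H_pos: "\<exists>u\<in>X. 0 < H u"
proof (rule ccontr)
  assume "\<not> ?thesis"
  then have neg: "H u \<le> 0" if "u \<in> X" for u using that by force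
  have opn: "(\<integral>x. indicator T x * a x \<partial>lborel) \<le> 0" if T: "open T" "T \<subseteq> \<Omega>" for T
  proof -
    have [measurable]: "T \<in> sets borel" using T by simp
    have "T \<noteq> UNIV" using T \<Omega>(1) by (metis not_bounded_UNIV bounded_subset)
    then have ne: "- T \<noteq> {}" by auto
    have cl: "closed (- T)" using T by (simp add: closed_Compl)
    define u where "u n x = min 1 (real n * infdist x (- T))" for n :: nat and x
    have [measurable]: "u n \<in> borel_measurable borel" for n
      unfolding u_def[abs_def] by (intro borel_measurable_continuous_onI continuous_intros)
    have u1: "0 \<le> u n x" "u n x \<le> 1" for n x by (auto simp: u_def infdist_nonneg)
    have off: "u n x = 0" if "x \<notin> T" for n x using that by (simp add: u_def)
    have "u n \<in> X" for n
    proof (rule lipschitz_in_X[where L = "real n"])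
      fix x y
      have "\<bar>real n * infdist x (- T) - real n * infdist y (- T)\<bar> \<le> real n * norm (x - y)"
        using infdist_triangle_abs[of x "- T" y]
        by (simp add: abs_mult dist_norm mult_left_mono flip: right_diff_distrib)
      then show "\<bar>u n x - u n y\<bar> \<le> real n * norm (x - y)" unfolding u_def by (simp add: min_def split: if_splits) linarith
      show "u n x = 0" if "x \<notin> \<Omega>" for x using off that T(2) by blast
    qed (use u1 in auto)
    then have Hn: "H (u n) \<le> 0" for n by (rule neg)
    have "(\<lambda>n. H (u n)) \<longlonglongrightarrow> (\<integral>x. indicator T x * a x \<partial>lborel)"
      unfolding H_def
    proof (rule integral_dominated_convergence[where w = "\<lambda>x. \<bar>a x\<bar>"])
      show "integrable lborel (\<lambda>x. \<bar>a x\<bar>)" using a_integrable by simp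
      show "AE x in lborel. (\<lambda>n. \<bar>u n x\<bar> powr q * a x) \<longlonglongrightarrow> indicator T x * a x"
      proof (intro always_eventually allI)
        fix x
        show "(\<lambda>n. \<bar>u n x\<bar> powr q * a x) \<longlonglongrightarrow> indicator T x * a x"
        proof (cases "x \<in> T")
          case True
          then have "0 < infdist x (- T)" using infdist_pos_not_in_closed[OF cl ne] by simp
          then obtain n0 :: nat where n0: "1 < real n0 * infdist x (- T)" using ex_less_of_nat_mult by blast
          have "eventually (\<lambda>n. \<bar>u n x\<bar> powr q * a x = indicator T x * a x) sequentially"
            unfolding eventually_sequentially
          proof (intro exI[of _ n0] allI impI)
            fix n assume "n0 \<le> n"
            then have "real n0 * infdist x (- T) \<le> real n * infdist x (- T)"
              by (intro mult_right_mono) (auto simp: infdist_nonneg)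
            then have "u n x = 1" using n0 by (simp add: u_def)
            then show "\<bar>u n x\<bar> powr q * a x = indicator T x * a x" using True by simp
          qed
          then show ?thesis by (rule tendsto_eventually)
        qed (simp add: off)
      qed
      show "AE x in lborel. norm (\<bar>u n x\<bar> powr q * a x) \<le> \<bar>a x\<bar>" for n
      proof (intro always_eventually allI)
        fix x
        have "\<bar>u n x\<bar> powr q \<le> 1" using u1[of n x] pq powr_mono2[of q "\<bar>u n x\<bar>" 1] by simp
        then show "norm (\<bar>u n x\<bar> powr q * a x) \<le> \<bar>a x\<bar>" by (simp add: abs_mult mult_left_le_one_le)
      qed
    qed measurable
    then show ?thesis by (rule LIMSEQ_le_const2) (use Hn in auto)
  qed
  define B where "B = {x. 0 < a x}"
  have B\<Omega>: "B \<subseteq> \<Omega>" using a_off by (force simp: B_def)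
  have [measurable]: "B \<in> sets borel" unfolding B_def by measurable
  have "\<exists>T. open T \<and> B \<subseteq> T \<and> emeasure lborel (T - B) \<le> ennreal ((1/2) ^ n)" for n :: nat
    using outer_regular_lborel_le[of B "(1/2) ^ n"] by (metis \<open>B \<in> sets borel\<close> zero_less_divide_1_iff zero_less_numeral zero_less_power)
  then obtain T where T: "\<And>n::nat. open (T n)" "\<And>n. B \<subseteq> T n" "\<And>n. emeasure lborel (T n - B) \<le> ennreal ((1/2) ^ n)" by metis
  have [measurable]: "T n \<in> sets borel" for n using T by simp
  \<comment> \<open>By Borel-Cantelli: the measures of \<open>T n - B\<close> are summable, so
    almost every point is eventually outside, and the indicators of \<open>T n\<close> and of
    \<open>B\<close> eventually agree there.\<close>
  have "AE x in lborel. eventually (\<lambda>n. x \<in> space lborel - (T n - B)) sequentially"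
  proof (rule borel_cantelli_AE1)
    show fin: "emeasure lborel (T n - B) < \<infinity>" for n using T(3)[of n] by (simp add: order_le_less_trans[OF _ ennreal_less_top])
    have "measure lborel (T n - B) \<le> (1/2) ^ n" for n
      using T(3)[of n] unfolding measure_def by (intro enn2real_leI) auto
    then show "summable (\<lambda>n. measure lborel (T n - B))"
      by (intro summable_comparison_test'[OF summable_geometric[of "1/2::real"], of 0]) auto
  qed measurable
  then have conv: "AE x in lborel. (\<lambda>n. indicator (T n \<inter> \<Omega>) x * a x) \<longlonglongrightarrow> indicator B x * a x"
  proof eventually_elim
    case (elim x)
    then have "eventually (\<lambda>n. indicator (T n \<inter> \<Omega>) x * a x = indicator B x * a x) sequentially"
      by eventually_elim (use T(2) B\<Omega> in \<open>auto split: split_indicator\<close>)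
    then show ?case by (rule tendsto_eventually)
  qed
  have "(\<lambda>n. \<integral>x. indicator (T n \<inter> \<Omega>) x * a x \<partial>lborel) \<longlonglongrightarrow> (\<integral>x. indicator B x * a x \<partial>lborel)"
    by (rule integral_dominated_convergence[where w = "\<lambda>x. \<bar>a x\<bar>", OF _ _ _ conv])
       (use a_integrable in \<open>auto split: split_indicator\<close>)
  moreover have "(\<integral>x. indicator (T n \<inter> \<Omega>) x * a x \<partial>lborel) \<le> 0" for n
    using T(1) \<Omega>(2) by (intro opn) auto
  ultimately have le0: "(\<integral>x. indicator B x * a x \<partial>lborel) \<le> 0" by (intro LIMSEQ_le_const2) auto
  have nn: "0 \<le> indicator B x * a x" for x by (auto simp: B_def split: split_indicator)
  have int: "integrable lborel (\<lambda>x. indicator B x * a x)"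
    by (rule Bochner_Integration.integrable_bound[OF a_integrable]) (auto split: split_indicator)
  have "(\<integral>x. indicator B x * a x \<partial>lborel) = 0"
    using le0 Bochner_Integration.integral_nonneg[of lborel "\<lambda>x. indicator B x * a x"] nn by (simp add: order_antisym)
  then have "AE x in lborel. indicator B x * a x = 0"
    using integral_nonneg_eq_0_iff_AE[OF int] nn by simp
  then have "AE x in lborel. max (a x) 0 = 0"
    by eventually_elim (auto simp: B_def max_def split: split_indicator_asm if_splits)
  then show False using a_pos by blast
qed

lemma fibering: "\<exists>C. fibering X (gform 2 s1) (gform p s2) H A (gform' 2 s1) (gform' p s2) H' A' p q r C"
proof -
  obtain C where C: "C > 0" "\<And>u. u \<in> X \<Longrightarrow> gform 2 s1 u \<le> 1 \<Longrightarrow> \<bar>H u\<bar> \<le> C \<and> \<bar>A u\<bar> \<le> C"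
    using unit_bounds by blast
  have "fibering X (gform 2 s1) (gform p s2) H A (gform' 2 s1) (gform' p s2) H' A' p q r C"
  proof unfold_locales
    show "1 < q" "q < p" "p < 2" "1 < r" using pq r by auto
    show "0 < C" using C by simp
    show "(\<lambda>x. u x + e * h x) \<in> X" if "u \<in> X" "h \<in> X" for u h e using X_line that .
    show "(\<lambda>x. c * u x) \<in> X" if "u \<in> X" for u c using X_scale that .
    show "(\<lambda>x. \<bar>u x\<bar>) \<in> X" if "u \<in> X" for u using X_abs that .
    show "gform 2 s1 (\<lambda>x. c * u x) = c powr 2 * gform 2 s1 u" if "0 < c" for u c using that by (simp add: gform_scale)
    show "gform p s2 (\<lambda>x. c * u x) = c powr p * gform p s2 u" if "0 < c" for u c using that by (simp add: gform_scale)
    show "H (\<lambda>x. c * u x) = c powr q * H u" if "0 < c" for u c using that by (simp add: H_scale)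
    show "A (\<lambda>x. c * u x) = c powr (2 * r) * A u" if "0 < c" for u c using that by (simp add: A_scale)
    show "0 \<le> gform 2 s1 u" "0 \<le> gform p s2 u" for u by (rule gform_nonneg)+
    show "\<bar>H u\<bar> \<le> C" "\<bar>A u\<bar> \<le> C" if "u \<in> X" "gform 2 s1 u \<le> 1" for u using C(2)[OF that] by auto
    show "0 < A u" if "u \<in> X" "0 < gform 2 s1 u" for u using A_pos that .
    show "gform 2 s1 (\<lambda>x. \<bar>u x\<bar>) \<le> gform 2 s1 u" "gform p s2 (\<lambda>x. \<bar>u x\<bar>) \<le> gform p s2 u" if "u \<in> X" for u
      using gform_abs that by auto
    show "H (\<lambda>x. \<bar>u x\<bar>) = H u" "A (\<lambda>x. \<bar>u x\<bar>) = A u" for u by (rule H_abs A_abs)+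
    show "\<exists>u\<in>X. 0 < H u" by (rule H_pos)
    show "\<exists>k w \<kappa> \<pi>. strict_mono (k :: nat \<Rightarrow> nat) \<and> w \<in> X \<and> (\<forall>x. 0 \<le> w x) \<and>
        (\<lambda>n. gform 2 s1 (U (k n))) \<longlonglongrightarrow> \<kappa> \<and> (\<lambda>n. gform p s2 (U (k n))) \<longlonglongrightarrow> \<pi> \<and>
        (\<lambda>n. H (U (k n))) \<longlonglongrightarrow> H w \<and> (\<lambda>n. A (U (k n))) \<longlonglongrightarrow> A w \<and>
        gform 2 s1 w \<le> \<kappa> \<and> gform p s2 w \<le> \<pi>"
      if "\<And>n. U n \<in> X" "\<And>n x. 0 \<le> U n x" "\<And>n. gform 2 s1 (U n) \<le> M" for U M
      by (rule compactness[of U M, OF that])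
    show "((\<lambda>e. gform 2 s1 (\<lambda>x. u x + e * h x)) has_real_derivative 2 * gform' 2 s1 u h) (at 0)"
      "((\<lambda>e. gform p s2 (\<lambda>x. u x + e * h x)) has_real_derivative p * gform' p s2 u h) (at 0)"
      "((\<lambda>e. H (\<lambda>x. u x + e * h x)) has_real_derivative q * H' u h) (at 0)"
      "((\<lambda>e. A (\<lambda>x. u x + e * h x)) has_real_derivative 2 * r * A' u h) (at 0)" if "u \<in> X" "h \<in> X" for u h
      using gform_deriv[OF that] H_deriv[OF that] A_deriv[OF that] by auto
  qed
  then show ?thesis by blast
qed

end

section \<open>Weak solutions\<close>

text \<open>The one bridge between Lebesgue integrals over a set and Borel integrals over the whole
  space. Measurability of \<open>f\<close> is derived: its extension by zero agrees almost
  everywhere with a Borel function, and \<open>lebesgue\<close> is complete.\<close>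

lemma lebesgue_on_eq_lborel:
  fixes f g :: "'a::euclidean_space \<Rightarrow> real"
  assumes S: "S \<in> sets lebesgue" and g: "g \<in> borel_measurable borel"
    and eq: "AE z in lborel. (if z \<in> S then f z else 0) = g z"
  shows "(\<integral>z. f z \<partial>lebesgue_on S) = (\<integral>z. g z \<partial>lborel)"
    and "integrable (lebesgue_on S) f \<longleftrightarrow> integrable lborel g"
proof -
  have gl: "g \<in> borel_measurable lborel" using g by simp
  have glm: "g \<in> borel_measurable lebesgue" using measurable_completion[OF gl] .
  have ind: "indicator S z *\<^sub>R f z = (if z \<in> S then f z else 0)" for z by simp
  have ae: "AE z in lebesgue. g z = (if z \<in> S then f z else 0)"
    using AE_completion[OF eq] by eventually_elim simp
  have fm: "(\<lambda>z. if z \<in> S then f z else 0) \<in> borel_measurable lebesgue"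
    by (rule borel_measurable_AE[OF glm ae])
  have S': "S \<inter> space lebesgue \<in> sets lebesgue" using S by simp
  have "(\<integral>z. f z \<partial>lebesgue_on S) = (\<integral>z. (if z \<in> S then f z else 0) \<partial>lebesgue)"
    unfolding integral_restrict_space[OF S'] ind ..
  also have "\<dots> = (\<integral>z. g z \<partial>lebesgue)" using ae by (intro integral_cong_AE fm glm) auto
  also have "\<dots> = (\<integral>z. g z \<partial>lborel)" by (rule integral_completion[OF gl])
  finally show "(\<integral>z. f z \<partial>lebesgue_on S) = (\<integral>z. g z \<partial>lborel)" .
  have "integrable (lebesgue_on S) f \<longleftrightarrow> integrable lebesgue (\<lambda>z. if z \<in> S then f z else 0)"
    unfolding integrable_restrict_space[OF S'] ind ..
  also have "\<dots> \<longleftrightarrow> integrable lebesgue g" using ae by (intro integrable_cong_AE fm glm) auto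
  also have "\<dots> \<longleftrightarrow> integrable lborel g" by (rule integrable_completion[OF gl])
  finally show "integrable (lebesgue_on S) f \<longleftrightarrow> integrable lborel g" .
qed

text \<open>\<open>S\<close> is where \<open>f\<close> is given and \<open>T\<close> where its
  values are kept. For elements of \<open>X_space\<close> these are the whole space and \<Omega>,
  for the weight both are \<Omega>.\<close>

lemma lebesgue_on_borel_representative:
  fixes f :: "'a::euclidean_space \<Rightarrow> real"
  assumes f: "f \<in> borel_measurable (lebesgue_on S)" and S: "S \<in> sets lebesgue" and T: "T \<in> sets borel" "T \<subseteq> S"
  obtains g where "g \<in> borel_measurable borel" "\<And>x. x \<notin> T \<Longrightarrow> g x = 0" "AE x in lborel. x \<in> T \<longrightarrow> f x = g x"
proof -
  obtain g where g: "g \<in> borel_measurable lborel" "AE x in lborel. (if x \<in> S then f x else 0) = g x"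
    using completion_ex_borel_measurable_real[OF borel_measurable_if_I[OF f S]] by blast
  have [measurable]: "g \<in> borel_measurable borel" "T \<in> sets borel" using g T by auto
  show thesis
  proof (rule that[of "\<lambda>x. indicator T x * g x"])
    show "AE x in lborel. x \<in> T \<longrightarrow> f x = indicator T x * g x"
      using g(2) by eventually_elim (use T in \<open>auto split: if_splits\<close>)
  qed auto
qed

lemma Q_set_sets: "open \<Omega> \<Longrightarrow> Q_set (\<Omega> :: 'a::euclidean_space set) \<in> sets lebesgue"
proof -
  assume "open \<Omega>"
  then have "closed ((- \<Omega>) \<times> (- \<Omega>))" by (intro closed_Times) (auto simp: closed_Compl)
  then have "open (Q_set \<Omega>)" unfolding Q_set_def by (auto intro: open_Diff)
  then show ?thesis by auto
qed

locale choquard_cart = choquard_data \<Omega> a s1 s2 \<mu> p q r d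
  for \<Omega> :: "(real ^ 'n) set" and a s1 s2 \<mu> p q r d
begin

lemma dim [simp]: "real DIM(real ^ 'n) = real CARD('n)" by simp

lemma kernel_quotient:
  "x * norm w powr (- (real DIM(real ^ 'n) + \<tau>)) = x / norm w powr (real CARD('n) + \<tau>)"
  by (simp only: dim powr_minus divide_inverse)

lemma gform_cong:
  assumes u: "u \<in> X" and v: "v \<in> X" and eq: "AE x in lborel. u x = v x"
  shows "gform t s u = gform t s v"
  unfolding gform_def
proof (rule integral_cong_AE)
  have [measurable]: "u \<in> borel_measurable borel" "v \<in> borel_measurable borel" using XD u v by auto
  show "gagliardo_density t s u \<in> borel_measurable lborel" "gagliardo_density t s v \<in> borel_measurable lborel" by measurable
  show "AE z in lborel. gagliardo_density t s u z = gagliardo_density t s v z"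
    using AE_lborel_fst_snd(1)[OF eq, where 'b = "real ^ 'n"] AE_lborel_fst_snd(2)[OF eq, where 'b = "real ^ 'n"]
    by eventually_elim (simp add: gagliardo_density_def)
qed

text \<open>A pair outside \<open>Q_set \<Omega>\<close> has both points off \<Omega>, where
  \<open>u\<close> is 0, so extending the domain to all pairs adds nothing.\<close>

lemma gagliardo_integrand:
  assumes t: "0 < t" and u: "u \<in> bsupp \<Omega>" and eq: "AE x in lborel. v x = u x"
  shows "integrable (lebesgue_on (Q_set \<Omega>)) (\<lambda>(x, y). \<bar>v x - v y\<bar> powr t / norm (x - y) powr (real CARD('n) + t * s))
    \<longleftrightarrow> integrable lborel (gagliardo_density t s u)"
proof (rule lebesgue_on_eq_lborel(2)[OF Q_set_sets[OF \<Omega>(2)]])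
  show "gagliardo_density t s u \<in> borel_measurable borel" using bsuppD(1)[OF u] by measurable
  show "AE z in lborel. (if z \<in> Q_set \<Omega> then case z of (x, y) \<Rightarrow> \<bar>v x - v y\<bar> powr t / norm (x - y) powr (real CARD('n) + t * s) else 0)
      = gagliardo_density t s u z"
    using AE_lborel_fst_snd(1)[OF eq, where 'b = "real ^ 'n"] AE_lborel_fst_snd(2)[OF eq, where 'b = "real ^ 'n"]
  proof eventually_elim
    case (elim z)
    then show ?case unfolding gagliardo_density_def kernel_quotient using bsuppD(2)[OF u] t
      by (cases z) (auto simp: Q_set_def)
  qed
qed

lemma X_subset: assumes u: "u \<in> X" shows "u \<in> X_space \<Omega> 2 s1"
proof -
  have [measurable]: "u \<in> borel_measurable borel" using XD(2)[OF u] .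
  have i: "integrable lborel (\<lambda>x. \<bar>u x\<bar> powr 2)" using X_integrable[OF u, of 2] S_gt_2 by simp
  have m: "u \<in> borel_measurable lborel" by simp
  have "integrable (lebesgue_on UNIV) (\<lambda>x. \<bar>u x\<bar> powr 2)"
  proof (rule lebesgue_on_eq_lborel(2)[THEN iffD2, OF _ _ _ i])
    show "(\<lambda>x. \<bar>u x\<bar> powr 2) \<in> borel_measurable borel" by measurable
  qed simp_all
  then have "u \<in> Lp_on 2 UNIV"
    unfolding Lp_on_def using measurable_completion[OF m] by (simp del: powr_numeral)
  moreover have "integrable (lebesgue_on (Q_set \<Omega>)) (\<lambda>(x, y). \<bar>u x - u y\<bar> powr 2 / norm (x - y) powr (real CARD('n) + 2 * s1))"
    by (subst gagliardo_integrand[of 2 u u]) (use X_gagliardo(3)[OF u] XD(1)[OF u] in auto)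
  moreover have "AE x in lebesgue. x \<notin> \<Omega> \<longrightarrow> u x = 0" using XD(4)[OF u] by simp
  ultimately show ?thesis by (simp add: X_space_def del: powr_numeral)
qed

text \<open>Test functions are Lebesgue measurable and vanish off \<Omega> only almost everywhere.
  The representative in \<open>X\<close> makes the critical point equation, known for
  \<open>X\<close>, available for all of them.\<close>

lemma X_space_representative:
  assumes v: "v \<in> X_space \<Omega> 2 s1"
  obtains v' where "v' \<in> X" "AE x in lborel. v x = v' x"
proof -
  have vm: "v \<in> borel_measurable (lebesgue_on UNIV)" and off: "AE x in lebesgue. x \<notin> \<Omega> \<longrightarrow> v x = 0"
    and int: "integrable (lebesgue_on (Q_set \<Omega>)) (\<lambda>(x, y). \<bar>v x - v y\<bar> powr 2 / norm (x - y) powr (real CARD('n) + 2 * s1))"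
    using v unfolding X_space_def Lp_on_def by auto
  obtain v' where v': "v' \<in> borel_measurable borel" "\<And>x. x \<notin> \<Omega> \<Longrightarrow> v' x = 0" "AE x in lborel. x \<in> \<Omega> \<longrightarrow> v x = v' x"
    using lebesgue_on_borel_representative[OF vm _ \<Omega>_borel] by auto
  have "AE x in lborel. x \<notin> \<Omega> \<longrightarrow> v x = 0" using off by (simp add: AE_completion_iff)
  with v'(3) have eq: "AE x in lborel. v x = v' x" by eventually_elim (use v'(2) in auto)
  have b: "v' \<in> bsupp \<Omega>" using v' by (simp add: bsupp_def)
  have i: "integrable lborel (gagliardo_density 2 s1 v')"
    using int gagliardo_integrand[OF _ b eq, of 2 s1] by simp
  have "gagliardo 2 s1 v' = ennreal (\<integral>z. gagliardo_density 2 s1 v' z \<partial>lborel)"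
    unfolding gagliardo_def using i by (intro nn_integral_eq_integral) auto
  then have "v' \<in> X" using b by (simp add: X_def)
  then show thesis using that eq by blast
qed

text \<open>After extension by zero the integrands agree almost everywhere, because every form
  contains a factor of \<open>u\<close> that vanishes off the set of integration.\<close>

lemma forms_eq:
  assumes u: "u \<in> X" and h: "h \<in> X" and eq: "AE x in lborel. v x = h x"
  shows "K_form \<Omega> t s u v = gform' t s u h"
    and "A_form \<Omega> \<mu> r u v = A' u h"
    and "AE x in lborel. x \<in> \<Omega> \<longrightarrow> a0 x = a x \<Longrightarrow>
      (LINT x | lebesgue_on \<Omega>. a0 x * \<bar>u x\<bar> powr (q - 2) * u x * v x) = H' u h"
proof -
  have [measurable]: "u \<in> borel_measurable borel" "h \<in> borel_measurable borel" using XD u h by auto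
  note eq2 = AE_lborel_fst_snd(1)[OF eq, where 'b = "real ^ 'n"] AE_lborel_fst_snd(2)[OF eq, where 'b = "real ^ 'n"]
  show "K_form \<Omega> t s u v = gform' t s u h"
    unfolding K_form_def gform'_def
  proof (rule lebesgue_on_eq_lborel(1)[OF Q_set_sets[OF \<Omega>(2)]])
    show "AE z in lborel. (if z \<in> Q_set \<Omega> then case z of (x, y) \<Rightarrow> \<bar>u x - u y\<bar> powr (t - 2) * (u x - u y) * (v x - v y)
          / norm (x - y) powr (real CARD('n) + t * s) else 0)
        = \<bar>u (fst z) - u (snd z)\<bar> powr (t - 2) * (u (fst z) - u (snd z)) * (h (fst z) - h (snd z)) * norm (fst z - snd z) powr (- (real DIM(real ^ 'n) + t * s))"
      using eq2
    proof eventually_elim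
      case (elim z)
      then show ?case unfolding kernel_quotient using XD(4)[OF u]
        by (cases z) (auto simp: Q_set_def)
    qed
  qed measurable
  show "A_form \<Omega> \<mu> r u v = A' u h"
    unfolding A_form_def A'_def
  proof (rule lebesgue_on_eq_lborel(1))
    have "open (\<Omega> \<times> \<Omega>)" using \<Omega>(2) by (intro open_Times)
    then show "\<Omega> \<times> \<Omega> \<in> sets lebesgue" by auto
    show "AE z in lborel. (if z \<in> \<Omega> \<times> \<Omega> then case z of (x, y) \<Rightarrow> \<bar>u y\<bar> powr r * \<bar>u x\<bar> powr (r - 2) * u x * v x / norm (x - y) powr \<mu> else 0)
        = \<bar>u (snd z)\<bar> powr r * (\<bar>u (fst z)\<bar> powr (r - 2) * u (fst z) * h (fst z)) * choquard_kernel z"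
      using eq2
    proof eventually_elim
      case (elim z)
      then show ?case using XD(4)[OF u] r
        by (cases z) (auto simp: choquard_kernel_def powr_minus_divide)
    qed
  qed measurable
  show "(LINT x | lebesgue_on \<Omega>. a0 x * \<bar>u x\<bar> powr (q - 2) * u x * v x) = H' u h"
    if "AE x in lborel. x \<in> \<Omega> \<longrightarrow> a0 x = a x"
    unfolding H'_def
  proof (rule lebesgue_on_eq_lborel(1))
    show "AE x in lborel. (if x \<in> \<Omega> then a0 x * \<bar>u x\<bar> powr (q - 2) * u x * v x else 0) = \<bar>u x\<bar> powr (q - 2) * u x * h x * a x"
      using that eq by eventually_elim (simp add: XD(4)[OF u] mult_ac)
  qed auto
qed

lemma weak_solution_of_critical:
  assumes u: "u \<in> X" and a0: "AE x in lborel. x \<in> \<Omega> \<longrightarrow> a0 x = a x"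
    and crit: "\<forall>h\<in>X. gform' 2 s1 u h + \<beta> * gform' p s2 u h - lam * H' u h - A' u h = 0"
  shows "weak_solution \<Omega> s1 s2 p q r \<mu> a0 lam \<beta> u"
  unfolding weak_solution_def
proof (intro conjI ballI X_subset u)
  fix v assume "v \<in> X_space \<Omega> 2 s1"
  then obtain h where h: "h \<in> X" "AE x in lborel. v x = h x" by (rule X_space_representative)
  then show "K_form \<Omega> 2 s1 u v + \<beta> * K_form \<Omega> p s2 u v
      - lam * (LINT x | lebesgue_on \<Omega>. a0 x * \<bar>u x\<bar> powr (q - 2) * u x * v x) - A_form \<Omega> \<mu> r u v = 0"
    using crit by (simp add: forms_eq(1,2)[OF u h] forms_eq(3)[OF u h a0])
qed

lemma two_weak_solutions:
  assumes a0: "AE x in lborel. x \<in> \<Omega> \<longrightarrow> a0 x = a x"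
  shows "\<exists>lam0>0. \<forall>lam. 0 < lam \<and> lam < lam0 \<longrightarrow> (\<forall>\<beta>>0.
           \<exists>u v. weak_solution \<Omega> s1 s2 p q r \<mu> a0 lam \<beta> u \<and> nontrivial_nonneg u \<and>
                 weak_solution \<Omega> s1 s2 p q r \<mu> a0 lam \<beta> v \<and> nontrivial_nonneg v \<and>
                 \<not> (AE x in lebesgue. u x = v x))"
proof -
  obtain C where fib: "fibering X (gform 2 s1) (gform p s2) H A (gform' 2 s1) (gform' p s2) H' A' p q r C"
    using fibering by blast
  obtain l0 where l0: "l0 > 0" "\<forall>lam. 0 < lam \<and> lam < l0 \<longrightarrow> (\<forall>b>0. \<exists>u\<in>X. \<exists>v\<in>X.
     (\<forall>x. 0 \<le> u x) \<and> (\<forall>x. 0 \<le> v x) \<and> 0 < gform 2 s1 u \<and> gform 2 s1 u < gform 2 s1 v \<and>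
     (\<forall>h\<in>X. gform' 2 s1 u h + b * gform' p s2 u h - lam * H' u h - A' u h = 0) \<and>
     (\<forall>h\<in>X. gform' 2 s1 v h + b * gform' p s2 v h - lam * H' v h - A' v h = 0))"
    using fibering.two_critical_points[OF fib] by (elim exE conjE) (rule that)
  have nontriv: "nontrivial_nonneg u" if "u \<in> X" "0 < gform 2 s1 u" "\<forall>x. 0 \<le> u x" for u
    using that gform_zero[of u 2 s1] by (auto simp: nontrivial_nonneg_def AE_completion_iff)
  show ?thesis
  proof (intro exI[of _ l0] conjI l0(1) allI impI)
    fix lam \<beta> :: real assume "0 < lam \<and> lam < l0" "0 < \<beta>"
    then obtain u v where u: "u \<in> X" "\<forall>x. 0 \<le> u x" "0 < gform 2 s1 u"
        "\<forall>h\<in>X. gform' 2 s1 u h + \<beta> * gform' p s2 u h - lam * H' u h - A' u h = 0"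
      and v: "v \<in> X" "\<forall>x. 0 \<le> v x" "gform 2 s1 u < gform 2 s1 v"
        "\<forall>h\<in>X. gform' 2 s1 v h + \<beta> * gform' p s2 v h - lam * H' v h - A' v h = 0"
      using l0(2) by blast
    \<comment> \<open>Functions that agree almost everywhere have equal seminorms, whereas the two
      solutions have different ones.\<close>
    have "\<not> (AE x in lborel. u x = v x)" using gform_cong[OF u(1) v(1), of 2 s1] v(3) by auto
    then show "\<exists>u v. weak_solution \<Omega> s1 s2 p q r \<mu> a0 lam \<beta> u \<and> nontrivial_nonneg u \<and>
                 weak_solution \<Omega> s1 s2 p q r \<mu> a0 lam \<beta> v \<and> nontrivial_nonneg v \<and>
                 \<not> (AE x in lebesgue. u x = v x)"
      using weak_solution_of_critical[OF u(1) a0 u(4)] weak_solution_of_critical[OF v(1) a0 v(4)]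
        nontriv[OF u(1,3,2)] nontriv[OF v(1) _ v(2)] u(3) v(3)
      by (intro exI[of _ u] exI[of _ v]) (simp add: AE_completion_iff)
  qed
qed

end

theorem theorem1p2:
  fixes \<Omega> :: "(real ^ 'n) set"
    and a :: "real ^ 'n \<Rightarrow> real"
    and s1 s2 \<mu> p q d r :: real
  assumes "bounded_C2_domain \<Omega>"
    and "0 < s2" and "s2 < s1" and "s1 < 1"
    and "real CARD('n) > 2 * s1"
    and "0 < \<mu>" and "\<mu> < real CARD('n)"
    and "1 < q" and "q < p" and "p < 2"
    and "q < d" and "d < crit_sobolev (real CARD('n)) s1"
    and "a \<in> Lp_on (d / (d - q)) \<Omega>"
    and "sign_changing_on \<Omega> a"
    and "\<not> (AE x in lebesgue_on \<Omega>. max (a x) 0 = 0)"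
    and "1 < r" and "r < crit_choquard (real CARD('n)) s1 \<mu>"
  shows "\<exists>lam0>0. \<forall>lam. 0 < lam \<and> lam < lam0 \<longrightarrow> (\<forall>\<beta>>0.
           \<exists>u v. weak_solution \<Omega> s1 s2 p q r \<mu> a lam \<beta> u \<and> nontrivial_nonneg u \<and>
                 weak_solution \<Omega> s1 s2 p q r \<mu> a lam \<beta> v \<and> nontrivial_nonneg v \<and>
                 \<not> (AE x in lebesgue. u x = v x))"
proof -
  have \<Omega>: "bounded \<Omega>" "open \<Omega>" using assms(1) by (auto simp: bounded_C2_domain_def)
  have S: "\<Omega> \<in> sets lebesgue" and B: "\<Omega> \<in> sets borel" using \<Omega>(2) by auto
  have am: "a \<in> borel_measurable (lebesgue_on \<Omega>)"
    and ai: "integrable (lebesgue_on \<Omega>) (\<lambda>x. \<bar>a x\<bar> powr (d / (d - q)))"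
    using assms(13) by (auto simp: Lp_on_def)
  \<comment> \<open>The weight is replaced by a Borel representative that is zero off \<Omega>;
    equality almost everywhere on \<Omega> carries the hypotheses over to \<open>a'\<close> and the
    solutions back to \<open>a\<close>.\<close>
  obtain a' where a': "a' \<in> borel_measurable borel" "\<And>x. x \<notin> \<Omega> \<Longrightarrow> a' x = 0" "AE x in lborel. x \<in> \<Omega> \<longrightarrow> a x = a' x"
    using lebesgue_on_borel_representative[OF am S B order_refl] by blast
  interpret choquard_cart \<Omega> a' s1 s2 \<mu> p q r d
  proof unfold_locales
    show "integrable lborel (\<lambda>x. \<bar>a' x\<bar> powr (d / (d - q)))"
    proof (rule lebesgue_on_eq_lborel(2)[OF S, THEN iffD1, OF _ _ ai])
      show "AE z in lborel. (if z \<in> \<Omega> then \<bar>a z\<bar> powr (d / (d - q)) else 0) = \<bar>a' z\<bar> powr (d / (d - q))"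
        using a'(3) by eventually_elim (use a'(2) in auto)
    qed (use a'(1) in measurable)
    show "\<not> (AE x in lborel. max (a' x) 0 = 0)"
    proof
      assume "AE x in lborel. max (a' x) 0 = 0"
      with a'(3) have "AE x in lborel. x \<in> \<Omega> \<longrightarrow> max (a x) 0 = 0" by eventually_elim auto
      then have "AE x in lebesgue_on \<Omega>. max (a x) 0 = 0"
        using S by (simp add: AE_restrict_space_iff AE_completion_iff)
      then show False using assms(15) by blast
    qed
  qed (use assms \<Omega> a' in simp_all)
  show ?thesis using two_weak_solutions[OF a'(3)] .
qed

end
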